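(* Let $n\ge 1$. Let $\varphi\colon\mathbb{R}^n\to\mathbb{R}_+\cup\{+\infty\}$ be lower semicontinuous. Let $L\colon\mathbb{R}^n\times\mathbb{R}^n\to\mathbb{R}_+$ be locally bounded and lower semicontinuous, with $L(x,\cdot)$ convex for every $x\in\mathbb{R}^n$, and suppose there exists a function $\Theta\colon\mathbb{R}^n\to\mathbb{R}_+$ with $\lim_{|u|\to\infty}\Theta(u)/|u|=+\infty$ and $L(x,u)\ge\Theta(u)$ for all $(x,u)\in\mathbb{R}^n\times\mathbb{R}^n$. Assume moreover that $L$ is continuous on $\mathbb{R}^n\times\mathbb{R}^n$. Let $H$ be the Hamiltonian and $V$ the value function associated with $L$ and $\varphi$ (defined in the context). Let $W\colon\mathbb{R}_+^\star\times\mathbb{R}^n\to\mathbb{R}_+\cup\{+\infty\}$ be a lower semicontinuous function such that: (i) for every $x\in\mathbb{R}^n$, $\liminf_{h\to0+,\,y\to x}W(h,y)=\varphi(x)$; (ii) for every $(t,x)\in\mathrm{dom}(W)$ (so $t>0$), $D_\uparrow W(t,x)(0,0)=0$; (iii) for every $(t,x)\in\mathrm{dom}(W)$ (so $t>0$) there exists $u\in\mathbb{R}^n$ such that $D_\uparrow W(t,x)(-1,u)<+\infty$; (iv) for every $(t,x)\in\mathbb{R}_+^\star\times\mathbb{R}^n$ and every $(p_t,p_x)\in\partial_-W(t,x)$, $\ p_t+H(x,-p_x)=0$. Then $W=V$ on $\mathbb{R}_+^\star\times\mathbb{R}^n$.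
   Context: Notation: $\mathbb{R}_+=[0,+\infty)$, $\mathbb{R}_+^\star=\mathbb{R}_+\setminus\{0\}$; $\langle\cdot,\cdot\rangle$ is the Euclidean scalar product and $|\cdot|$ the Euclidean norm. $\mathrm{dom}(W)$ is the set of points where $W$ is finite. The Hamiltonian is $H(x,p):=\sup_{u\in\mathbb{R}^n}\left(\langle p,u\rangle-L(x,u)\right)$ for $x,p\in\mathbb{R}^n$. The value function $V\colon\mathbb{R}_+\times\mathbb{R}^n\to\mathbb{R}_+\cup\{+\infty\}$ is $$V(t,x):=\min\left\{\int_0^tL(y(s),y'(s))\,ds+\varphi(y(t)):\ y\in W^{1,1}(0,t;\mathbb{R}^n),\ y(0)=x\right\},$$ with $V(0,x)=\varphi(x)$. Here $W^{1,1}(0,t;\mathbb{R}^n)$ is the space of absolutely continuous functions $y\colon[0,t]\to\mathbb{R}^n$. For a function $W$ of $z\in\mathbb{R}^m$ (here $m=n+1$, $z=(t,x)$) and a point $z\in\mathrm{dom}(W)$, the subdifferential is $$\partial_-W(z):=\left\{p\in\mathbb{R}^m:\ \liminf_{z'\to z}\frac{W(z')-W(z)-\langle p,z'-z\rangle}{|z'-z|}\ge0\right\}$$ (it is only defined at points of $\mathrm{dom}(W)$; conditions quantified over $\partial_-W(z)$ are void when $z\notin\mathrm{dom}(W)$), and the contingent directional derivative in the direction $w\in\mathbb{R}^m$ is $$D_\uparrow W(z)(w):=\liminf_{h\to0+,\ v\to w}\frac{W(z+hv)-W(z)}{h}\in[-\infty,+\infty].$$ *)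

theory Defs
  imports "HOL-Analysis.Analysis"
begin

text \<open>
  Functions with values in \<open>\<real>\<^sub>+ \<union> {+\<infinity>}\<close> are nonnegative \<^typ>\<open>ereal\<close>-valued functions, so that
  difference quotients can take values in \<open>[-\<infinity>, +\<infinity>]\<close>.  A function of \<open>(t, x)\<close> defined for
  \<open>t > 0\<close> only is a function on \<open>\<real> \<times> \<real>\<^sup>n\<close> whose values at \<open>t \<le> 0\<close> are irrelevant: the limits
  below are local and are only taken at points with \<open>t > 0\<close>, or along \<open>t \<rightarrow> 0+\<close>.
\<close>

definition lsc_on :: "'a::topological_space set \<Rightarrow> ('a \<Rightarrow> ereal) \<Rightarrow> bool" where
  "lsc_on S f \<longleftrightarrow> (\<forall>x\<in>S. f x \<le> Liminf (at x within S) f)"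

definition locally_bounded :: "('a::metric_space \<Rightarrow> real) \<Rightarrow> bool" where
  "locally_bounded f \<longleftrightarrow> (\<forall>x. \<exists>r>0. bounded (f ` ball x r))"

definition dom_on :: "'a set \<Rightarrow> ('a \<Rightarrow> ereal) \<Rightarrow> 'a set" where
  "dom_on S W = {z\<in>S. \<bar>W z\<bar> \<noteq> \<infinity>}"

definition hamiltonian :: "('a::euclidean_space \<times> 'a \<Rightarrow> real) \<Rightarrow> 'a \<Rightarrow> 'a \<Rightarrow> ereal" where
  "hamiltonian L x p = (SUP u. ereal (p \<bullet> u - L (x, u)))"

text \<open>
  In the next definition \<open>D\<close> ranges over the finite families of nonoverlapping compact
  subintervals of \<open>[a, b]\<close>; \<open>Inf K\<close> and \<open>Sup K\<close> are the endpoints of the interval \<open>K\<close>.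
\<close>

definition abs_continuous_on_interval ::
    "real \<Rightarrow> real \<Rightarrow> (real \<Rightarrow> 'a::real_normed_vector) \<Rightarrow> bool" where
  "abs_continuous_on_interval a b y \<longleftrightarrow>
     (\<forall>\<epsilon>>0. \<exists>\<delta>>0. \<forall>D. D division_of \<Union>D \<and> \<Union>D \<subseteq> {a..b} \<and> (\<Sum>K\<in>D. Sup K - Inf K) < \<delta>
        \<longrightarrow> (\<Sum>K\<in>D. norm (y (Sup K) - y (Inf K))) < \<epsilon>)"

text \<open>
  An absolutely continuous \<open>y\<close> is differentiable almost everywhere on \<open>[0, t]\<close>; the arbitrary value
  of \<^const>\<open>vector_derivative\<close> at the remaining points does not affect the integral.  The integral
  is taken with respect to the complete measure \<^const>\<open>lebesgue\<close> because this derivative, set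
  arbitrarily on a null set, need not be Borel measurable.
\<close>

definition cost ::
    "('a::euclidean_space \<times> 'a \<Rightarrow> real) \<Rightarrow> ('a \<Rightarrow> ereal) \<Rightarrow> real \<Rightarrow> (real \<Rightarrow> 'a) \<Rightarrow> ereal" where
  "cost L \<phi> t y =
     enn2ereal (\<integral>\<^sup>+s\<in>{0..t}. ennreal (L (y s, vector_derivative y (at s within {0..t}))) \<partial>lebesgue)
     + \<phi> (y t)"

text \<open>
  The minimum in the definition of the value function is written as an infimum; the two agree
  whenever the minimum exists.
\<close>

definition value_function ::
    "('a::euclidean_space \<times> 'a \<Rightarrow> real) \<Rightarrow> ('a \<Rightarrow> ereal) \<Rightarrow> real \<times> 'a \<Rightarrow> ereal" where
  "value_function L \<phi> = (\<lambda>(t, x). INF y\<in>{y. abs_continuous_on_interval 0 t y \<and> y 0 = x}. cost L \<phi> t y)"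

lemma value_function_at_0: "value_function L \<phi> (0, x) = \<phi> x"
proof -
  have c: "cost L \<phi> 0 y = \<phi> (y 0)" for y
  proof -
    have "AE s in lebesgue. s \<noteq> (0::real)"
      by (rule AE_I[where N = "{0}"]) auto
    hence "(\<integral>\<^sup>+s\<in>{0..0}. ennreal (L (y s, vector_derivative y (at s within {0..0}))) \<partial>lebesgue)
        = (\<integral>\<^sup>+(s::real). 0 \<partial>lebesgue)"
      by (intro nn_integral_cong_AE) (auto elim!: eventually_mono simp: indicator_def)
    thus ?thesis by (simp add: cost_def zero_ennreal.rep_eq)
  qed
  have a: "abs_continuous_on_interval 0 0 (\<lambda>_. x)"
    by (auto simp: abs_continuous_on_interval_def intro: exI[of _ 1])
  show ?thesis
    unfolding value_function_def prod.case using a c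
    by (intro antisym INF_greatest INF_lower2[where i = "\<lambda>_. x"]) auto
qed

definition subdifferential :: "('a::euclidean_space \<Rightarrow> ereal) \<Rightarrow> 'a \<Rightarrow> 'a set" where
  "subdifferential W z =
     {p. \<bar>W z\<bar> \<noteq> \<infinity> \<and>
         0 \<le> Liminf (at z) (\<lambda>z'. (W z' - W z - ereal (p \<bullet> (z' - z))) / ereal (norm (z' - z)))}"

text \<open>
  In the contingent derivative the limit \<open>v \<rightarrow> w\<close> includes \<open>v = w\<close>, so that its epigraph is the
  contingent cone to the epigraph of \<open>W\<close>.
\<close>

definition contingent_derivative :: "('a::euclidean_space \<Rightarrow> ereal) \<Rightarrow> 'a \<Rightarrow> 'a \<Rightarrow> ereal" where
  "contingent_derivative W z w =
     Liminf (at_right 0 \<times>\<^sub>F nhds w) (\<lambda>(h, v). (W (z + h *\<^sub>R v) - W z) / ereal h)"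

end

theory Submission
  imports Defs
begin

text \<open>
  Subgradient information is turned into growth estimates for \<open>W\<close> by a mean value argument: minimizing
  \<open>W (z\<^sub>0 + A q + d) + n \<bar>d\<bar>\<^sup>2 + g q\<close> over \<open>d\<close> and over a cone of directions \<open>q\<close> yields a subgradient at a
  point close to \<open>z\<^sub>0 + A q\<close> that controls all directions of the cone at once.

  For \<open>V \<le> W\<close> the cone consists of the directions \<open>(-\<tau>, u, -\<rho>)\<close> with \<open>\<rho> \<ge> \<tau> L (x, u / \<tau>)\<close>; its base is compact
  because \<open>L\<close> is superlinear.  If \<open>W\<close> did not descend along any of these directions, some subgradient
  would satisfy \<open>p\<^sub>t + H (x, -p\<^sub>x) < 0\<close>.  Directions with \<open>\<tau> = 0\<close> are excluded by the condition on
  the contingent derivative at \<open>(0, 0)\<close>.  Hence from every point there is a short segment along which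
  \<open>W\<close> plus the running cost grows by at most \<open>\<epsilon> h\<close>, and a greedy concatenation of such segments reaches \<open>t = 0\<close>.

  For \<open>W \<le> V\<close> the cone is a single ray, which gives the inequality along segments.  An absolutely
  continuous curve is replaced by a polygon: it is slowed down where its speed exceeds \<open>M\<close>, which
  changes the total time and the cost only by \<open>O(1/M)\<close>, and Jensen's inequality bounds the cost of the
  chords.  The end points and the final time are matched only in the limit, by lower semicontinuity of \<open>W\<close>.
\<close>

section \<open>Absolutely continuous curves\<close>

text \<open>The variable t is the time left, so a curve run with velocity u moves (t, x) in the
  direction (-1, u); this fixes all signs. The two halves of the equation act separately: p_t + H
  \<le> 0, tested at one velocity, limits the growth of W along segments and hence along curves,
  while p_t + H \<ge> 0 supplies, up to an error, a velocity of descent. The initial condition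
  splits likewise: liminf \<ge> \<phi> closes the descent at t = 0, liminf \<le> \<phi> provides
  starting points for the growth estimate. The obstacle is that W is only lower semicontinuous:
  subgradients are found merely near the points of interest, and upper bounds of W do not pass to
  neighbouring points. Every estimate therefore meets L at displaced points, which its continuity on
  compact sets absorbs, and the descent cone collects the velocities of all x in a ball. Since
  velocities are unbounded, directions are normalized by duration plus cost, \<tau> + \<rho>,
  instead of duration; the price is the possible limit \<tau> = 0. Costs involve derivatives that
  exist almost everywhere, hence the preliminary theory of absolutely continuous curves.\<close>

definition nonoverlapping :: "(real \<times> real) set \<Rightarrow> bool" where
  "nonoverlapping P \<longleftrightarrow> finite P \<and> (\<forall>p\<in>P. fst p < snd p) \<and>
     (\<forall>p\<in>P. \<forall>q\<in>P. p \<noteq> q \<longrightarrow> snd p \<le> fst q \<or> snd q \<le> fst p)"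

definition total_length :: "(real \<times> real) set \<Rightarrow> real" where
  "total_length P = (\<Sum>p\<in>P. snd p - fst p)"

definition sum_increments :: "(real \<Rightarrow> 'a::real_normed_vector) \<Rightarrow> (real \<times> real) set \<Rightarrow> real" where
  "sum_increments y P = (\<Sum>p\<in>P. norm (y (snd p) - y (fst p)))"

text \<open>A curve on [a, b] is first extended by constants (\<open>clamp_real\<close>).
  Truncations such as \<open>min s b\<close> can then be applied to the intervals without tracking
  end points.\<close>

definition abs_continuous :: "(real \<Rightarrow> 'a::real_normed_vector) \<Rightarrow> bool" where
  "abs_continuous y \<longleftrightarrow>
     (\<forall>\<epsilon>>0. \<exists>\<delta>>0. \<forall>P. nonoverlapping P \<and> total_length P < \<delta> \<longrightarrow> sum_increments y P < \<epsilon>)"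

text \<open>In use, \<open>\<phi>\<close> is a truncation (\<open>min\<close>, \<open>max\<close>,
  \<open>clamp_real\<close>) that cuts a family at a point; intervals collapsed by it are dropped
  because \<open>nonoverlapping\<close> asks for positive length.\<close>

definition map_intervals :: "(real \<Rightarrow> real) \<Rightarrow> (real \<times> real) set \<Rightarrow> (real \<times> real) set" where
  "map_intervals \<phi> P = {p \<in> (\<lambda>p. (\<phi> (fst p), \<phi> (snd p))) ` P. fst p < snd p}"

lemma map_intervalsE:
  assumes "p \<in> map_intervals \<phi> P"
  obtains q where "q \<in> P" "fst p = \<phi> (fst q)" "snd p = \<phi> (snd q)"
  using assms by (auto simp: map_intervals_def)

lemma nonoverlapping_map:
  assumes P: "nonoverlapping P" and \<phi>: "mono \<phi>"
  shows "nonoverlapping (map_intervals \<phi> P)"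
proof -
  have fin: "finite P" using P by (simp add: nonoverlapping_def)
  have "snd p \<le> fst q \<or> snd q \<le> fst p"
    if "p \<in> map_intervals \<phi> P" "q \<in> map_intervals \<phi> P" "p \<noteq> q" for p q
  proof -
    from that(1) obtain p' where p': "p' \<in> P" "fst p = \<phi> (fst p')" "snd p = \<phi> (snd p')"
      by (rule map_intervalsE)
    from that(2) obtain q' where q': "q' \<in> P" "fst q = \<phi> (fst q')" "snd q = \<phi> (snd q')"
      by (rule map_intervalsE)
    have "p' \<noteq> q'" using that(3) p' q' by (auto simp: prod_eq_iff)
    hence "snd p' \<le> fst q' \<or> snd q' \<le> fst p'" using P p'(1) q'(1) by (auto simp: nonoverlapping_def)
    thus ?thesis using monoD[OF \<phi>] p' q' by metis
  qed
  thus ?thesis using fin by (auto simp: nonoverlapping_def map_intervals_def)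
qed

text \<open>Collapsed intervals contribute \<open>h a a = 0\<close>. On the others the image map is
  injective: two equal nondegenerate images would overlap, while monotonicity keeps the order of the
  intervals.\<close>

lemma sum_map_intervals:
  assumes P: "nonoverlapping P" and \<phi>: "mono \<phi>" and h: "\<And>a. h a a = (0::real)"
  shows "(\<Sum>p\<in>map_intervals \<phi> P. h (fst p) (snd p)) = (\<Sum>p\<in>P. h (\<phi> (fst p)) (\<phi> (snd p)))"
proof -
  define f where "f = (\<lambda>p. (\<phi> (fst p), \<phi> (snd p)))"
  define P0 where "P0 = {p\<in>P. \<phi> (fst p) < \<phi> (snd p)}"
  have fin: "finite P" using P by (simp add: nonoverlapping_def)
  have eq: "map_intervals \<phi> P = f ` P0"
    by (auto simp: map_intervals_def f_def P0_def)
  have inj: "inj_on f P0"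
  proof (rule inj_onI, rule ccontr)
    fix p q assume pq: "p \<in> P0" "q \<in> P0" "f p = f q" "p \<noteq> q"
    hence "snd p \<le> fst q \<or> snd q \<le> fst p" using P by (auto simp: nonoverlapping_def P0_def)
    hence "\<phi> (snd p) \<le> \<phi> (fst q) \<or> \<phi> (snd q) \<le> \<phi> (fst p)" using monoD[OF \<phi>] by blast
    thus False using pq by (auto simp: f_def P0_def)
  qed
  have "(\<Sum>p\<in>map_intervals \<phi> P. h (fst p) (snd p)) = (\<Sum>p\<in>P0. h (\<phi> (fst p)) (\<phi> (snd p)))"
    unfolding eq sum.reindex[OF inj] by (simp add: f_def)
  also have "\<dots> = (\<Sum>p\<in>P. h (\<phi> (fst p)) (\<phi> (snd p)))"
  proof (rule sum.mono_neutral_left)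
    show "finite P" by fact
    show "P0 \<subseteq> P" by (auto simp: P0_def)
    show "\<forall>p\<in>P - P0. h (\<phi> (fst p)) (\<phi> (snd p)) = 0"
    proof
      fix p assume p: "p \<in> P - P0"
      hence "fst p < snd p" using P by (auto simp: nonoverlapping_def)
      hence "\<phi> (fst p) \<le> \<phi> (snd p)" using monoD[OF \<phi>] by simp
      hence "\<phi> (fst p) = \<phi> (snd p)" using p by (auto simp: P0_def)
      thus "h (\<phi> (fst p)) (\<phi> (snd p)) = 0" using h by simp
    qed
  qed
  finally show ?thesis .
qed

lemma sum_increments_map:
  assumes "nonoverlapping P" "mono \<phi>"
  shows "sum_increments y (map_intervals \<phi> P) = (\<Sum>p\<in>P. norm (y (\<phi> (snd p)) - y (\<phi> (fst p))))"
  unfolding sum_increments_def using sum_map_intervals[OF assms, of "\<lambda>a b. norm (y b - y a)"] by simp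

lemma total_length_map:
  assumes "nonoverlapping P" "mono \<phi>"
  shows "total_length (map_intervals \<phi> P) = (\<Sum>p\<in>P. \<phi> (snd p) - \<phi> (fst p))"
  unfolding total_length_def using sum_map_intervals[OF assms, of "\<lambda>a b. b - a"] by simp

lemma nonoverlapping_subset: "nonoverlapping P \<Longrightarrow> Q \<subseteq> P \<Longrightarrow> nonoverlapping Q"
  unfolding nonoverlapping_def by (meson finite_subset subsetD)

text \<open>Induction that removes the interval with the largest left end point: all others end
  before it begins, so that left end point replaces \<open>b\<close>.\<close>

lemma sum_increments_mono:
  fixes F :: "real \<Rightarrow> real"
  assumes "nonoverlapping P" and F: "mono F" and "\<And>p. p \<in> P \<Longrightarrow> a \<le> fst p \<and> snd p \<le> b" and "a \<le> b"
  shows "(\<Sum>p\<in>P. F (snd p) - F (fst p)) \<le> F b - F a"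
proof -
  have "finite P" using assms(1) by (simp add: nonoverlapping_def)
  from this assms(1,3,4) show ?thesis
  proof (induction P arbitrary: b rule: finite_psubset_induct)
    case (psubset P)
    show ?case
    proof (cases "P = {}")
      case True thus ?thesis using psubset.prems monoD[OF F] by simp
    next
      case False
      obtain p where p: "p \<in> P" "\<And>q. q \<in> P \<Longrightarrow> fst q \<le> fst p"
      proof -
        have "Max (fst ` P) \<in> fst ` P" using psubset.hyps False by (intro Max_in) auto
        then obtain p where "p \<in> P" "fst p = Max (fst ` P)" by force
        thus ?thesis using that psubset.hyps by simp
      qed
      have q: "a \<le> fst q \<and> snd q \<le> fst p" if "q \<in> P - {p}" for q
      proof -
        have "fst q < snd q" "fst p < snd p" "snd q \<le> fst p \<or> snd p \<le> fst q"
          using that p psubset.prems(1) by (auto simp: nonoverlapping_def)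
        thus ?thesis using p(2)[of q] that psubset.prems(2)[of q] by auto
      qed
      have "(\<Sum>p\<in>P - {p}. F (snd p) - F (fst p)) \<le> F (fst p) - F a"
        by (rule psubset.IH)
           (use p q psubset.prems nonoverlapping_subset[of P] in auto)
      moreover have "F (snd p) \<le> F b" using psubset.prems(2)[OF p(1)] monoD[OF F] by blast
      moreover have "(\<Sum>p\<in>P. F (snd p) - F (fst p)) = (F (snd p) - F (fst p)) + (\<Sum>p\<in>P - {p}. F (snd p) - F (fst p))"
        by (rule sum.remove) (use p psubset.hyps in auto)
      ultimately show ?thesis by simp
    qed
  qed
qed

text \<open>Bridge to families of compact intervals: one-point members of a division carry no
  increment, and disjoint interiors force the remaining intervals to be ordered.\<close>

lemma abs_continuous_division:
  assumes y: "abs_continuous y" and "\<epsilon> > 0"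
  shows "\<exists>\<delta>>0. \<forall>D. D division_of \<Union>D \<and> (\<Sum>K\<in>D. Sup K - Inf K) < \<delta>
    \<longrightarrow> (\<Sum>K\<in>D. norm (y (Sup K) - y (Inf K))) < \<epsilon>"
proof -
  obtain \<delta> where \<delta>: "\<delta> > 0" "\<And>P. nonoverlapping P \<Longrightarrow> total_length P < \<delta> \<Longrightarrow> sum_increments y P < \<epsilon>"
    using assms unfolding abs_continuous_def by blast
  show ?thesis
  proof (intro exI[of _ \<delta>] conjI allI impI \<delta>(1))
    fix D :: "real set set"
    assume D: "D division_of \<Union> D \<and> (\<Sum>K\<in>D. Sup K - Inf K) < \<delta>"
    hence div: "D division_of \<Union> D" by blast
    define D0 where "D0 = {K\<in>D. Inf K < Sup K}"
    define f where "f = (\<lambda>K::real set. (Inf K, Sup K))"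
    have finD: "finite D" using div by (rule division_ofD)
    have K: "\<exists>l r. l \<le> r \<and> K = {l..r}" if "K \<in> D" for K
      using division_ofD(3,4)[OF div that] by (metis box_real(2) atLeastatMost_empty_iff2)
    have Kf: "K = {Inf K..Sup K}" "Inf K \<le> Sup K" if "K \<in> D" for K
      using K[OF that] by auto
    have inj: "inj_on f D0"
      by (rule inj_onI) (metis (mono_tags, lifting) D0_def Kf(1) Pair_inject f_def mem_Collect_eq)
    have disj: "Sup K \<le> Inf J \<or> Sup J \<le> Inf K" if "K \<in> D0" "J \<in> D0" "K \<noteq> J" for K J
    proof (rule ccontr)
      assume "\<not> ?thesis"
      hence c: "Inf J < Sup K" "Inf K < Sup J" by auto
      have i: "interior K \<inter> interior J = {}"
        using division_ofD(5)[OF div] that by (auto simp: D0_def)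
      have "interior K = {Inf K<..<Sup K}" "interior J = {Inf J<..<Sup J}"
        using Kf(1)[of K] Kf(1)[of J] that interior_atLeastAtMost_real unfolding D0_def
        by (metis (no_types, lifting) mem_Collect_eq)+
      with i have "{Inf K<..<Sup K} \<inter> {Inf J<..<Sup J} = {}" by simp
      moreover have "(max (Inf K) (Inf J) + min (Sup K) (Sup J)) / 2 \<in> {Inf K<..<Sup K} \<inter> {Inf J<..<Sup J}"
        using c that by (auto simp: D0_def max_def min_def)
      ultimately show False by blast
    qed
    have no: "nonoverlapping (f ` D0)"
      using finD disj by (auto simp: nonoverlapping_def D0_def f_def)
    have "total_length (f ` D0) = (\<Sum>K\<in>D0. Sup K - Inf K)"
      unfolding total_length_def sum.reindex[OF inj] by (simp add: f_def)
    also have "\<dots> \<le> (\<Sum>K\<in>D. Sup K - Inf K)"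
      by (rule sum_mono2) (use finD Kf in \<open>auto simp: D0_def\<close>)
    also have "\<dots> < \<delta>" using D by blast
    finally have "sum_increments y (f ` D0) < \<epsilon>" using \<delta>(2)[OF no] by blast
    moreover have "sum_increments y (f ` D0) = (\<Sum>K\<in>D0. norm (y (Sup K) - y (Inf K)))"
      unfolding sum_increments_def sum.reindex[OF inj] by (simp add: f_def)
    moreover have "(\<Sum>K\<in>D0. norm (y (Sup K) - y (Inf K))) = (\<Sum>K\<in>D. norm (y (Sup K) - y (Inf K)))"
      by (rule sum.mono_neutral_left) (use finD Kf in \<open>force simp: D0_def\<close>)+
    ultimately show "(\<Sum>K\<in>D. norm (y (Sup K) - y (Inf K))) < \<epsilon>" by simp
  qed
qed

lemma abs_continuous_imp_on_interval:
  "abs_continuous y \<Longrightarrow> abs_continuous_on_interval a b y"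
  unfolding abs_continuous_on_interval_def by (metis abs_continuous_division)

definition clamp_real :: "real \<Rightarrow> real \<Rightarrow> real \<Rightarrow> real" where
  "clamp_real a b s = max a (min s b)"

lemma mono_clamp_real: "mono (clamp_real a b)"
  by (auto simp: mono_def clamp_real_def)

text \<open>Clamping the end points moves a family into [a, b] without lengthening it, and there the
  increments of the clamped curve are those of \<open>y\<close>.\<close>

lemma abs_continuous_clamp:
  assumes y: "abs_continuous_on_interval a b y" and ab: "a \<le> b"
  shows "abs_continuous (\<lambda>s. y (clamp_real a b s))"
  unfolding abs_continuous_def
proof (intro allI impI)
  fix \<epsilon> :: real assume "\<epsilon> > 0"
  then obtain \<delta> where \<delta>: "\<delta> > 0"
    "\<And>D. D division_of \<Union>D \<Longrightarrow> \<Union>D \<subseteq> {a..b} \<Longrightarrow> (\<Sum>K\<in>D. Sup K - Inf K) < \<delta>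
        \<Longrightarrow> (\<Sum>K\<in>D. norm (y (Sup K) - y (Inf K))) < \<epsilon>"
    using y unfolding abs_continuous_on_interval_def by meson
  show "\<exists>\<delta>>0. \<forall>P. nonoverlapping P \<and> total_length P < \<delta> \<longrightarrow> sum_increments (\<lambda>s. y (clamp_real a b s)) P < \<epsilon>"
  proof (intro exI[of _ \<delta>] conjI allI impI \<delta>(1))
    fix P assume "nonoverlapping P \<and> total_length P < \<delta>"
    hence P: "nonoverlapping P" "total_length P < \<delta>" by auto
    define Q where "Q = map_intervals (clamp_real a b) P"
    have Q: "nonoverlapping Q" unfolding Q_def by (rule nonoverlapping_map[OF P(1) mono_clamp_real])
    define g where "g = (\<lambda>p::real\<times>real. {fst p..snd p})"
    have lt: "fst p < snd p" if "p \<in> Q" for p using that Q by (auto simp: nonoverlapping_def)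
    have rng: "a \<le> fst p" "snd p \<le> b" if "p \<in> Q" for p
      using that ab unfolding Q_def by (auto elim!: map_intervalsE simp: clamp_real_def)
    have inj: "inj_on g Q"
    proof (rule inj_onI)
      fix p q assume "p \<in> Q" "q \<in> Q" "g p = g q"
      thus "p = q" using lt[of p] lt[of q] by (auto simp: g_def prod_eq_iff Icc_eq_Icc)
    qed
    have div: "g ` Q division_of \<Union>(g ` Q)"
      unfolding division_of_def
    proof (intro conjI ballI impI)
      show "finite (g ` Q)" using Q by (auto simp: nonoverlapping_def)
      fix K assume K: "K \<in> g ` Q"
      thus "K \<subseteq> \<Union>(g ` Q)" by blast
      show "K \<noteq> {}" using K lt by (fastforce simp: g_def)
      show "\<exists>a b. K = cbox a b" using K by (auto simp: g_def)
    next
      fix K J assume KJ: "K \<in> g ` Q" "J \<in> g ` Q" "K \<noteq> J"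
      then obtain p q where pq: "p \<in> Q" "q \<in> Q" "K = g p" "J = g q" "p \<noteq> q" by auto
      hence "snd p \<le> fst q \<or> snd q \<le> fst p" using Q by (auto simp: nonoverlapping_def)
      thus "interior K \<inter> interior J = {}" using pq by (auto simp: g_def)
    qed simp
    have sub: "\<Union>(g ` Q) \<subseteq> {a..b}" using rng by (fastforce simp: g_def)
    have "(\<Sum>K\<in>g ` Q. Sup K - Inf K) = total_length Q"
      unfolding total_length_def by (simp add: sum.reindex[OF inj]) (rule sum.cong, auto simp: g_def dest: lt)
    also have "\<dots> = (\<Sum>p\<in>P. clamp_real a b (snd p) - clamp_real a b (fst p))"
      unfolding Q_def by (rule total_length_map[OF P(1) mono_clamp_real])
    also have "\<dots> \<le> total_length P"
      unfolding total_length_def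
    proof (rule sum_mono)
      fix p assume "p \<in> P"
      hence "fst p < snd p" using P by (auto simp: nonoverlapping_def)
      thus "clamp_real a b (snd p) - clamp_real a b (fst p) \<le> snd p - fst p"
        using ab by (auto simp: clamp_real_def max_def min_def)
    qed
    also have "\<dots> < \<delta>" by fact
    finally have "(\<Sum>K\<in>g ` Q. norm (y (Sup K) - y (Inf K))) < \<epsilon>" by (rule \<delta>(2)[OF div sub])
    moreover have "(\<Sum>K\<in>g ` Q. norm (y (Sup K) - y (Inf K))) = sum_increments y Q"
      unfolding sum_increments_def by (simp add: sum.reindex[OF inj]) (rule sum.cong, auto simp: g_def dest: lt)
    moreover have "sum_increments y Q = sum_increments (\<lambda>s. y (clamp_real a b s)) P"
      unfolding Q_def sum_increments_map[OF P(1) mono_clamp_real] by (simp add: sum_increments_def)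
    ultimately show "sum_increments (\<lambda>s. y (clamp_real a b s)) P < \<epsilon>" by simp
  qed
qed

lemma abs_continuous_increment:
  assumes y: "abs_continuous y" and "\<epsilon> > 0"
  shows "\<exists>\<delta>>0. \<forall>a b. a \<le> b \<and> b - a < \<delta> \<longrightarrow> norm (y b - y a) < \<epsilon>"
proof -
  obtain \<delta> where \<delta>: "\<delta> > 0" "\<And>P. nonoverlapping P \<Longrightarrow> total_length P < \<delta> \<Longrightarrow> sum_increments y P < \<epsilon>"
    using assms unfolding abs_continuous_def by blast
  have "norm (y b - y a) < \<epsilon>" if "a \<le> b" "b - a < \<delta>" for a b
  proof (cases "a = b")
    case False
    thus ?thesis using \<delta>(2)[of "{(a, b)}"] that
      by (auto simp: nonoverlapping_def total_length_def sum_increments_def)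
  qed (use \<open>\<epsilon> > 0\<close> in auto)
  thus ?thesis using \<delta>(1) by blast
qed

lemma abs_continuous_imp_continuous:
  assumes y: "abs_continuous y"
  shows "continuous_on UNIV y"
proof (rule continuous_at_imp_continuous_on, rule ballI)
  fix s
  show "isCont y s"
    unfolding continuous_at_eps_delta dist_norm
  proof (intro allI impI)
    fix \<epsilon> :: real assume "\<epsilon> > 0"
    then obtain \<delta> where \<delta>: "\<delta> > 0" "\<And>a b. a \<le> b \<Longrightarrow> b - a < \<delta> \<Longrightarrow> norm (y b - y a) < \<epsilon>"
      using abs_continuous_increment[OF y] by meson
    show "\<exists>d>0. \<forall>x'. norm (x' - s) < d \<longrightarrow> norm (y x' - y s) < \<epsilon>"
    proof (intro exI[of _ \<delta>] conjI allI impI \<delta>(1))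
      fix x' assume "norm (x' - s) < \<delta>"
      thus "norm (y x' - y s) < \<epsilon>"
        using \<delta>(2)[of s x'] \<delta>(2)[of x' s] by (cases "s \<le> x'") (auto simp: norm_minus_commute)
    qed
  qed
qed

text \<open>A null set lies in an open set of measure below \<open>\<delta>\<close>, a countable
  union of boxes. Absolute continuity bounds the interval measure of every finite union of them by
  \<open>\<epsilon>\<close>, and continuity from below passes to the whole open set.\<close>

lemma abs_continuous_null_sets:
  fixes F :: "real \<Rightarrow> real"
  assumes F: "abs_continuous F" and mono: "mono F"
  shows "absolutely_continuous lborel (interval_measure F)"
  unfolding absolutely_continuous_def
proof
  fix A :: "real set" assume A: "A \<in> null_sets lborel"
  hence Ab: "A \<in> sets borel" "emeasure lborel A = 0" by auto
  have cont: "continuous_on UNIV F" by (rule abs_continuous_imp_continuous[OF F])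
  let ?N = "interval_measure F"
  have small: "emeasure ?N A \<le> ennreal \<epsilon>" if eps: "\<epsilon> > 0" for \<epsilon>
  proof -
    obtain \<delta> where \<delta>: "\<delta> > 0" "\<And>D. D division_of \<Union>D \<Longrightarrow> (\<Sum>K\<in>D. Sup K - Inf K) < \<delta>
        \<Longrightarrow> (\<Sum>K\<in>D. norm (F (Sup K) - F (Inf K))) < \<epsilon>"
      using abs_continuous_division[OF F eps] by meson
    obtain U where U: "open U" "A \<subseteq> U" "emeasure lborel (U - A) < \<delta>"
      using outer_regular_lborel[OF Ab(1) \<delta>(1)] by blast
    have "emeasure lborel U \<le> emeasure lborel (U - A) + emeasure lborel A"
    proof -
      have "U = (U - A) \<union> A" using U by blast
      thus ?thesis using emeasure_subadditive[of "U - A" lborel A] U Ab by auto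
    qed
    hence Ud: "emeasure lborel U < \<delta>" using U Ab by simp
    obtain \<D> where D: "countable \<D>" "\<D> \<subseteq> Pow U" "\<And>X. X \<in> \<D> \<Longrightarrow> \<exists>a b. X = cbox a b" "\<Union>\<D> = U"
      using open_countable_Union_open_cbox[OF U(1)] by blast
    have fin: "emeasure ?N (\<Union>\<F>) \<le> \<epsilon>" if \<F>: "finite \<F>" "\<F> \<subseteq> \<D>" for \<F>
    proof -
      \<comment> \<open>The boxes may overlap, so the finite union is recut into a division; its
        members have disjoint interiors, which bounds their total length by the measure of
        \<open>U\<close>.\<close>
      obtain p where p: "p division_of \<Union>\<F>"
        using elementary_unions_intervals[OF \<F>(1)] D(3) \<F>(2) by (metis subsetD)
      have pp: "p division_of \<Union>p" using p by (metis division_ofD(6))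
      have finp: "finite p" using p by blast
      have K: "K = {Inf K..Sup K}" "Inf K \<le> Sup K" if K: "K \<in> p" for K
      proof -
        obtain l r where "K = {l..r}" "K \<noteq> {}" using division_ofD(3,4)[OF p K] by auto
        thus "K = {Inf K..Sup K}" "Inf K \<le> Sup K" by auto
      qed
      have "ennreal (\<Sum>K\<in>p. Sup K - Inf K) = (\<Sum>K\<in>p. emeasure lborel (interior K))"
      proof (subst sum_ennreal[symmetric])
        show "\<And>K. K \<in> p \<Longrightarrow> 0 \<le> Sup K - Inf K" using K by simp
        show "(\<Sum>K\<in>p. ennreal (Sup K - Inf K)) = (\<Sum>K\<in>p. emeasure lborel (interior K))"
        proof (rule sum.cong[OF refl])
          fix K assume k: "K \<in> p"
          have "interior K = {Inf K<..<Sup K}" using K(1)[OF k] interior_atLeastAtMost_real by metis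
          thus "ennreal (Sup K - Inf K) = emeasure lborel (interior K)" using K(2)[OF k] by simp
        qed
      qed
      also have "\<dots> = emeasure lborel (\<Union>K\<in>p. interior K)"
        by (rule sum_emeasure) (use p finp in \<open>auto simp: disjoint_family_on_def\<close>)
      also have "\<dots> \<le> emeasure lborel U"
      proof (rule emeasure_mono)
        have "K \<subseteq> U" if "K \<in> p" for K using division_ofD(2)[OF p that] \<open>\<F> \<subseteq> \<D>\<close> D(2) by blast
        thus "(\<Union>K\<in>p. interior K) \<subseteq> U" using interior_subset by blast
      qed (use U in auto)
      also have "\<dots> < \<delta>" by fact
      finally have "(\<Sum>K\<in>p. Sup K - Inf K) < \<delta>" using \<delta>(1)
        by (metis ennreal_less_iff ennreal_leI linorder_not_le)
      from \<delta>(2)[OF pp this] have lt: "(\<Sum>K\<in>p. norm (F (Sup K) - F (Inf K))) < \<epsilon>" .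
      have "emeasure ?N (\<Union>\<F>) = emeasure ?N (\<Union>K\<in>p. K)" using division_ofD(6)[OF p] by simp
      also have "\<dots> \<le> (\<Sum>K\<in>p. emeasure ?N K)"
        by (rule emeasure_subadditive_finite) (use finp K in \<open>auto, metis borel_closed closed_atLeastAtMost\<close>)
      also have "\<dots> = (\<Sum>K\<in>p. ennreal (norm (F (Sup K) - F (Inf K))))"
      proof (rule sum.cong[OF refl])
        fix K assume k: "K \<in> p"
        have "emeasure ?N {Inf K..Sup K} = F (Sup K) - F (Inf K)"
          by (rule emeasure_interval_measure_Icc) (use K(2)[OF k] monoD[OF mono] cont in auto)
        thus "emeasure ?N K = ennreal (norm (F (Sup K) - F (Inf K)))"
          using K[OF k] monoD[OF mono K(2)[OF k]] by simp
      qed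
      also have "\<dots> = ennreal (\<Sum>K\<in>p. norm (F (Sup K) - F (Inf K)))" by (rule sum_ennreal) auto
      also have "\<dots> \<le> \<epsilon>" using lt by (intro ennreal_leI) auto
      finally show ?thesis .
    qed
    have "emeasure ?N U \<le> \<epsilon>"
    proof (cases "\<D> = {}")
      case True thus ?thesis using D(4) by simp
    next
      case False
      define X where "X = (\<lambda>n. \<Union>(from_nat_into \<D> ` {..n}))"
      have "\<Union>(range X) = U"
      proof -
        have "X n \<subseteq> \<Union>(range (from_nat_into \<D>))" for n unfolding X_def by blast
        moreover have "from_nat_into \<D> n \<subseteq> X n" for n unfolding X_def by blast
        ultimately have "\<Union>(range X) = \<Union>(range (from_nat_into \<D>))" by blast
        thus ?thesis using range_from_nat_into[OF False D(1)] D(4) by simp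
      qed
      moreover have "(SUP n. emeasure ?N (X n)) = emeasure ?N (\<Union>(range X))"
      proof (rule SUP_emeasure_incseq)
        have "Z \<in> sets borel" if "Z \<in> \<D>" for Z
          using D(3)[OF that] by auto
        hence "X n \<in> sets borel" for n unfolding X_def
          using from_nat_into[OF False] by (intro sets.finite_Union) auto
        thus "range X \<subseteq> sets ?N" by auto
        show "incseq X" unfolding X_def incseq_def by (intro allI impI Union_mono image_mono) auto
      qed
      moreover have "emeasure ?N (X n) \<le> \<epsilon>" for n
        unfolding X_def by (rule fin) (use from_nat_into[OF False] in auto)
      ultimately show ?thesis by (metis SUP_least)
    qed
    moreover have "emeasure ?N A \<le> emeasure ?N U" by (rule emeasure_mono) (use U in auto)
    ultimately show ?thesis by simp
  qed
  have "emeasure ?N A \<le> 0"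
  proof (rule ennreal_le_epsilon)
    fix e :: real assume "0 < e"
    from small[OF this] show "emeasure ?N A \<le> 0 + ennreal e" by (simp only: add_0)
  qed
  thus "A \<in> null_sets ?N" using Ab by auto
qed

text \<open>The density from the Radon-Nikodym theorem is extended-valued; its integral over every
  [-n, n] is finite, so it is finite almost everywhere and can be replaced by a real
  function.\<close>

lemma mono_abs_continuous_density:
  fixes F :: "real \<Rightarrow> real"
  assumes F: "abs_continuous F" and mono: "mono F"
  obtains g where "\<And>s. 0 \<le> g s" "\<And>a b. a \<le> b \<Longrightarrow> (g has_integral (F b - F a)) {a..b}"
proof -
  have cont: "continuous_on UNIV F" by (rule abs_continuous_imp_continuous[OF F])
  let ?N = "interval_measure F"
  obtain f where f: "f \<in> borel_measurable lborel" "density lborel f = ?N"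
    using sigma_finite_measure.Radon_Nikodym[OF sigma_finite_lborel abs_continuous_null_sets[OF F mono]] by auto
  have I: "(\<integral>\<^sup>+x. f x * indicator {a..b} x \<partial>lborel) = ennreal (F b - F a)" if "a \<le> b" for a b
  proof -
    have "(\<integral>\<^sup>+x. f x * indicator {a..b} x \<partial>lborel) = emeasure (density lborel f) {a..b}"
      by (rule emeasure_density[symmetric]) (use f in auto)
    also have "\<dots> = F b - F a" unfolding f(2)
      by (rule emeasure_interval_measure_Icc) (use that monoD[OF mono] cont in auto)
    finally show ?thesis .
  qed
  have fin: "AE x in lborel. f x * indicator {-real n..real n} x \<noteq> \<infinity>" for n
    by (rule nn_integral_PInf_AE) (use I[of "-real n" "real n"] f in auto)
  have AE_fin: "AE x in lborel. f x \<noteq> \<infinity>"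
  proof -
    have "AE x in lborel. \<forall>n. f x * indicator {-real n..real n} x \<noteq> \<infinity>"
      using fin by (simp add: AE_all_countable)
    thus ?thesis
    proof eventually_elim
      case (elim x)
      obtain n where "\<bar>x\<bar> \<le> real n" using real_arch_simple by blast
      hence "x \<in> {-real n..real n}" by auto
      with elim[rule_format, of n] show ?case by simp
    qed
  qed
  define g where "g = (\<lambda>x. enn2real (f x))"
  have gm: "g \<in> borel_measurable borel" using f unfolding g_def by measurable
  show ?thesis
  proof
    show "0 \<le> g s" for s by (simp add: g_def)
    fix a b :: real assume ab: "a \<le> b"
    have "(\<integral>\<^sup>+x. ennreal (g x * indicator {a..b} x) \<partial>lborel) = (\<integral>\<^sup>+x. f x * indicator {a..b} x \<partial>lborel)"
    proof (rule nn_integral_cong_AE, use AE_fin in eventually_elim)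
      case (elim x)
      thus ?case by (auto simp: g_def indicator_def less_top)
    qed
    hence "((\<lambda>x. g x * indicator {a..b} x) has_integral (F b - F a)) UNIV"
      using I[OF ab] gm monoD[OF mono ab] by (intro nn_integral_has_integral) (auto simp: g_def)
    moreover have "(\<lambda>x. g x * indicator {a..b} x) = (\<lambda>x. if x \<in> {a..b} then g x else 0)"
      by (auto simp: indicator_def)
    ultimately show "(g has_integral (F b - F a)) {a..b}"
      by (simp only: has_integral_restrict_UNIV)
  qed
qed

section \<open>The variation of a curve\<close>

lemma sum_increments_split:
  assumes P: "nonoverlapping P"
  shows "sum_increments y P \<le> sum_increments y (map_intervals (\<lambda>s. min s b) P)
           + sum_increments y (map_intervals (\<lambda>s. max s b) P)"
proof -
  have m: "mono (\<lambda>s. min s b)" "mono (\<lambda>s. max s b)" by (auto simp: mono_def)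
  show ?thesis
    unfolding sum_increments_map[OF P m(1)] sum_increments_map[OF P m(2)] sum.distrib[symmetric]
      sum_increments_def[of y P]
  proof (rule sum_mono)
    fix p assume "p \<in> P"
    hence lt: "fst p < snd p" using P by (auto simp: nonoverlapping_def)
    show "norm (y (snd p) - y (fst p)) \<le> norm (y (min (snd p) b) - y (min (fst p) b))
            + norm (y (max (snd p) b) - y (max (fst p) b))"
    proof (cases "fst p \<le> b \<and> b \<le> snd p")
      case True
      thus ?thesis using norm_triangle_ineq[of "y (snd p) - y b" "y b - y (fst p)"]
        by (simp add: min_def max_def)
    next
      case False
      thus ?thesis using lt by (auto simp: min_def max_def)
    qed
  qed
qed

lemma nonoverlapping_Un:
  assumes "nonoverlapping P" "nonoverlapping Q"
    and "\<And>p q. p \<in> P \<Longrightarrow> q \<in> Q \<Longrightarrow> snd p \<le> fst q \<or> snd q \<le> fst p"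
  shows "nonoverlapping (P \<union> Q)"
proof -
  have "snd p \<le> fst q \<or> snd q \<le> fst p" if "p \<in> P \<union> Q" "q \<in> P \<union> Q" "p \<noteq> q" for p q
  proof -
    consider "p \<in> P" "q \<in> P" | "p \<in> P" "q \<in> Q" | "p \<in> Q" "q \<in> P" | "p \<in> Q" "q \<in> Q"
      using \<open>p \<in> P \<union> Q\<close> \<open>q \<in> P \<union> Q\<close> by blast
    thus ?thesis
      using assms(1,2) \<open>p \<noteq> q\<close> assms(3)[of p q] assms(3)[of q p]
      by cases (auto simp: nonoverlapping_def)
  qed
  thus ?thesis using assms(1,2) by (auto simp: nonoverlapping_def)
qed

text \<open>Cut at the multiples of \<open>h < \<delta>\<close>: each cell adds less than 1 to the
  sum, and the curve is constant outside [0, t], so the number of cells is a bound independent of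
  the family.\<close>

lemma bounded_variation:
  assumes y: "abs_continuous y" and y0: "\<And>s. s \<le> 0 \<Longrightarrow> y s = y 0" and yt: "\<And>s. t \<le> s \<Longrightarrow> y s = y t"
  obtains B where "\<forall>P. nonoverlapping P \<longrightarrow> sum_increments y P \<le> B"
proof -
  obtain \<delta> where \<delta>: "\<delta> > 0" "\<And>P. nonoverlapping P \<Longrightarrow> total_length P < \<delta> \<Longrightarrow> sum_increments y P < 1"
    using y unfolding abs_continuous_def by (meson zero_less_one)
  define h where "h = \<delta> / 2"
  have h: "h > 0" "h < \<delta>" using \<delta>(1) by (auto simp: h_def)
  have idm: "mono (\<lambda>s::real. s)" by (simp add: mono_def)
  have step: "sum_increments y P \<le> real n" if "nonoverlapping P" "\<And>p. p \<in> P \<Longrightarrow> snd p \<le> real n * h" for n P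
    using that
  proof (induction n arbitrary: P)
    case 0
    have "y (snd p) = y 0" "y (fst p) = y 0" if "p \<in> P" for p
    proof -
      have "fst p < snd p" "snd p \<le> 0" using 0 that by (auto simp: nonoverlapping_def)
      thus "y (snd p) = y 0" "y (fst p) = y 0" using y0[of "snd p"] y0[of "fst p"] by simp_all
    qed
    thus ?case by (simp add: sum_increments_def)
  next
    case (Suc n)
    define b where "b = real n * h"
    let ?P1 = "map_intervals (\<lambda>s. min s b) P" and ?P2 = "map_intervals (\<lambda>s. max s b) P"
    have m: "mono (\<lambda>s. min s b)" "mono (\<lambda>s. max s b)" by (auto simp: mono_def)
    have "sum_increments y ?P1 \<le> real n"
    proof (rule Suc.IH)
      show "nonoverlapping ?P1" by (rule nonoverlapping_map[OF Suc.prems(1) m(1)])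
      fix p assume "p \<in> ?P1" thus "snd p \<le> real n * h" by (auto elim!: map_intervalsE simp: b_def)
    qed
    moreover have "sum_increments y ?P2 < 1"
    proof (rule \<delta>(2))
      show no: "nonoverlapping ?P2" by (rule nonoverlapping_map[OF Suc.prems(1) m(2)])
      have rng: "b \<le> fst p \<and> snd p \<le> b + h" if "p \<in> ?P2" for p
        using that
      proof (rule map_intervalsE)
        fix q assume "q \<in> P" "fst p = max (fst q) b" "snd p = max (snd q) b"
        thus ?thesis using Suc.prems(2)[of q] h by (auto simp: b_def algebra_simps)
      qed
      have "total_length ?P2 \<le> (b + h) - b"
        unfolding total_length_def
        by (rule sum_increments_mono[OF no idm]) (use rng h in auto)
      thus "total_length ?P2 < \<delta>" using h by simp
    qed
    ultimately show ?case using sum_increments_split[OF Suc.prems(1), of y b] by simp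
  qed
  obtain n where n: "t < real n * h" using h by (metis reals_Archimedean3)
  have "sum_increments y P \<le> real n" if P: "nonoverlapping P" for P
  proof -
    let ?b = "real n * h"
    let ?P1 = "map_intervals (\<lambda>s. min s ?b) P" and ?P2 = "map_intervals (\<lambda>s. max s ?b) P"
    have m: "mono (\<lambda>s. min s ?b)" "mono (\<lambda>s. max s ?b)" by (auto simp: mono_def)
    have "sum_increments y ?P1 \<le> real n"
      by (rule step[OF nonoverlapping_map[OF P m(1)]]) (auto elim!: map_intervalsE)
    moreover have "sum_increments y ?P2 = 0"
      unfolding sum_increments_map[OF P m(2)]
    proof (intro sum.neutral ballI)
      fix p
      have "y (max (snd p) ?b) = y t" "y (max (fst p) ?b) = y t" using n by (intro yt; simp)+
      thus "norm (y (max (snd p) ?b) - y (max (fst p) ?b)) = 0" by simp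
    qed
    ultimately show ?thesis using sum_increments_split[OF P, of y ?b] by simp
  qed
  thus ?thesis using that by blast
qed

text \<open>The variation of \<open>y\<close> on (-\<infinity>, s]; the supremum is meaningful
  because \<open>bounded_variation\<close> bounds all the sums.\<close>

definition variation_upto :: "(real \<Rightarrow> 'a::real_normed_vector) \<Rightarrow> real \<Rightarrow> real" where
  "variation_upto y s = (SUP P\<in>{P. nonoverlapping P \<and> (\<forall>p\<in>P. snd p \<le> s)}. sum_increments y P)"

text \<open>For the increment bound, the interval (a, b) is appended to a family that nearly attains
  the variation up to \<open>a\<close>.\<close>

lemma
  assumes B: "\<forall>P. nonoverlapping P \<longrightarrow> sum_increments y P \<le> B"
  shows variation_upper: "\<And>P s. nonoverlapping P \<Longrightarrow> (\<forall>p\<in>P. snd p \<le> s) \<Longrightarrow> sum_increments y P \<le> variation_upto y s"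
    and variation_approx: "\<And>s \<eta>. \<eta> > 0 \<Longrightarrow> \<exists>P. nonoverlapping P \<and> (\<forall>p\<in>P. snd p \<le> s) \<and> variation_upto y s < sum_increments y P + \<eta>"
    and variation_increment: "\<And>a b. a \<le> b \<Longrightarrow> norm (y b - y a) \<le> variation_upto y b - variation_upto y a"
proof -
  have bdd: "bdd_above (sum_increments y ` {P. nonoverlapping P \<and> (\<forall>p\<in>P. snd p \<le> s)})" for s
    using B by (intro bdd_aboveI[of _ B]) auto
  have ne: "{P. nonoverlapping P \<and> (\<forall>p\<in>P. snd p \<le> s)} \<noteq> {}" for s
    by (rule ex_in_conv[THEN iffD1]) (auto simp: nonoverlapping_def intro!: exI[of _ "{}"])
  show upper: "sum_increments y P \<le> variation_upto y s" if "nonoverlapping P" "\<forall>p\<in>P. snd p \<le> s" for P s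
    unfolding variation_upto_def by (rule cSUP_upper[OF _ bdd]) (use that in auto)
  show approx: "\<exists>P. nonoverlapping P \<and> (\<forall>p\<in>P. snd p \<le> s) \<and> variation_upto y s < sum_increments y P + \<eta>"
    if "\<eta> > 0" for s \<eta>
  proof -
    have "variation_upto y s - \<eta> < (SUP P\<in>{P. nonoverlapping P \<and> (\<forall>p\<in>P. snd p \<le> s)}. sum_increments y P)"
      using that unfolding variation_upto_def by simp
    thus ?thesis using less_cSUP_iff[OF ne bdd] by fastforce
  qed
  show "norm (y b - y a) \<le> variation_upto y b - variation_upto y a" if ab: "a \<le> b" for a b
  proof (rule field_le_epsilon)
    fix \<eta> :: real assume "\<eta> > 0"
    then obtain P where P: "nonoverlapping P" "\<forall>p\<in>P. snd p \<le> a" "variation_upto y a < sum_increments y P + \<eta>"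
      using approx by blast
    show "norm (y b - y a) \<le> variation_upto y b - variation_upto y a + \<eta>"
    proof (cases "a = b")
      case True thus ?thesis using \<open>\<eta> > 0\<close> by simp
    next
      case False
      have no: "nonoverlapping (P \<union> {(a, b)})"
        by (rule nonoverlapping_Un[OF P(1)]) (use P(2) False ab in \<open>auto simp: nonoverlapping_def\<close>)
      have notin: "(a, b) \<notin> P" using P(2) False ab by force
      have "sum_increments y (P \<union> {(a, b)}) = norm (y b - y a) + sum_increments y P"
        using notin P(1) by (simp add: sum_increments_def nonoverlapping_def)
      moreover have "sum_increments y (P \<union> {(a, b)}) \<le> variation_upto y b"
        by (rule upper[OF no]) (use P(2) ab in force)
      ultimately show ?thesis using P(3) by simp
    qed
  qed
qed

lemma mono_variation_upto:
  assumes B: "\<forall>P. nonoverlapping P \<longrightarrow> sum_increments y P \<le> B"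
  shows "mono (variation_upto y)"
proof (rule monoI)
  fix a b :: real assume "a \<le> b"
  hence "norm (y b - y a) \<le> variation_upto y b - variation_upto y a"
    by (rule variation_increment[OF B])
  thus "variation_upto y a \<le> variation_upto y b" using norm_ge_zero[of "y b - y a"] by linarith
qed

text \<open>Inside each interval of \<open>P\<close> a family nearly attaining the variation is
  chosen. Their union is again nonoverlapping and no longer than \<open>P\<close>, so the absolute
  continuity of \<open>y\<close> applies to it.\<close>

lemma abs_continuous_variation:
  assumes y: "abs_continuous y" and B: "\<forall>P. nonoverlapping P \<longrightarrow> sum_increments y P \<le> B"
  shows "abs_continuous (variation_upto y)"
  unfolding abs_continuous_def
proof (intro allI impI)
  let ?T = "variation_upto y"
  fix \<epsilon> :: real assume \<epsilon>: "\<epsilon> > 0"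
  obtain \<delta> where \<delta>: "\<delta> > 0" "\<And>P. nonoverlapping P \<Longrightarrow> total_length P < \<delta> \<Longrightarrow> sum_increments y P < \<epsilon> / 2"
    using y half_gt_zero[OF \<epsilon>] unfolding abs_continuous_def by meson
  show "\<exists>\<delta>>0. \<forall>P. nonoverlapping P \<and> total_length P < \<delta> \<longrightarrow> sum_increments ?T P < \<epsilon>"
  proof (intro exI[of _ \<delta>] conjI allI impI \<delta>(1))
    fix P assume "nonoverlapping P \<and> total_length P < \<delta>"
    hence P: "nonoverlapping P" "total_length P < \<delta>" by auto
    have finP: "finite P" using P by (simp add: nonoverlapping_def)
    \<comment> \<open>The approximation errors of all intervals together use at most half of
      \<open>\<epsilon>\<close>; the \<open>+ 1\<close> covers an empty \<open>P\<close>.\<close>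
    define \<eta> where "\<eta> = \<epsilon> / (2 * (real (card P) + 1))"
    have \<eta>: "\<eta> > 0" using \<epsilon> by (auto simp: \<eta>_def intro!: divide_pos_pos)
    have "\<exists>Q. nonoverlapping Q \<and> (\<forall>q\<in>Q. fst p \<le> fst q \<and> snd q \<le> snd p) \<and> ?T (snd p) - ?T (fst p) \<le> sum_increments y Q + \<eta>"
      if p: "p \<in> P" for p
    proof -
      have lt: "fst p < snd p" using P p by (auto simp: nonoverlapping_def)
      obtain R where R: "nonoverlapping R" "\<forall>q\<in>R. snd q \<le> snd p" "?T (snd p) < sum_increments y R + \<eta>"
        using variation_approx[OF B \<eta>] by meson
      \<comment> \<open>Cutting at \<open>fst p\<close> discards the part of \<open>R\<close> to the
        left of \<open>p\<close>, which accounts for at most \<open>?T (fst p)\<close>.\<close>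
      let ?b = "fst p"
      let ?P1 = "map_intervals (\<lambda>s. min s ?b) R" and ?P2 = "map_intervals (\<lambda>s. max s ?b) R"
      have m: "mono (\<lambda>s. min s ?b)" "mono (\<lambda>s. max s ?b)" by (auto simp: mono_def)
      have "sum_increments y ?P1 \<le> ?T (fst p)"
        by (rule variation_upper[OF B nonoverlapping_map[OF R(1) m(1)]]) (auto elim!: map_intervalsE)
      hence "?T (snd p) - ?T (fst p) \<le> sum_increments y ?P2 + \<eta>"
        using sum_increments_split[OF R(1), of y ?b] R(3) by simp
      moreover have "\<forall>q\<in>?P2. fst p \<le> fst q \<and> snd q \<le> snd p"
        using R(2) lt by (auto elim!: map_intervalsE)
      ultimately show ?thesis using nonoverlapping_map[OF R(1) m(2)] by blast
    qed
    then obtain Q where Q: "\<And>p. p \<in> P \<Longrightarrow> nonoverlapping (Q p)"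
        "\<And>p q. p \<in> P \<Longrightarrow> q \<in> Q p \<Longrightarrow> fst p \<le> fst q \<and> snd q \<le> snd p"
        "\<And>p. p \<in> P \<Longrightarrow> ?T (snd p) - ?T (fst p) \<le> sum_increments y (Q p) + \<eta>"
      by metis
    have Qlt: "fst q < snd q" if "p \<in> P" "q \<in> Q p" for p q using Q(1)[OF that(1)] that(2) by (auto simp: nonoverlapping_def)
    have finQ: "finite (Q p)" if "p \<in> P" for p using Q(1)[OF that] by (simp add: nonoverlapping_def)
    have sep: "snd q \<le> fst q' \<or> snd q' \<le> fst q" if "p \<in> P" "p' \<in> P" "p \<noteq> p'" "q \<in> Q p" "q' \<in> Q p'" for p p' q q'
    proof -
      have "snd p \<le> fst p' \<or> snd p' \<le> fst p" using P(1) that by (auto simp: nonoverlapping_def)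
      thus ?thesis using Q(2)[of p q] Q(2)[of p' q'] that by fastforce
    qed
    have disj: "Q p \<inter> Q p' = {}" if "p \<in> P" "p' \<in> P" "p \<noteq> p'" for p p'
      using sep[OF that] Qlt[OF that(1)] by fastforce
    let ?U = "\<Union>p\<in>P. Q p"
    have no: "nonoverlapping ?U"
      unfolding nonoverlapping_def
    proof (intro conjI ballI impI)
      show "finite ?U" using finP finQ by blast
      fix q assume "q \<in> ?U" thus "fst q < snd q" using Qlt by blast
    next
      fix q q' assume q: "q \<in> ?U" "q' \<in> ?U" "q \<noteq> q'"
      then obtain p p' where p: "p \<in> P" "q \<in> Q p" "p' \<in> P" "q' \<in> Q p'" by blast
      show "snd q \<le> fst q' \<or> snd q' \<le> fst q"
      proof (cases "p = p'")
        case True thus ?thesis using Q(1)[OF p(1)] p q(3) unfolding nonoverlapping_def by blast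
      next
        case False thus ?thesis using sep p by blast
      qed
    qed
    have sumU: "sum f ?U = (\<Sum>p\<in>P. sum f (Q p))" for f :: "real \<times> real \<Rightarrow> real"
      by (rule sum.UNION_disjoint) (use finP finQ disj in auto)
    have "total_length ?U = (\<Sum>p\<in>P. \<Sum>q\<in>Q p. snd q - fst q)" unfolding total_length_def sumU ..
    also have "\<dots> \<le> total_length P"
      unfolding total_length_def
    proof (rule sum_mono)
      fix p assume p: "p \<in> P"
      have "fst p \<le> snd p" using P(1) p by (force simp: nonoverlapping_def)
      thus "(\<Sum>q\<in>Q p. snd q - fst q) \<le> snd p - fst p"
        using sum_increments_mono[of "Q p" "\<lambda>s. s" "fst p" "snd p"] Q(1,2)[OF p] by (auto simp: mono_def)
    qed
    also have "\<dots> < \<delta>" by fact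
    finally have "sum_increments y ?U < \<epsilon> / 2" by (rule \<delta>(2)[OF no])
    hence s1: "(\<Sum>p\<in>P. sum_increments y (Q p)) < \<epsilon> / 2" unfolding sum_increments_def sumU .
    have "sum_increments ?T P = (\<Sum>p\<in>P. ?T (snd p) - ?T (fst p))"
      unfolding sum_increments_def
    proof (rule sum.cong[OF refl])
      fix p assume "p \<in> P"
      hence "fst p \<le> snd p" using P(1) by (force simp: nonoverlapping_def)
      thus "norm (?T (snd p) - ?T (fst p)) = ?T (snd p) - ?T (fst p)"
        using monoD[OF mono_variation_upto[OF B]] by simp
    qed
    also have "\<dots> \<le> (\<Sum>p\<in>P. sum_increments y (Q p) + \<eta>)" by (rule sum_mono) (rule Q(3))
    also have "\<dots> = (\<Sum>p\<in>P. sum_increments y (Q p)) + real (card P) * \<eta>" by (simp add: sum.distrib)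
    also have "\<dots> < \<epsilon> / 2 + \<epsilon> / 2"
    proof (rule add_less_le_mono[OF s1])
      have "real (card P) * \<eta> \<le> (real (card P) + 1) * \<eta>" using \<eta> by (simp add: algebra_simps)
      also have "\<dots> = \<epsilon> / 2" unfolding \<eta>_def by (simp add: field_simps)
      finally show "real (card P) * \<eta> \<le> \<epsilon> / 2" .
    qed
    finally show "sum_increments ?T P < \<epsilon>" by simp
  qed
qed

lemma abs_continuous_dominated:
  assumes F: "abs_continuous F" and y: "\<And>a b. a \<le> b \<Longrightarrow> norm (y b - y a) \<le> C * norm (F b - F a)" and C: "C > 0"
  shows "abs_continuous y"
  unfolding abs_continuous_def
proof (intro allI impI)
  fix \<epsilon> :: real assume "\<epsilon> > 0"
  then obtain \<delta> where \<delta>: "\<delta> > 0" "\<And>P. nonoverlapping P \<Longrightarrow> total_length P < \<delta> \<Longrightarrow> sum_increments F P < \<epsilon> / C"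
    using F C unfolding abs_continuous_def by (meson divide_pos_pos)
  show "\<exists>\<delta>>0. \<forall>P. nonoverlapping P \<and> total_length P < \<delta> \<longrightarrow> sum_increments y P < \<epsilon>"
  proof (intro exI[of _ \<delta>] conjI allI impI \<delta>(1))
    fix P assume P: "nonoverlapping P \<and> total_length P < \<delta>"
    have "sum_increments y P \<le> (\<Sum>p\<in>P. C * norm (F (snd p) - F (fst p)))"
      unfolding sum_increments_def
      by (intro sum_mono y) (use P in \<open>auto simp: nonoverlapping_def less_imp_le\<close>)
    also have "\<dots> = C * sum_increments F P" by (simp add: sum_increments_def sum_distrib_left)
    also have "\<dots> < C * (\<epsilon> / C)" using \<delta>(2) P C by (intro mult_strict_left_mono) auto
    finally show "sum_increments y P < \<epsilon>" using C by simp
  qed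
qed

text \<open>
  Adding the variation makes every component of the curve monotone, which reduces the claim to the
  Radon-Nikodym theorem for interval measures.
\<close>

lemma abs_continuous_density:
  fixes y :: "real \<Rightarrow> 'a::euclidean_space"
  assumes y: "abs_continuous y" and y0: "\<And>s. s \<le> 0 \<Longrightarrow> y s = y 0" and yt: "\<And>s. t \<le> s \<Longrightarrow> y s = y t"
  obtains g where "\<And>a b. a \<le> b \<Longrightarrow> (g has_integral (y b - y a)) {a..b}"
    "\<And>a b. g absolutely_integrable_on {a..b}"
proof -
  obtain B where B: "\<forall>P. nonoverlapping P \<longrightarrow> sum_increments y P \<le> B"
    using bounded_variation[OF y y0 yt] by blast
  define T where "T = variation_upto y"
  have T: "mono T" "abs_continuous T" "\<And>a b. a \<le> b \<Longrightarrow> norm (y b - y a) \<le> T b - T a"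
    unfolding T_def using mono_variation_upto[OF B] abs_continuous_variation[OF y B]
      variation_increment[OF B] by auto
  define F where "F = (\<lambda>i s. T s + y s \<bullet> i)"
  have ii: "\<bar>y b \<bullet> i - y a \<bullet> i\<bar> \<le> T b - T a" if "a \<le> b" "i \<in> Basis" for a b i
    using Basis_le_norm[OF that(2), of "y b - y a"] T(3)[OF that(1)] by (simp add: inner_diff_left)
  have monoF: "mono (F i)" if "i \<in> Basis" for i
  proof (rule monoI)
    fix a b :: real assume "a \<le> b"
    from ii[OF this that] show "F i a \<le> F i b" by (simp add: F_def)
  qed
  have acF: "abs_continuous (F i)" if "i \<in> Basis" for i
  proof (rule abs_continuous_dominated[OF T(2)])
    fix a b :: real assume "a \<le> b"
    from ii[OF this that] show "norm (F i b - F i a) \<le> 2 * norm (T b - T a)"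
      by (simp add: F_def)
  qed simp
  obtain gT where gT: "\<And>s. 0 \<le> gT s" "\<And>a b. a \<le> b \<Longrightarrow> (gT has_integral (T b - T a)) {a..b}"
    using mono_abs_continuous_density[OF T(2,1)] by blast
  have "\<forall>i\<in>Basis. \<exists>g. (\<forall>s. 0 \<le> g s) \<and> (\<forall>a b. a \<le> b \<longrightarrow> (g has_integral (F i b - F i a)) {a..b})"
    using mono_abs_continuous_density[OF acF monoF] by metis
  then obtain G where G: "\<And>i s. i \<in> Basis \<Longrightarrow> 0 \<le> G i s"
      "\<And>i a b. i \<in> Basis \<Longrightarrow> a \<le> b \<Longrightarrow> (G i has_integral (F i b - F i a)) {a..b}"
    by metis
  define g where "g = (\<lambda>s. \<Sum>i\<in>Basis. (G i s - gT s) *\<^sub>R (i::'a))"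
  have int: "(g has_integral (y b - y a)) {a..b}" if ab: "a \<le> b" for a b
  proof -
    have "(g has_integral (\<Sum>i\<in>Basis. ((F i b - F i a) - (T b - T a)) *\<^sub>R i)) {a..b}"
      unfolding g_def
      by (intro has_integral_sum has_integral_scaleR_left has_integral_diff G(2) gT(2) ab) auto
    moreover have "(\<Sum>i\<in>Basis. ((F i b - F i a) - (T b - T a)) *\<^sub>R i) = y b - y a"
    proof -
      have "(\<Sum>i\<in>Basis. ((F i b - F i a) - (T b - T a)) *\<^sub>R i) = (\<Sum>i\<in>Basis. ((y b - y a) \<bullet> i) *\<^sub>R i)"
        by (rule sum.cong) (auto simp: F_def inner_diff_left)
      thus ?thesis by (simp add: euclidean_representation)
    qed
    ultimately show ?thesis by simp
  qed
  have abs: "g absolutely_integrable_on {a..b}" for a b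
  proof (cases "a \<le> b")
    case True
    have "gT absolutely_integrable_on {a..b}"
      by (rule nonnegative_absolutely_integrable_1) (use gT True in auto)
    moreover have "G i absolutely_integrable_on {a..b}" if "i \<in> Basis" for i
      by (rule nonnegative_absolutely_integrable_1[OF has_integral_integrable[OF G(2)[OF that True]]])
         (rule G(1)[OF that])
    ultimately show ?thesis unfolding g_def
      by (intro absolutely_integrable_sum absolutely_integrable_scaleR_right
          set_integral_diff finite_Basis) auto
  qed auto
  show ?thesis by (rule that[OF int abs])
qed

section \<open>Differentiation of indefinite integrals\<close>

lemma has_vector_derivative_of_one_sided_quotients:
  fixes y :: "real \<Rightarrow> 'a::real_normed_vector"
  assumes r: "\<And>e. e > 0 \<Longrightarrow> \<exists>d>0. \<forall>h. 0 < h \<and> h < d \<longrightarrow> norm ((y (s + h) - y s) /\<^sub>R h - v) < e"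
    and l: "\<And>e. e > 0 \<Longrightarrow> \<exists>d>0. \<forall>h. 0 < h \<and> h < d \<longrightarrow> norm ((y s - y (s - h)) /\<^sub>R h - v) < e"
  shows "(y has_vector_derivative v) (at s)"
  unfolding has_vector_derivative_def has_derivative_at
proof (intro conjI LIM_I)
  show "bounded_linear (\<lambda>x. x *\<^sub>R v)" by (rule bounded_linear_scaleR_left)
  fix e :: real assume "e > 0"
  from r[OF this] l[OF this] obtain d1 d2
    where d: "d1 > 0" "\<And>h. 0 < h \<Longrightarrow> h < d1 \<Longrightarrow> norm ((y (s + h) - y s) /\<^sub>R h - v) < e"
     "d2 > 0" "\<And>h. 0 < h \<Longrightarrow> h < d2 \<Longrightarrow> norm ((y s - y (s - h)) /\<^sub>R h - v) < e"
    by auto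
  show "\<exists>d>0. \<forall>h. h \<noteq> 0 \<and> norm (h - 0) < d \<longrightarrow> norm (norm (y (s + h) - y s - h *\<^sub>R v) / norm h - 0) < e"
  proof (intro exI[of _ "min d1 d2"] conjI allI impI)
    show "0 < min d1 d2" using d by simp
    fix h :: real assume h: "h \<noteq> 0 \<and> norm (h - 0) < min d1 d2"
    have "y (s + h) - y s - h *\<^sub>R v = h *\<^sub>R ((y (s + h) - y s) /\<^sub>R h - v)"
      using h by (simp add: scaleR_diff_right)
    hence eq: "norm (y (s + h) - y s - h *\<^sub>R v) / norm h = norm ((y (s + h) - y s) /\<^sub>R h - v)"
      using h by simp
    have "norm ((y (s + h) - y s) /\<^sub>R h - v) < e"
    proof (cases "h > 0")
      case True thus ?thesis using d(2) h by simp
    next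
      case False
      have "(y s - y (s - (-h))) /\<^sub>R (-h) = (y (s + h) - y s) /\<^sub>R h"
        by (simp add: scaleR_diff_right)
      thus ?thesis using d(4)[of "-h"] h False by auto
    qed
    thus "norm (norm (y (s + h) - y s - h *\<^sub>R v) / norm h - 0) < e" using eq by simp
  qed
qed

text \<open>The averages in the differentiation theorem run over [s, s + h] and give right
  quotients; applied to the reflected density \<open>\<lambda>s. g (-s)\<close>, the theorem gives
  the left quotients.\<close>

lemma indefinite_integral_has_vector_derivative_AE:
  fixes y :: "real \<Rightarrow> 'a::euclidean_space"
  assumes g: "\<And>a b. a \<le> b \<Longrightarrow> (g has_integral (y b - y a)) {a..b}"
  obtains N where "negligible N" "\<And>s. s \<notin> N \<Longrightarrow> (y has_vector_derivative g s) (at s)"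
proof -
  have int: "g integrable_on cbox a b" for a b
    using g[of a b] by (cases "a \<le> b") (auto simp: integrable_on_def)
  obtain N1 where N1: "negligible N1" "\<And>s e. s \<notin> N1 \<Longrightarrow> 0 < e \<Longrightarrow>
      \<exists>d>0. \<forall>h. 0 < h \<and> h < d \<longrightarrow> norm (integral (cbox s (s + h *\<^sub>R One)) g /\<^sub>R h ^ DIM(real) - g s) < e"
    using integrable_ccontinuous_explicit[OF int] by blast
  have g': "((\<lambda>s. g (-s)) has_integral (y (-a) - y (-b))) {a..b}" if "a \<le> b" for a b
    using g[of "-b" "-a"] that has_integral_reflect_real[where f=g and a="-b" and b="-a"] by simp
  have int': "(\<lambda>s. g (-s)) integrable_on cbox a b" for a b
    using g'[of a b] by (cases "a \<le> b") (auto simp: integrable_on_def)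
  obtain N2 where N2: "negligible N2" "\<And>s e. s \<notin> N2 \<Longrightarrow> 0 < e \<Longrightarrow>
      \<exists>d>0. \<forall>h. 0 < h \<and> h < d \<longrightarrow> norm (integral (cbox s (s + h *\<^sub>R One)) (\<lambda>s. g (-s)) /\<^sub>R h ^ DIM(real) - g (-s)) < e"
    using integrable_ccontinuous_explicit[OF int'] by blast
  show ?thesis
  proof
    have "negligible (uminus ` N2)"
      by (rule negligible_differentiable_image_negligible[OF _ N2(1)])
         (auto intro!: derivative_intros simp: differentiable_on_def)
    thus "negligible (N1 \<union> uminus ` N2)" using N1(1) by simp
    fix s assume s: "s \<notin> N1 \<union> uminus ` N2"
    show "(y has_vector_derivative g s) (at s)"
    proof (rule has_vector_derivative_of_one_sided_quotients)
      fix e :: real assume e: "e > 0"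
      have "integral {s..s+h} g = y (s + h) - y s" if "h > 0" for h
        using g[of s "s + h"] that by (intro integral_unique) auto
      thus "\<exists>d>0. \<forall>h. 0 < h \<and> h < d \<longrightarrow> norm ((y (s + h) - y s) /\<^sub>R h - g s) < e"
        using N1(2)[of s e] s e by auto
    next
      fix e :: real assume e: "e > 0"
      have "-s \<notin> N2" using s by force
      moreover have "integral {-s..-s+h} (\<lambda>s. g (-s)) = y s - y (s - h)" if "h > 0" for h
        using g'[of "-s" "-s + h"] that by (intro integral_unique) auto
      ultimately show "\<exists>d>0. \<forall>h. 0 < h \<and> h < d \<longrightarrow> norm ((y s - y (s - h)) /\<^sub>R h - g s) < e"
        using N2(2)[of "-s" e] e by auto
    qed
  qed
qed

text \<open>The work is done for the constant extension \<open>z\<close>, which has a density on the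
  whole line; the two-sided derivative of \<open>z\<close> restricts to the derivative of
  \<open>y\<close> within [0, t].\<close>

theorem abs_continuous_on_interval_derivative:
  fixes y :: "real \<Rightarrow> 'a::euclidean_space"
  assumes y: "abs_continuous_on_interval 0 t y" and t: "0 < t"
  obtains g where "\<And>a b. 0 \<le> a \<Longrightarrow> a \<le> b \<Longrightarrow> b \<le> t \<Longrightarrow> (g has_integral (y b - y a)) {a..b}"
    "g absolutely_integrable_on {0..t}"
    "AE s in lebesgue. s \<in> {0..t} \<longrightarrow> vector_derivative y (at s within {0..t}) = g s"
    "continuous_on {0..t} y"
proof -
  define z where "z = (\<lambda>s. y (clamp_real 0 t s))"
  have z: "abs_continuous z" unfolding z_def by (rule abs_continuous_clamp[OF y]) (use t in simp)
  have z0: "z s = z 0" if "s \<le> 0" for s using that t by (simp add: z_def clamp_real_def)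
  have zt: "z s = z t" if "t \<le> s" for s using that t by (simp add: z_def clamp_real_def)
  have zy: "z s = y s" if "0 \<le> s" "s \<le> t" for s using that by (simp add: z_def clamp_real_def)
  obtain g where g: "\<And>a b. a \<le> b \<Longrightarrow> (g has_integral (z b - z a)) {a..b}"
    "\<And>a b. g absolutely_integrable_on {a..b}"
    using abs_continuous_density[OF z z0 zt] by blast
  obtain N where N: "negligible N" "\<And>s. s \<notin> N \<Longrightarrow> (z has_vector_derivative g s) (at s)"
    using indefinite_integral_has_vector_derivative_AE[OF g(1)] by blast
  show ?thesis
  proof
    show "(g has_integral (y b - y a)) {a..b}" if "0 \<le> a" "a \<le> b" "b \<le> t" for a b
      using g(1)[OF that(2)] zy that by simp
    show "g absolutely_integrable_on {0..t}" by (rule g(2))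
    show "continuous_on {0..t} y"
    proof -
      have "continuous_on {0..t} z"
        using abs_continuous_imp_continuous[OF z] continuous_on_subset by blast
      thus ?thesis using continuous_on_eq[of "{0..t}" z y] zy by auto
    qed
    have d: "vector_derivative y (at s within {0..t}) = g s" if s: "s \<in> {0..t}" "s \<notin> N" for s
    proof -
      have "(z has_vector_derivative g s) (at s within {0..t})"
        using N(2)[OF s(2)] has_vector_derivative_at_within by blast
      hence "(y has_vector_derivative g s) (at s within {0..t})"
        by (rule has_vector_derivative_transform_within[where d=1]) (use s zy in auto)
      thus ?thesis using vector_derivative_within_closed_interval[OF t] s by blast
    qed
    have "N \<in> null_sets lebesgue" using N(1) negligible_iff_null_sets by blast
    thus "AE s in lebesgue. s \<in> {0..t} \<longrightarrow> vector_derivative y (at s within {0..t}) = g s"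
      by (rule AE_I') (use d in auto)
  qed
qed

section \<open>Polygons with infinitely many edges\<close>

text \<open>The time spent by instant \<open>\<sigma>\<close> on an edge that starts at
  \<open>a\<close> and lasts \<open>h\<close>. With it a polygon becomes a series over its edges,
  defined also at the time where the vertices accumulate.\<close>

definition elapsed :: "real \<Rightarrow> real \<Rightarrow> real \<Rightarrow> real" where
  "elapsed a h \<sigma> = min (max (\<sigma> - a) 0) h"

lemma elapsed_bounds: "0 \<le> h \<Longrightarrow> 0 \<le> elapsed a h \<sigma>" "elapsed a h \<sigma> \<le> h"
  by (auto simp: elapsed_def)

lemma elapsed_mono: "\<sigma> \<le> \<sigma>' \<Longrightarrow> elapsed a h \<sigma> \<le> elapsed a h \<sigma>'"
  by (auto simp: elapsed_def)

lemma elapsed_lipschitz: "\<sigma> \<le> \<sigma>' \<Longrightarrow> elapsed a h \<sigma>' - elapsed a h \<sigma> \<le> \<sigma>' - \<sigma>"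
  by (auto simp: elapsed_def min_def max_def)

lemma summable_elapsed:
  fixes v :: "nat \<Rightarrow> 'a::euclidean_space"
  assumes h: "\<And>k. 0 \<le> h k" and s: "summable (\<lambda>k. h k * norm (v k))"
  shows "summable (\<lambda>k. norm (elapsed (a k) (h k) \<sigma> *\<^sub>R v k))"
proof (rule summable_comparison_test[OF _ s], intro exI allI impI)
  fix n
  have "elapsed (a n) (h n) \<sigma> * norm (v n) \<le> h n * norm (v n)"
    by (intro mult_right_mono elapsed_bounds(2)) auto
  thus "norm (norm (elapsed (a n) (h n) \<sigma> *\<^sub>R v n)) \<le> h n * norm (v n)"
    using elapsed_bounds(1)[OF h[of n], of "a n" \<sigma>] by simp
qed

text \<open>The first \<open>N\<close> edges form a Lipschitz curve with constant at most
  \<open>B\<close>; the remaining edges have total length below \<open>\<epsilon> / 2\<close>,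
  whatever the family of intervals.\<close>

lemma abs_continuous_polygon:
  fixes v :: "nat \<Rightarrow> 'a::euclidean_space"
  assumes h: "\<And>k. 0 \<le> h k" and s: "summable (\<lambda>k. h k * norm (v k))"
  shows "abs_continuous (\<lambda>\<sigma>. x0 + (\<Sum>k. elapsed (a k) (h k) \<sigma> *\<^sub>R v k))" (is "abs_continuous ?y")
  unfolding abs_continuous_def
proof (intro allI impI)
  fix \<epsilon> :: real assume \<epsilon>: "\<epsilon> > 0"
  note sn = summable_elapsed[of h v a, OF h s]
  obtain N where N: "(\<Sum>k. h (k + N) * norm (v (k + N))) < \<epsilon> / 2"
  proof -
    have "(\<lambda>N. \<Sum>k. h (k + N) * norm (v (k + N))) \<longlonglongrightarrow> 0" by (rule suminf_exist_split2[OF s])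
    hence "eventually (\<lambda>N. (\<Sum>k. h (k + N) * norm (v (k + N))) < \<epsilon> / 2) sequentially"
      using \<epsilon> by (intro order_tendstoD(2)) auto
    thus ?thesis using that by (auto simp: eventually_sequentially)
  qed
  define B where "B = (\<Sum>k<N. norm (v k)) + 1"
  have B: "B > 0" by (simp add: B_def add_nonneg_pos sum_nonneg)
  have s': "summable (\<lambda>k. h (k + N) * norm (v (k + N)))"
    using s by (subst summable_iff_shift[of "\<lambda>k. h k * norm (v k)"])
  show "\<exists>\<delta>>0. \<forall>P. nonoverlapping P \<and> total_length P < \<delta> \<longrightarrow> sum_increments ?y P < \<epsilon>"
  proof (intro exI[of _ "\<epsilon> / (2 * B)"] conjI allI impI)
    show "0 < \<epsilon> / (2 * B)" using \<epsilon> B by simp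
    fix P assume "nonoverlapping P \<and> total_length P < \<epsilon> / (2 * B)"
    hence P: "nonoverlapping P" "total_length P < \<epsilon> / (2 * B)" by auto
    have finP: "finite P" and lt: "\<And>p. p \<in> P \<Longrightarrow> fst p < snd p" using P(1) by (auto simp: nonoverlapping_def)
    define D where "D = (\<lambda>k p. elapsed (a k) (h k) (snd p) - elapsed (a k) (h k) (fst p))"
    have D0: "0 \<le> D k p" if "p \<in> P" for k p
      using elapsed_mono[of "fst p" "snd p"] lt[OF that] by (simp add: D_def)
    have sD: "summable (\<lambda>k. norm (D k p *\<^sub>R v k))" if "p \<in> P" for p
    proof (rule summable_comparison_test, intro exI allI impI)
      fix n
      have "D n p \<le> h n" using elapsed_bounds(1)[OF h[of n], of "a n" "fst p"]
          elapsed_bounds(2)[of "a n" "h n" "snd p"] unfolding D_def by linarith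
      thus "norm (norm (D n p *\<^sub>R v n)) \<le> h n * norm (v n)"
        using D0[OF that, of n] by (simp add: mult_right_mono)
    qed (rule s)
    have inc: "norm (?y (snd p) - ?y (fst p)) \<le> (\<Sum>k. D k p * norm (v k))" if p: "p \<in> P" for p
    proof -
      have "?y (snd p) - ?y (fst p) = (\<Sum>k. D k p *\<^sub>R v k)"
        unfolding D_def scaleR_left_diff_distrib
        by (simp add: suminf_diff[OF summable_norm_cancel[OF sn] summable_norm_cancel[OF sn]])
      also have "norm \<dots> \<le> (\<Sum>k. norm (D k p *\<^sub>R v k))" by (rule summable_norm[OF sD[OF p]])
      also have "\<dots> = (\<Sum>k. D k p * norm (v k))" using D0[OF p] by simp
      finally show ?thesis .
    qed
    have sD': "summable (\<lambda>k. D k p * norm (v k))" if "p \<in> P" for p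
      using sD[OF that] D0[OF that] by simp
    have "sum_increments ?y P \<le> (\<Sum>p\<in>P. \<Sum>k. D k p * norm (v k))"
      unfolding sum_increments_def by (rule sum_mono) (rule inc)
    also have "\<dots> = (\<Sum>k. \<Sum>p\<in>P. D k p * norm (v k))"
      by (rule suminf_sum[symmetric]) (rule sD')
    also have "\<dots> = (\<Sum>k. \<Sum>p\<in>P. D (k + N) p * norm (v (k + N))) + (\<Sum>k<N. \<Sum>p\<in>P. D k p * norm (v k))"
      by (rule suminf_split_initial_segment) (intro summable_sum sD')
    also have "\<dots> < \<epsilon> / 2 + \<epsilon> / 2"
    proof (rule add_le_less_mono)
      \<comment> \<open>Over the whole family one edge gains at most its own duration, so the tail
        is dominated by the tail of the edge lengths.\<close>
      have "(\<Sum>p\<in>P. D k p) \<le> h k" for k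
      proof (cases "P = {}")
        case False
        define l where "l = Min (fst ` P)"
        define u where "u = Max (snd ` P)"
        have lu: "l \<le> fst p \<and> snd p \<le> u" if "p \<in> P" for p using that finP by (auto simp: l_def u_def)
        have "(\<Sum>p\<in>P. D k p) \<le> elapsed (a k) (h k) u - elapsed (a k) (h k) l"
          unfolding D_def
        proof (rule sum_increments_mono[OF P(1)])
          show "mono (elapsed (a k) (h k))" by (simp add: mono_def elapsed_mono)
          obtain p where "p \<in> P" using False by blast
          thus "l \<le> u" using lu[of p] lt[of p] by linarith
        qed (use lu in auto)
        thus ?thesis using elapsed_bounds(1)[OF h[of k], of "a k" l] elapsed_bounds(2)[of "a k" "h k" u] by linarith
      qed (use h in simp)
      hence le: "(\<Sum>p\<in>P. D k p * norm (v k)) \<le> h k * norm (v k)" for k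
        unfolding sum_distrib_right[symmetric] by (intro mult_right_mono) auto
      have "(\<Sum>k. \<Sum>p\<in>P. D (k + N) p * norm (v (k + N))) \<le> (\<Sum>k. h (k + N) * norm (v (k + N)))"
      proof (rule suminf_le[OF le _ s'])
        have "summable (\<lambda>k. \<Sum>p\<in>P. D k p * norm (v k))" by (intro summable_sum sD')
        thus "summable (\<lambda>k. \<Sum>p\<in>P. D (k + N) p * norm (v (k + N)))"
          by (subst summable_iff_shift[of "\<lambda>k. \<Sum>p\<in>P. D k p * norm (v k)"])
      qed
      thus "(\<Sum>k. \<Sum>p\<in>P. D (k + N) p * norm (v (k + N))) \<le> \<epsilon> / 2" using N by simp
      have "(\<Sum>k<N. \<Sum>p\<in>P. D k p * norm (v k)) \<le> (\<Sum>k<N. total_length P * norm (v k))"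
      proof (rule sum_mono)
        fix k
        have "(\<Sum>p\<in>P. D k p) \<le> total_length P"
          unfolding total_length_def D_def
          by (rule sum_mono) (use lt elapsed_lipschitz less_imp_le in blast)
        thus "(\<Sum>p\<in>P. D k p * norm (v k)) \<le> total_length P * norm (v k)"
          unfolding sum_distrib_right[symmetric] by (intro mult_right_mono) auto
      qed
      also have "\<dots> \<le> total_length P * B"
      proof -
        have "total_length P \<ge> 0" unfolding total_length_def by (rule sum_nonneg) (use lt less_imp_le in fastforce)
        thus ?thesis unfolding sum_distrib_left[symmetric] by (intro mult_left_mono) (auto simp: B_def)
      qed
      also have "\<dots> < \<epsilon> / (2 * B) * B" using P(2) B by (intro mult_strict_right_mono) auto
      also have "\<dots> = \<epsilon> / 2" using B by simp
      finally show "(\<Sum>k<N. \<Sum>p\<in>P. D k p * norm (v k)) < \<epsilon> / 2" .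
    qed
    finally show "sum_increments ?y P < \<epsilon>" by simp
  qed
qed

text \<open>At the accumulation time \<open>T\<close> every edge is fully elapsed, so the series
  equals the limit of the vertices; this yields the end value \<open>xs\<close>.\<close>

lemma polygon_curve:
  fixes v :: "nat \<Rightarrow> 'a::euclidean_space"
  assumes h: "\<And>k. 0 < h k" and summ: "summable (\<lambda>k. h k * norm (v k))"
    and s: "s 0 = 0" "\<And>k. s (Suc k) = s k + h k" "s \<longlonglongrightarrow> T"
    and x: "\<And>k. x (Suc k) = x k + h k *\<^sub>R v k" "x \<longlonglongrightarrow> xs"
  obtains y where "abs_continuous y" "\<And>k \<sigma>. s k \<le> \<sigma> \<Longrightarrow> \<sigma> \<le> s (Suc k) \<Longrightarrow> y \<sigma> = x k + (\<sigma> - s k) *\<^sub>R v k"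
    "y 0 = x 0" "y T = xs"
proof -
  define y where "y = (\<lambda>\<sigma>. x 0 + (\<Sum>k. elapsed (s k) (h k) \<sigma> *\<^sub>R v k))"
  have h0: "0 \<le> h k" for k using h[of k] by simp
  have sx: "s n = (\<Sum>k<n. h k)" "x n = x 0 + (\<Sum>k<n. h k *\<^sub>R v k)" for n
    by (induction n) (auto simp: s x(1))
  have mono: "s j \<le> s k" if "j \<le> k" for j k
    by (rule lift_Suc_mono_le[OF _ that]) (use s(2) h0 in simp)
  have val: "y \<sigma> = x k + (\<sigma> - s k) *\<^sub>R v k" if "s k \<le> \<sigma>" "\<sigma> \<le> s (Suc k)" for k \<sigma>
  proof -
    have "elapsed (s j) (h j) \<sigma> = 0" if "j \<ge> Suc k" for j
      using mono[OF that] \<open>\<sigma> \<le> s (Suc k)\<close> h0[of j] by (simp add: elapsed_def)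
    hence "(\<Sum>j. elapsed (s j) (h j) \<sigma> *\<^sub>R v j) = (\<Sum>j<Suc k. elapsed (s j) (h j) \<sigma> *\<^sub>R v j)"
      by (intro suminf_finite) (auto simp: not_less)
    also have "\<dots> = (\<Sum>j<k. h j *\<^sub>R v j) + (\<sigma> - s k) *\<^sub>R v k"
    proof -
      have "elapsed (s j) (h j) \<sigma> = h j" if "j < k" for j
        using mono[of "Suc j" k] that \<open>s k \<le> \<sigma>\<close> s(2)[of j] h0[of j] by (simp add: elapsed_def)
      moreover have "elapsed (s k) (h k) \<sigma> = \<sigma> - s k" using that s(2)[of k] by (simp add: elapsed_def)
      ultimately show ?thesis by simp
    qed
    finally show ?thesis by (simp add: y_def sx(2)[of k])
  qed
  have "y T = xs"
  proof -
    have sT: "s k \<le> T" for k using s(3) mono by (intro incseq_le) (auto simp: incseq_def)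
    have "elapsed (s j) (h j) T = h j" for j
      using sT[of "Suc j"] s(2)[of j] h0[of j] by (simp add: elapsed_def)
    hence "y T = x 0 + (\<Sum>j. h j *\<^sub>R v j)" by (simp add: y_def)
    moreover have "(\<lambda>n. x 0 + (\<Sum>k<n. h k *\<^sub>R v k)) \<longlonglongrightarrow> x 0 + (\<Sum>j. h j *\<^sub>R v j)"
    proof (intro tendsto_intros summable_LIMSEQ)
      show "summable (\<lambda>k. h k *\<^sub>R v k)"
        by (rule summable_norm_cancel) (use summ h0 in simp)
    qed
    moreover have "(\<lambda>n. x 0 + (\<Sum>k<n. h k *\<^sub>R v k)) \<longlonglongrightarrow> xs"
      using x(2) by (subst (asm) sx(2)[abs_def])
    ultimately show ?thesis using LIMSEQ_unique by metis
  qed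
  moreover have "abs_continuous y" unfolding y_def by (rule abs_continuous_polygon[OF h0 summ])
  moreover have "y 0 = x 0" using val[of 0 0] s h0[of 0] by simp
  ultimately show ?thesis using that val by blast
qed

section \<open>Subgradients of lower semicontinuous functions\<close>

lemma lsc_on_sequentially:
  fixes f :: "'a::metric_space \<Rightarrow> ereal"
  assumes f: "lsc_on S f" and x: "x \<in> S" and X: "\<And>n. X n \<in> S" "X \<longlonglongrightarrow> x"
    and c: "\<And>n. f (X n) \<le> ereal (c n)" "c \<longlonglongrightarrow> l"
  shows "f x \<le> ereal l"
proof (rule ccontr)
  assume "\<not> f x \<le> ereal l"
  hence "ereal l < f x" by simp
  then obtain e where e: "ereal l < e" "e < f x" using dense by blast
  have "f x \<le> Liminf (at x within S) f" using f x by (auto simp: lsc_on_def)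
  hence "eventually (\<lambda>y. e < f y) (at x within S)" using e(2) by (auto simp: le_Liminf_iff)
  then obtain d where d: "d > 0" "\<And>y. y \<in> S \<Longrightarrow> y \<noteq> x \<Longrightarrow> dist y x < d \<Longrightarrow> e < f y"
    unfolding eventually_at by blast
  have "eventually (\<lambda>n. dist (X n) x < d) sequentially" using X(2) d(1) by (rule tendstoD)
  moreover have "eventually (\<lambda>n. ereal (c n) < e) sequentially"
    using c(2) e(1) by (intro order_tendstoD) (auto simp: lim_ereal)
  ultimately have "eventually (\<lambda>n. False) sequentially"
  proof eventually_elim
    case (elim n)
    have "e < f (X n)" using d(2)[of "X n"] X(1) elim(1) e(2) by (cases "X n = x") auto
    with elim(2) c(1)[of n] show False by (meson leD less_le_trans less_trans)
  qed
  thus False by simp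
qed

text \<open>After division by \<open>norm (z' - z)\<close> the quadratic error is
  \<open>c * norm (z' - z)\<close>, which tends to 0: a proximal subgradient is a
  subgradient.\<close>

lemma subdifferentialI:
  assumes Wz: "W z = ereal w" and "\<rho> > 0" and
    ineq: "\<And>z'. norm (z' - z) < \<rho> \<Longrightarrow> ereal (w + p \<bullet> (z' - z) - c * (norm (z' - z))\<^sup>2) \<le> W z'"
  shows "p \<in> subdifferential W z"
proof -
  have "0 \<le> Liminf (at z) (\<lambda>z'. (W z' - W z - ereal (p \<bullet> (z' - z))) / ereal (norm (z' - z)))"
    unfolding le_Liminf_iff
  proof (intro allI impI)
    fix e :: ereal assume "e < 0"
    then obtain e' :: real where e': "e < ereal e'" "e' < 0"
      using dense[of e 0] by (metis ereal_dense2 ereal_less(4) less_ereal.simps(1) zero_ereal_def)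
    define \<delta> where "\<delta> = min \<rho> (- e' / (\<bar>c\<bar> + 1))"
    have \<delta>: "\<delta> > 0" using e' \<open>\<rho> > 0\<close> by (auto simp: \<delta>_def intro!: divide_neg_pos)
    show "eventually (\<lambda>z'. e < (W z' - W z - ereal (p \<bullet> (z' - z))) / ereal (norm (z' - z))) (at z)"
      unfolding eventually_at
    proof (intro exI[of _ \<delta>] conjI ballI impI \<delta>)
      fix z' assume z': "z' \<noteq> z \<and> dist z' z < \<delta>"
      define a where "a = norm (z' - z)"
      have a: "a > 0" "a < \<rho>" "a < - e' / (\<bar>c\<bar> + 1)" using z' by (auto simp: a_def \<delta>_def dist_norm)
      have "c * a \<le> (\<bar>c\<bar> + 1) * a" using a(1) by (intro mult_right_mono) auto
      also have "\<dots> < - e'" using a(3) by (simp add: field_simps)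
      finally have ca: "e' < - c * a" by simp
      have le: "ereal (w + p \<bullet> (z' - z) - c * a\<^sup>2) \<le> W z'" using ineq[of z'] a(2) by (simp add: a_def)
      have "ereal (- c * a) \<le> (W z' - W z - ereal (p \<bullet> (z' - z))) / ereal a"
      proof (cases "W z'")
        case (real v)
        hence "- c * a\<^sup>2 \<le> v - w - p \<bullet> (z' - z)" using le by simp
        hence "- c * a \<le> (v - w - p \<bullet> (z' - z)) / a" using a(1) by (simp add: field_simps power2_eq_square)
        thus ?thesis using real Wz a(1) by simp
      qed (use le Wz a(1) in auto)
      thus "e < (W z' - W z - ereal (p \<bullet> (z' - z))) / ereal (norm (z' - z))"
        using e'(1) ca unfolding a_def by (meson less_ereal.simps(1) less_le_trans less_trans)
    qed
  qed
  thus ?thesis using Wz by (simp add: subdifferential_def)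
qed

text \<open>\<open>l\<close> makes the truncated cone compact, \<open>bd\<close> keeps the minimizer
  off the face \<open>l q = h\<close>, and a large penalty \<open>n\<close> keeps it off
  \<open>norm d = r\<close>. At such a minimizer, varying \<open>d\<close> alone gives the
  subgradient, and varying \<open>q\<close> together with \<open>d\<close> gives its sign on the
  cone.\<close>

lemma multidirectional_mean_value:
  fixes W :: "'z::euclidean_space \<Rightarrow> ereal" and Q :: "'b::euclidean_space set"
    and A :: "'b \<Rightarrow> 'z" and l g :: "'b \<Rightarrow> real"
  assumes lsc: "lsc_on S W" and nonneg: "\<And>z. z \<in> S \<Longrightarrow> 0 \<le> W z" and W0: "W z0 = ereal w0"
    and Q: "closed Q" "0 \<in> Q" "\<And>q q'. q \<in> Q \<Longrightarrow> q' \<in> Q \<Longrightarrow> q + q' \<in> Q"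
      "\<And>q c. q \<in> Q \<Longrightarrow> 0 \<le> c \<Longrightarrow> c *\<^sub>R q \<in> Q"
    and l: "linear l" "\<And>q. q \<in> Q \<Longrightarrow> norm q \<le> C * l q" "C > 0"
    and A: "linear A" and g: "linear g"
    and h: "0 < h" and r: "0 < r"
    and S: "\<And>q d. q \<in> Q \<Longrightarrow> l q \<le> h \<Longrightarrow> norm d \<le> r \<Longrightarrow> z0 + A q + d \<in> S"
    and bd: "\<And>q d. q \<in> Q \<Longrightarrow> l q = h \<Longrightarrow> norm d \<le> r \<Longrightarrow> ereal (w0 - g q) < W (z0 + A q + d)"
  shows "\<exists>q d p. q \<in> Q \<and> l q < h \<and> norm d < r \<and> p \<in> subdifferential W (z0 + A q + d)
           \<and> (\<forall>q'\<in>Q. 0 \<le> p \<bullet> A q' + g q')"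
proof -
  have contl: "continuous_on UNIV l" "continuous_on UNIV A" "continuous_on UNIV g"
    using l(1) A g linear_continuous_on linear_conv_bounded_linear by blast+
  define K where "K = {q\<in>Q. l q \<le> h} \<times> cball (0::'z) r"
  have "bounded {q\<in>Q. l q \<le> h}"
  proof (rule boundedI)
    fix q assume "q \<in> {q\<in>Q. l q \<le> h}"
    thus "norm q \<le> C * h" using l(2)[of q] l(3) by (auto intro: order_trans mult_left_mono)
  qed
  moreover have "closed {q\<in>Q. l q \<le> h}"
  proof -
    have "closed {q. l q \<le> h}" using contl(1) by (intro closed_Collect_le) auto
    moreover have "{q\<in>Q. l q \<le> h} = Q \<inter> {q. l q \<le> h}" by blast
    ultimately show ?thesis using Q(1) by auto
  qed
  ultimately have cQ: "compact {q\<in>Q. l q \<le> h}" by (simp add: compact_eq_bounded_closed)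
  hence cK: "compact K" unfolding K_def by (intro compact_Times) auto
  obtain G where G: "\<And>q. q \<in> Q \<Longrightarrow> l q \<le> h \<Longrightarrow> \<bar>g q\<bar> \<le> G"
  proof -
    have "compact (g ` {q\<in>Q. l q \<le> h})"
      using contl(3) continuous_on_subset by (intro compact_continuous_image cQ) blast
    hence "bounded (g ` {q\<in>Q. l q \<le> h})" by (rule compact_imp_bounded)
    thus ?thesis using that unfolding bounded_iff by (metis (mono_tags, lifting) image_eqI mem_Collect_eq real_norm_def)
  qed
  have l0: "l 0 = 0" "g 0 = 0" "A 0 = 0" using linear_0 l(1) g A by auto
  have G0: "G \<ge> 0" using G[OF Q(2)] l0 h by simp
  have w0: "w0 \<ge> 0" using nonneg[of z0] S[OF Q(2), of 0] l0 h r W0 by simp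
  \<comment> \<open>On \<open>norm d = r\<close> the penalty equals \<open>w0 + G + 1\<close>, more
    than the comparison with \<open>(0, 0)\<close> allows, since \<open>W \<ge> 0\<close> and
    \<open>- g q \<le> G\<close>.\<close>
  define n where "n = (w0 + G + 1) / r\<^sup>2"
  have n: "n > 0" using w0 G0 r by (auto simp: n_def intro!: divide_pos_pos)
  define f where "f = (\<lambda>(q, d). real_of_ereal (W (z0 + A q + d)) + n * (norm d)\<^sup>2 + g q)"
  define V where "V = {(q, d)\<in>K. W (z0 + A q + d) \<noteq> \<infinity>}"
  have VS: "z0 + A q + d \<in> S" if "(q, d) \<in> K" for q d using that S by (auto simp: K_def)
  have Wr: "W (z0 + A q + d) = ereal (real_of_ereal (W (z0 + A q + d)))"
      "0 \<le> real_of_ereal (W (z0 + A q + d))" if "(q, d) \<in> V" for q d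
    using that nonneg[OF VS, of q d] by (cases "W (z0 + A q + d)"; force simp: V_def)+
  have V0: "(0, 0) \<in> V" using Q(2) l0 h r W0 by (auto simp: V_def K_def)
  have lower: "- G \<le> f p" if "p \<in> V" for p
  proof (cases p)
    case (Pair q d)
    have "\<bar>g q\<bar> \<le> G" using that Pair G by (auto simp: V_def K_def)
    moreover have "0 \<le> n * (norm d)\<^sup>2" using n by simp
    ultimately show ?thesis using Wr(2)[of q d] that Pair by (simp add: f_def)
  qed
  define m where "m = Inf (f ` V)"
  have bdd: "bdd_below (f ` V)" using lower by (intro bdd_belowI[of _ "-G"]) auto
  have m_le: "m \<le> f p" if "p \<in> V" for p unfolding m_def by (rule cINF_lower[OF bdd that])
  have "\<exists>p\<in>V. f p < m + inverse (real (Suc k))" for k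
  proof -
    have "Inf (f ` V) < m + inverse (real (Suc k))" unfolding m_def by simp
    thus ?thesis using V0 cInf_less_iff[OF _ bdd] by blast
  qed
  then obtain X where X: "\<And>k. X k \<in> V" "\<And>k. f (X k) < m + inverse (real (Suc k))" by metis
  have "\<forall>k. X k \<in> K"
  proof
    fix k show "X k \<in> K" using X(1)[of k] by (cases "X k") (auto simp: V_def)
  qed

  then obtain qd \<sigma> where lim: "qd \<in> K" "strict_mono \<sigma>" "(X \<circ> \<sigma>) \<longlonglongrightarrow> qd"
    using cK unfolding compact_def by metis
  obtain q d where qd: "qd = (q, d)" by force
  define qs where "qs = (\<lambda>k. fst (X (\<sigma> k)))"
  define ds where "ds = (\<lambda>k. snd (X (\<sigma> k)))"
  have qs: "qs \<longlonglongrightarrow> q" using tendsto_fst[OF lim(3)] qd by (simp add: qs_def o_def)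
  have ds: "ds \<longlonglongrightarrow> d" using tendsto_snd[OF lim(3)] qd by (simp add: ds_def o_def)
  have Vs: "(qs k, ds k) \<in> V" for k using X(1)[of "\<sigma> k"] by (simp add: qs_def ds_def)
  define cs where "cs = (\<lambda>k. m + inverse (real (Suc (\<sigma> k))) - n * (norm (ds k))\<^sup>2 - g (qs k))"
  have tA: "(\<lambda>k. A (qs k)) \<longlonglongrightarrow> A q" using contl(2) qs
    by (intro continuous_on_tendsto_compose[of UNIV A]) auto
  have tg: "(\<lambda>k. g (qs k)) \<longlonglongrightarrow> g q" using contl(3) qs
    by (intro continuous_on_tendsto_compose[of UNIV g]) auto
  have t0: "(\<lambda>k. inverse (real (Suc (\<sigma> k)))) \<longlonglongrightarrow> 0"
    using LIMSEQ_subseq_LIMSEQ[OF LIMSEQ_inverse_real_of_nat lim(2)] by (simp add: o_def)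
  \<comment> \<open>Along the minimizing sequence the values of \<open>W\<close> are bounded by the
    convergent \<open>cs\<close>, so lower semicontinuity makes the limit a minimizer at which
    \<open>W\<close> is finite.\<close>
  have Wqd: "W (z0 + A q + d) \<le> ereal (m + 0 - n * (norm d)\<^sup>2 - g q)"
  proof (rule lsc_on_sequentially[OF lsc])
    show "z0 + A q + d \<in> S" using VS lim(1) qd by blast
    show "z0 + A (qs k) + ds k \<in> S" for k using VS Vs[of k] by (auto simp: V_def)
    show "(\<lambda>k. z0 + A (qs k) + ds k) \<longlonglongrightarrow> z0 + A q + d" by (intro tendsto_intros tA ds)
    show "cs \<longlonglongrightarrow> m + 0 - n * (norm d)\<^sup>2 - g q" unfolding cs_def
      by (intro tendsto_intros t0 ds tg)
    show "W (z0 + A (qs k) + ds k) \<le> ereal (cs k)" for k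
    proof -
      have "f (qs k, ds k) \<le> m + inverse (real (Suc (\<sigma> k)))"
        using X(2)[of "\<sigma> k"] by (simp add: qs_def ds_def)
      thus ?thesis by (subst Wr(1)[OF Vs]) (simp add: f_def cs_def)
    qed
  qed
  hence qdV: "(q, d) \<in> V" using lim(1) qd by (auto simp: V_def)
  have qK: "q \<in> Q" "l q \<le> h" "norm d \<le> r" using qdV by (auto simp: V_def K_def)
  define w where "w = real_of_ereal (W (z0 + A q + d))"
  have w: "W (z0 + A q + d) = ereal w" "w \<ge> 0" unfolding w_def using Wr[OF qdV] by auto
  have opt: "ereal (w + n * (norm d)\<^sup>2 + g q - n * (norm d')\<^sup>2 - g q') \<le> W (z0 + A q' + d')"
    if "q' \<in> Q" "l q' \<le> h" "norm d' \<le> r" for q' d'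
  proof (cases "W (z0 + A q' + d') = \<infinity>")
    case False
    hence V': "(q', d') \<in> V" using that by (auto simp: V_def K_def)
    have "w + n * (norm d)\<^sup>2 + g q \<le> m" using Wqd w by simp
    also have "m \<le> f (q', d')" by (rule m_le[OF V'])
    finally show ?thesis by (subst Wr(1)[OF V']) (simp add: f_def)
  qed simp
  have opt0: "w + n * (norm d)\<^sup>2 + g q \<le> w0"
    using opt[OF Q(2), of 0] l0 h r W0 by simp
  have dr: "norm d < r"
  proof (rule ccontr)
    assume "\<not> norm d < r"
    hence "norm d = r" using qK(3) by simp
    hence "n * (norm d)\<^sup>2 = w0 + G + 1" using r by (simp add: n_def)
    moreover have "- g q \<le> G" using G[OF qK(1,2)] by simp
    ultimately show False using opt0 w(2) by simp
  qed
  have lh: "l q < h"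
  proof (rule ccontr)
    assume "\<not> l q < h"
    hence "ereal (w0 - g q) < W (z0 + A q + d)" using bd[of q d] qK by simp
    moreover have "0 \<le> n * (norm d)\<^sup>2" using n by simp
    ultimately show False using w opt0 by simp
  qed
  \<comment> \<open>Minus the gradient of the penalty \<open>n * (norm d)\<^sup>2\<close>.\<close>
  define p where "p = - (2 * n) *\<^sub>R d"
  have sub: "p \<in> subdifferential W (z0 + A q + d)"
  proof (rule subdifferentialI[where W = W and w = w and \<rho> = "r - norm d" and c = n])
    show "W (z0 + A q + d) = ereal w" by (rule w(1))
    show "r - norm d > 0" using dr by simp
    fix z' assume z': "norm (z' - (z0 + A q + d)) < r - norm d"
    define v where "v = z' - (z0 + A q + d)"
    have "norm (d + v) \<le> r" using norm_triangle_ineq[of d v] z' by (simp add: v_def)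
    from opt[OF qK(1,2) this]
    have "ereal (w + n * (norm d)\<^sup>2 - n * (norm (d + v))\<^sup>2) \<le> W (z0 + A q + (d + v))"
      by (simp add: algebra_simps)
    moreover have "z0 + A q + (d + v) = z'" by (simp add: v_def)
    moreover have "w + n * (norm d)\<^sup>2 - n * (norm (d + v))\<^sup>2 = w + p \<bullet> v - n * (norm v)\<^sup>2"
      by (simp add: p_def power2_norm_eq_inner inner_add_left inner_add_right algebra_simps inner_commute)
    ultimately show "ereal (w + p \<bullet> (z' - (z0 + A q + d)) - n * (norm (z' - (z0 + A q + d)))\<^sup>2) \<le> W z'"
      by (simp only: v_def[symmetric])
  qed
  \<comment> \<open>Replacing \<open>(q, d)\<close> by
    \<open>(q + c *\<^sub>R q', d - c *\<^sub>R A q')\<close> leaves the argument of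
    \<open>W\<close> unchanged, so minimality compares only the penalty and \<open>g\<close>; the
    first-order term in \<open>c\<close> is \<open>p \<bullet> A q' + g q'\<close>.\<close>
  have dir: "0 \<le> p \<bullet> A q' + g q'" if q': "q' \<in> Q" for q'
  proof (rule ccontr)
    assume neg: "\<not> 0 \<le> p \<bullet> A q' + g q'"
    define a where "a = - (p \<bullet> A q' + g q')"
    have a: "a > 0" using neg by (simp add: a_def)
    \<comment> \<open>The three bounds respect \<open>l \<le> h\<close>, respect
      \<open>norm \<le> r\<close>, and make the quadratic remainder smaller than the assumed
      negative slope.\<close>
    define c where "c = min (min ((h - l q) / (\<bar>l q'\<bar> + 1)) ((r - norm d) / (norm (A q') + 1)))
        (a / (n * (norm (A q'))\<^sup>2 + 1))"
    have nA: "n * (norm (A q'))\<^sup>2 \<ge> 0" using n by simp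
    have c: "c > 0" using lh dr a nA unfolding c_def by (simp add: add_nonneg_pos)
    have c1: "c * (\<bar>l q'\<bar> + 1) \<le> h - l q"
    proof -
      have "c \<le> (h - l q) / (\<bar>l q'\<bar> + 1)" by (simp add: c_def)
      thus ?thesis by (simp add: pos_le_divide_eq add_nonneg_pos)
    qed
    have c2: "c * (norm (A q') + 1) \<le> r - norm d"
    proof -
      have "c \<le> (r - norm d) / (norm (A q') + 1)" by (simp add: c_def)
      thus ?thesis by (simp add: pos_le_divide_eq add_nonneg_pos)
    qed
    have c3: "c * (n * (norm (A q'))\<^sup>2 + 1) \<le> a"
    proof -
      have "c \<le> a / (n * (norm (A q'))\<^sup>2 + 1)" by (simp add: c_def)
      thus ?thesis using nA by (simp add: pos_le_divide_eq add_nonneg_pos)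
    qed
    have "c * l q' \<le> c * (\<bar>l q'\<bar> + 1)" using c by (intro mult_left_mono) auto
    hence lq: "l (q + c *\<^sub>R q') \<le> h" using c1 l(1) by (simp add: linear_add linear_scale)
    have "norm (d - c *\<^sub>R A q') \<le> norm d + c * norm (A q')"
      using norm_triangle_ineq4[of d "c *\<^sub>R A q'"] c by simp
    also have "\<dots> \<le> r" using c2 c by (simp add: algebra_simps)
    finally have nd: "norm (d - c *\<^sub>R A q') \<le> r" .
    have "q + c *\<^sub>R q' \<in> Q" using Q(3,4) qK(1) q' c by simp
    from opt[OF this lq nd]
    have "ereal (w + n * (norm d)\<^sup>2 + g q - n * (norm (d - c *\<^sub>R A q'))\<^sup>2 - g (q + c *\<^sub>R q')) \<le> ereal w"
      using A w by (simp add: linear_add linear_scale)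
    hence "n * (norm d)\<^sup>2 - n * (norm (d - c *\<^sub>R A q'))\<^sup>2 - c * g q' \<le> 0"
      using g by (simp add: linear_add linear_scale)
    moreover have "n * (norm d)\<^sup>2 - n * (norm (d - c *\<^sub>R A q'))\<^sup>2 = - c * (p \<bullet> A q') - n * c\<^sup>2 * (norm (A q'))\<^sup>2"
    proof -
      have eq: "(norm (d - c *\<^sub>R A q'))\<^sup>2 = (norm d)\<^sup>2 - 2 * c * (d \<bullet> A q') + c\<^sup>2 * (norm (A q'))\<^sup>2"
        by (simp add: power2_norm_eq_inner inner_diff_left inner_diff_right inner_commute)
           (simp add: power2_eq_square)
      show ?thesis unfolding eq by (simp add: p_def algebra_simps)
    qed
    ultimately have "c * a \<le> c * (c * (n * (norm (A q'))\<^sup>2))"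
      by (simp add: a_def algebra_simps power2_eq_square)
    hence "a \<le> c * (n * (norm (A q'))\<^sup>2)" using c by simp
    thus False using c3 c by (simp add: algebra_simps)
  qed
  show ?thesis using qK(1) lh dr sub dir by blast
qed

text \<open>A supporting hyperplane of the epigraph at \<open>(u, f u)\<close>. It is not vertical:
  it is strict at the interior point \<open>(u, f u + 1)\<close>, which gives
  \<open>c > 0\<close>.\<close>

lemma convex_on_subgradient:
  fixes f :: "'a::euclidean_space \<Rightarrow> real"
  assumes f: "convex_on UNIV f"
  obtains p where "\<And>w. f u + p \<bullet> (w - u) \<le> f w"
proof -
  have cont: "continuous_on UNIV f" by (rule convex_on_continuous[OF open_UNIV f])
  define E where "E = {z. f (fst z) \<le> snd z}"
  have "convex E" using f convex_epigraph[of UNIV f] by (simp add: E_def epigraph_def)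
  define x0 where "x0 = (u, f u)"
  have cl: "closed E"
  proof -
    have "closed {z::'a \<times> real. f (fst z) \<le> snd z}"
      by (intro closed_Collect_le continuous_intros continuous_on_compose2[OF cont]) auto
    thus ?thesis by (simp add: E_def)
  qed
  have x0E: "x0 \<in> E" by (simp add: x0_def E_def)
  have ntop: "x0 \<notin> interior E"
  proof
    assume "x0 \<in> interior E"
    then obtain e where e: "e > 0" "ball x0 e \<subseteq> E" by (meson mem_interior)
    have "(u, f u - e/2) \<in> ball x0 e" using e by (simp add: x0_def dist_Pair_Pair dist_norm)
    thus False using e by (auto simp: E_def)
  qed
  have iE: "(u, f u + 1) \<in> interior E"
  proof -
    have "open {z::'a \<times> real. f (fst z) < snd z}"
      by (intro open_Collect_less continuous_intros continuous_on_compose2[OF cont]) auto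
    moreover have "{z::'a \<times> real. f (fst z) < snd z} \<subseteq> E" by (auto simp: E_def)
    ultimately have "{z::'a \<times> real. f (fst z) < snd z} \<subseteq> interior E" using interior_maximal by blast
    thus ?thesis by auto
  qed
  have "x0 \<notin> rel_interior E" using ntop iE rel_interior_nonempty_interior[of E] by blast
  then obtain a where a: "a \<noteq> 0" "\<And>z. z \<in> closure E \<Longrightarrow> a \<bullet> x0 \<le> a \<bullet> z"
      "\<And>z. z \<in> rel_interior E \<Longrightarrow> a \<bullet> x0 < a \<bullet> z"
    using supporting_hyperplane_relative_frontier[OF \<open>convex E\<close>, of x0] x0E closure_subset by blast
  obtain b c where bc: "a = (b, c)" by force
  have ineq: "b \<bullet> u + c * f u \<le> b \<bullet> w + c * y" if "f w \<le> y" for w y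
  proof -
    have "(w, y) \<in> closure E" using that closure_subset[of E] by (force simp: E_def)
    from a(2)[OF this] show ?thesis by (simp add: bc x0_def)
  qed
  have "a \<bullet> x0 < a \<bullet> (u, f u + 1)" using a(3) iE interior_subset_rel_interior by blast
  hence c: "c > 0" by (simp add: bc x0_def algebra_simps)
  show ?thesis
  proof
    fix w
    have "b \<bullet> u + c * f u \<le> b \<bullet> w + c * f w" by (rule ineq) simp
    hence "c * (f u + (- (1/c) *\<^sub>R b) \<bullet> (w - u)) \<le> c * f w"
      using c by (simp add: algebra_simps inner_diff_right)
    thus "f u + (- (1/c) *\<^sub>R b) \<bullet> (w - u) \<le> f w" using c by (simp only: mult_le_cancel_left_pos)
  qed
qed

section \<open>Growth of a solution along segments\<close>

locale tonelli_lagrangian =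
  fixes L :: "'a::euclidean_space \<times> 'a \<Rightarrow> real" and \<Theta> :: "'a \<Rightarrow> real"
  assumes L_nonneg: "0 \<le> L (x, u)"
    and L_convex: "convex_on UNIV (\<lambda>u. L (x, u))"
    and Theta_superlinear: "filterlim (\<lambda>u. \<Theta> u / norm u) at_top at_infinity"
    and L_ge_Theta: "\<Theta> u \<le> L (x, u)"
    and L_cont: "continuous_on UNIV L"
begin

text \<open>Superlinearity in the form used throughout: any slope \<open>c\<close> is available,
  uniformly in \<open>x\<close>, at the price of a constant. Below the radius where
  \<open>\<Theta>\<close> dominates, that constant absorbs \<open>c * norm u\<close>.\<close>

lemma Theta_lower_bound: "\<exists>M\<ge>0. \<forall>x u. c * norm u \<le> L (x, u) + M"
proof -
  have "eventually (\<lambda>u. c \<le> \<Theta> u / norm u) at_infinity"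
    using Theta_superlinear by (auto simp: filterlim_at_top)
  then obtain b where b: "\<And>u. b \<le> norm u \<Longrightarrow> c \<le> \<Theta> u / norm u" by (auto simp: eventually_at_infinity)
  define M where "M = \<bar>c\<bar> * (\<bar>b\<bar> + 1)"
  have "c * norm u \<le> L (x, u) + M" for x u
  proof (cases "\<bar>b\<bar> + 1 \<le> norm u")
    case True
    hence "c \<le> \<Theta> u / norm u" "norm u > 0" using b[of u] by auto
    hence "c * norm u \<le> \<Theta> u" by (simp add: field_simps)
    moreover have "M \<ge> 0" by (simp add: M_def)
    ultimately show ?thesis using L_ge_Theta[of u x] by simp
  next
    case False
    have "c * norm u \<le> \<bar>c\<bar> * norm u" by (simp add: mult_right_mono)
    also have "\<dots> \<le> M" unfolding M_def using False by (intro mult_left_mono) auto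
    finally show ?thesis using L_nonneg[of x u] by simp
  qed
  moreover have "M \<ge> 0" by (simp add: M_def)
  ultimately show ?thesis by blast
qed

lemma L_uniformly_continuous:
  assumes "e > 0"
  obtains \<delta> where "\<delta> > 0" "\<And>x x' u u'. norm x \<le> R \<Longrightarrow> norm x' \<le> R \<Longrightarrow> norm u \<le> R \<Longrightarrow> norm u' \<le> R \<Longrightarrow>
    norm (x - x') \<le> \<delta> \<Longrightarrow> norm (u - u') \<le> \<delta> \<Longrightarrow> \<bar>L (x, u) - L (x', u')\<bar> < e"
proof -
  have "uniformly_continuous_on (cball 0 R \<times> cball 0 R) L"
    by (intro compact_uniformly_continuous continuous_on_subset[OF L_cont] compact_Times) auto
  then obtain d where d: "d > 0" "\<And>z z'. z \<in> cball 0 R \<times> cball 0 R \<Longrightarrow> z' \<in> cball 0 R \<times> cball 0 R \<Longrightarrow>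
      dist z z' < d \<Longrightarrow> dist (L z) (L z') < e"
    using assms unfolding uniformly_continuous_on_def by (metis dist_commute)
  show ?thesis
  proof
    show "d / 3 > 0" using d by simp
    fix x x' u u' :: 'a
    assume a: "norm x \<le> R" "norm x' \<le> R" "norm u \<le> R" "norm u' \<le> R" "norm (x - x') \<le> d / 3" "norm (u - u') \<le> d / 3"
    have "dist (x, u) (x', u') \<le> dist x x' + dist u u'"
      unfolding dist_Pair_Pair by (rule sqrt_sum_squares_le_sum) auto
    also have "\<dots> < d" using a(5,6) d(1) by (simp add: dist_norm)
    finally have "dist (L (x, u)) (L (x', u')) < e" using d(2)[of "(x, u)" "(x', u')"] a by simp
    thus "\<bar>L (x, u) - L (x', u')\<bar> < e" by (simp add: dist_real_def)
  qed
qed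

text \<open>
  The support inequalities say that \<open>(\<tau>, u, \<rho>)\<close> lies in the closed convex cone generated by the
  triples \<open>(1, v, r)\<close> with \<open>r \<ge> L (x, v)\<close> and \<open>\<bar>x - x\<^sub>0\<bar> \<le> e\<close>.  Allowing \<open>\<tau> = 0\<close> makes its base compact
  although the velocities \<open>v\<close> are unbounded.
\<close>

definition velocity_cone :: "real \<Rightarrow> 'a \<Rightarrow> (real \<times> 'a \<times> real) set" where
  "velocity_cone e x0 = {(\<tau>, u, \<rho>). 0 \<le> \<tau> \<and>
     (\<forall>p m. (\<forall>x\<in>cball x0 e. \<forall>v. p \<bullet> v - L (x, v) \<le> m) \<longrightarrow> p \<bullet> u \<le> \<rho> + \<tau> * m)}"

lemma velocity_cone_add:
  assumes "q \<in> velocity_cone e x0" "q' \<in> velocity_cone e x0"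
  shows "q + q' \<in> velocity_cone e x0"
proof -
  obtain \<tau> u \<rho> \<tau>' u' \<rho>' where q: "q = (\<tau>, u, \<rho>)" "q' = (\<tau>', u', \<rho>')" by (metis prod_cases3)
  have "p \<bullet> (u + u') \<le> (\<rho> + \<rho>') + (\<tau> + \<tau>') * m" if "\<forall>x\<in>cball x0 e. \<forall>v. p \<bullet> v - L (x, v) \<le> m" for p m
  proof -
    have "p \<bullet> u \<le> \<rho> + \<tau> * m" "p \<bullet> u' \<le> \<rho>' + \<tau>' * m"
      using assms that unfolding q velocity_cone_def by blast+
    thus ?thesis by (simp add: inner_add_right algebra_simps)
  qed
  thus ?thesis using assms unfolding q velocity_cone_def by auto
qed

lemma velocity_cone_scale:
  assumes "q \<in> velocity_cone e x0" "0 \<le> c"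
  shows "c *\<^sub>R q \<in> velocity_cone e x0"
proof -
  obtain \<tau> u \<rho> where q: "q = (\<tau>, u, \<rho>)" by (metis prod_cases3)
  have "p \<bullet> (c *\<^sub>R u) \<le> c * \<rho> + c * \<tau> * m" if "\<forall>x\<in>cball x0 e. \<forall>v. p \<bullet> v - L (x, v) \<le> m" for p m
  proof -
    have "p \<bullet> u \<le> \<rho> + \<tau> * m"
      using assms that unfolding q velocity_cone_def by blast
    hence "c * (p \<bullet> u) \<le> c * (\<rho> + \<tau> * m)" using assms(2) by (rule mult_left_mono)
    thus ?thesis by (simp add: algebra_simps)
  qed
  thus ?thesis using assms unfolding q velocity_cone_def by auto
qed

lemma velocity_cone_zero: "0 \<in> velocity_cone e x0"
  by (simp add: velocity_cone_def zero_prod_def)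

lemma closed_velocity_cone: "closed (velocity_cone e x0)"
proof -
  have "velocity_cone e x0 = {q. 0 \<le> fst q} \<inter>
    (\<Inter>p. \<Inter>m\<in>{m. \<forall>x\<in>cball x0 e. \<forall>v. p \<bullet> v - L (x, v) \<le> m}. {q. p \<bullet> fst (snd q) \<le> snd (snd q) + fst q * m})"
    unfolding velocity_cone_def by auto
  moreover have "closed {q :: real \<times> 'a \<times> real. 0 \<le> fst q}"
    by (intro closed_Collect_le continuous_intros)
  moreover have "closed {q :: real \<times> 'a \<times> real. p \<bullet> fst (snd q) \<le> snd (snd q) + fst q * m}" for p m
    by (intro closed_Collect_le continuous_intros)
  ultimately show ?thesis by (auto intro!: closed_Int closed_INT)
qed

lemma velocity_cone_generator:
  assumes "x \<in> cball x0 e"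
  shows "(1, u, L (x, u)) \<in> velocity_cone e x0"
proof -
  have "p \<bullet> u \<le> L (x, u) + m" if "\<forall>x\<in>cball x0 e. \<forall>v. p \<bullet> v - L (x, v) \<le> m" for p m
    using that assms by (metis add.commute diff_le_eq)
  thus ?thesis by (simp add: velocity_cone_def)
qed

text \<open>\<open>\<rho> \<ge> 0\<close> is the support inequality for \<open>p = 0\<close> and
  \<open>m = 0\<close>, valid since \<open>L \<ge> 0\<close>.\<close>

lemma velocity_cone_nonneg:
  assumes "(\<tau>, u, \<rho>) \<in> velocity_cone e x0"
  shows "0 \<le> \<tau>" "0 \<le> \<rho>"
proof -
  show "0 \<le> \<tau>" using assms by (simp add: velocity_cone_def)
  have "0 \<bullet> u \<le> \<rho> + \<tau> * 0"
    using assms unfolding velocity_cone_def by (auto simp: L_nonneg dest!: spec[of _ "0::'a"] spec[of _ "0::real"])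
  thus "0 \<le> \<rho>" by simp
qed

text \<open>Testing with the unit vector along \<open>u\<close> gives
  \<open>norm u \<le> \<rho> + \<tau> * M\<close>. So \<open>\<tau> + \<rho>\<close> controls the
  whole triple, uniformly in the ball, which makes the base \<open>\<tau> + \<rho> = 1\<close>
  compact.\<close>

lemma velocity_cone_norm:
  "\<exists>C>0. \<forall>e x0 \<tau> u \<rho>. (\<tau>, u, \<rho>) \<in> velocity_cone e x0 \<longrightarrow> norm (\<tau>, u, \<rho>) \<le> C * (\<tau> + \<rho>)"
proof -
  obtain M where M: "M \<ge> 0" "\<And>x u. norm u \<le> L (x, u) + M"
    using Theta_lower_bound[of 1] by auto
  have "norm (\<tau>, u, \<rho>) \<le> (M + 2) * (\<tau> + \<rho>)" if q: "(\<tau>, u, \<rho>) \<in> velocity_cone e x0" for e x0 \<tau> u \<rho>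
  proof -
    note nn = velocity_cone_nonneg[OF q]
    have "norm u \<le> \<rho> + \<tau> * M"
    proof (cases "u = 0")
      case False
      define p where "p = u /\<^sub>R norm u"
      have "p \<bullet> v - L (x, v) \<le> M" for x v
      proof -
        have "p \<bullet> v \<le> norm p * norm v" by (rule norm_cauchy_schwarz)
        also have "norm p = 1" using False by (simp add: p_def)
        finally show ?thesis using M(2)[of v x] by simp
      qed
      hence "p \<bullet> u \<le> \<rho> + \<tau> * M" using q by (simp add: velocity_cone_def)
      moreover have "p \<bullet> u = norm u" using False
        by (simp add: p_def dot_square_norm power2_eq_square)
      ultimately show ?thesis by simp
    qed (use nn M in simp)
    moreover have "norm (\<tau>, u, \<rho>) \<le> norm \<tau> + (norm u + norm \<rho>)"
      by (rule order_trans[OF norm_Pair_le]) (intro add_left_mono norm_Pair_le)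
    moreover have "0 \<le> \<rho> * M" "0 \<le> \<tau>" using nn M by auto
    ultimately show ?thesis using nn by (simp add: algebra_simps)
  qed
  thus ?thesis using M(1) by (intro exI[of _ "M + 2"]) auto
qed

text \<open>Continuity of \<open>L\<close> settles bounded velocities. For \<open>norm v > R\<close>
  the slope \<open>norm p + 1\<close> makes \<open>p \<bullet> v - L (x, v)\<close> at most
  \<open>M - norm v \<le> m\<close>.\<close>

lemma hamiltonian_usc:
  assumes m: "\<And>v. p \<bullet> v - L (x0, v) \<le> m" and "\<delta> > 0"
  obtains e where "e > 0" "\<And>x v. x \<in> cball x0 e \<Longrightarrow> p \<bullet> v - L (x, v) \<le> m + \<delta>"
proof -
  obtain M where M: "M \<ge> 0" "\<And>x u. (norm p + 1) * norm u \<le> L (x, u) + M"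
    using Theta_lower_bound[of "norm p + 1"] by auto
  define R where "R = norm x0 + 1 + \<bar>M - m\<bar>"
  obtain d where d: "d > 0" "\<And>x x' u u'. norm x \<le> R \<Longrightarrow> norm x' \<le> R \<Longrightarrow> norm u \<le> R \<Longrightarrow> norm u' \<le> R \<Longrightarrow>
    norm (x - x') \<le> d \<Longrightarrow> norm (u - u') \<le> d \<Longrightarrow> \<bar>L (x, u) - L (x', u')\<bar> < \<delta>"
    using L_uniformly_continuous[OF \<open>\<delta> > 0\<close>, of R] by metis
  show ?thesis
  proof
    show "min d 1 > 0" using d by simp
    fix x v assume x: "x \<in> cball x0 (min d 1)"
    show "p \<bullet> v - L (x, v) \<le> m + \<delta>"
    proof (cases "norm v \<le> R")
      case True
      have nx: "norm (x - x0) \<le> d" "norm (x - x0) \<le> 1" using x by (auto simp: dist_norm norm_minus_commute)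
      have "norm x \<le> norm x0 + 1" using norm_triangle_ineq[of x0 "x - x0"] nx by simp
      hence "\<bar>L (x, v) - L (x0, v)\<bar> < \<delta>" using d(2)[of x x0 v v] nx True d(1) by (simp add: R_def)
      thus ?thesis using m[of v] by simp
    next
      case False
      have "p \<bullet> v \<le> norm p * norm v" by (rule norm_cauchy_schwarz)
      moreover have "norm p * norm v + norm v \<le> L (x, v) + M" using M(2)[of v x] by (simp add: algebra_simps)
      moreover have "M - m \<le> norm v"
        using False norm_ge_zero[of x0] unfolding R_def by linarith
      ultimately show ?thesis using \<open>\<delta> > 0\<close> by simp
    qed
  qed
qed

end

section \<open>The equation at subgradients and growth along one segment\<close>

locale hj_solution = tonelli_lagrangian L \<Theta>
  for L :: "'a::euclidean_space \<times> 'a \<Rightarrow> real" and \<Theta> :: "'a \<Rightarrow> real" +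
  fixes \<phi> :: "'a \<Rightarrow> ereal" and W :: "real \<times> 'a \<Rightarrow> ereal"
  assumes W_nonneg: "0 < t \<Longrightarrow> 0 \<le> W (t, x)"
    and W_lsc: "lsc_on ({0<..} \<times> UNIV) W"
    and W_initial: "Liminf (at_right 0 \<times>\<^sub>F nhds x) W = \<phi> x"
    and W_contingent: "(t, x) \<in> dom_on ({0<..} \<times> UNIV) W \<Longrightarrow> contingent_derivative W (t, x) (0, 0) = 0"
    and W_equation: "0 < t \<Longrightarrow> (pt, px) \<in> subdifferential W (t, x) \<Longrightarrow> ereal pt + hamiltonian L x (- px) = 0"
begin

lemma hamiltonian_at_subgradient:
  assumes "0 < t" "(pt, px) \<in> subdifferential W (t, x)"
  shows "hamiltonian L x (- px) = ereal (- pt)"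
  using W_equation[OF assms] by (cases "hamiltonian L x (- px)") auto

lemma subgradient_upper:
  assumes "0 < t" "(pt, px) \<in> subdifferential W (t, x)"
  shows "pt - px \<bullet> u \<le> L (x, u)"
proof -
  have "ereal (- px \<bullet> u - L (x, u)) \<le> hamiltonian L x (- px)"
    unfolding hamiltonian_def by (rule SUP_upper) simp
  thus ?thesis unfolding hamiltonian_at_subgradient[OF assms] by simp
qed

text \<open>The supremum in the Hamiltonian is only approached, hence the slack
  \<open>\<kappa>\<close>.\<close>

lemma subgradient_lower:
  assumes "0 < t" "(pt, px) \<in> subdifferential W (t, x)" "\<kappa> > 0"
  shows "\<exists>u. - \<kappa> < pt - px \<bullet> u - L (x, u)"
proof (rule ccontr)
  assume a: "\<not> ?thesis"
  have "hamiltonian L x (- px) \<le> ereal (- \<kappa> - pt)"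
    unfolding hamiltonian_def
  proof (rule SUP_least)
    fix u
    have "pt - px \<bullet> u - L (x, u) \<le> - \<kappa>" using a by (simp add: not_less)
    thus "ereal (- px \<bullet> u - L (x, u)) \<le> ereal (- \<kappa> - pt)" by simp
  qed
  thus False unfolding hamiltonian_at_subgradient[OF assms(1,2)] using assms(3) by simp
qed

text \<open>A faster growth would, by the mean value argument on the ray through
  \<open>(1, - u)\<close>, yield a nearby subgradient with
  \<open>pt - px \<bullet> u \<ge> c + \<kappa>\<close>, against
  \<open>subgradient_upper\<close>.\<close>

lemma W_along_segment:
  assumes t: "0 < t" and h: "0 \<le> h" and c: "\<And>s. 0 \<le> s \<Longrightarrow> s \<le> h \<Longrightarrow> L (x - s *\<^sub>R u, u) \<le> c"
  shows "W (t + h, x - h *\<^sub>R u) \<le> W (t, x) + ereal (h * c)"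
proof (cases "W (t, x) = \<infinity> \<or> h = 0")
  case True thus ?thesis by auto
next
  case False
  then obtain w where w: "W (t, x) = ereal w" using W_nonneg[OF t, of x] by (cases "W (t, x)") auto
  have h0: "h > 0" using False h by simp
  show ?thesis
  proof (rule ccontr)
    assume "\<not> ?thesis"
    hence "ereal (w + h * c) < W (t + h, x - h *\<^sub>R u)" by (simp add: w)
    then obtain b where b: "w + h * c < b" "ereal b < W (t + h, x - h *\<^sub>R u)"
      using ereal_dense2 by (metis less_ereal.simps(1))
    \<comment> \<open>The excess growth rate: \<open>b\<close> lies strictly between the two sides,
      and \<open>\<kappa>\<close> spreads its gap over the duration \<open>h\<close>.\<close>
    define \<kappa> where "\<kappa> = (b - w - h * c) / h"
    have \<kappa>: "\<kappa> > 0" "w + h * (c + \<kappa>) = b" using b h0 by (auto simp: \<kappa>_def field_simps)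
    have "(t + h, x - h *\<^sub>R u) \<in> {0<..} \<times> UNIV" using t h by simp
    hence "W (t + h, x - h *\<^sub>R u) \<le> Liminf (at (t + h, x - h *\<^sub>R u) within {0<..} \<times> UNIV) W"
      using W_lsc by (auto simp: lsc_on_def)
    hence "eventually (\<lambda>z. ereal b < W z) (at (t + h, x - h *\<^sub>R u) within {0<..} \<times> UNIV)"
      using b(2) by (auto simp: le_Liminf_iff)
    then obtain r1 where r1: "r1 > 0" "\<And>z. z \<in> {0<..} \<times> UNIV \<Longrightarrow> z \<noteq> (t + h, x - h *\<^sub>R u) \<Longrightarrow>
        dist z (t + h, x - h *\<^sub>R u) < r1 \<Longrightarrow> ereal b < W z"
      unfolding eventually_at by blast
    define R where "R = norm x + h * norm u + 1 + norm u"
    obtain r2 where r2: "r2 > 0" "\<And>x x' u u'. norm x \<le> R \<Longrightarrow> norm x' \<le> R \<Longrightarrow> norm u \<le> R \<Longrightarrow> norm u' \<le> R \<Longrightarrow>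
      norm (x - x') \<le> r2 \<Longrightarrow> norm (u - u') \<le> r2 \<Longrightarrow> \<bar>L (x, u) - L (x', u')\<bar> < \<kappa>"
      using L_uniformly_continuous[OF \<kappa>(1), of R] by metis
    \<comment> \<open>\<open>r1\<close> preserves the strict inequality around the end point by
      lower semicontinuity, \<open>r2\<close> keeps the variation of \<open>L\<close> below
      \<open>\<kappa>\<close>, and \<open>t / 2\<close> keeps times positive.\<close>
    define r where "r = min (min (r1 / 2) r2) (min 1 (t / 2))"
    have r: "0 < r" "r < r1" "r \<le> r2" "r \<le> 1" "r < t" using r1(1) r2(1) t by (auto simp: r_def)
    have nfst: "\<bar>fst d\<bar> \<le> norm d" for d :: "real \<times> 'a" using norm_fst_le[of "fst d" "snd d"] by simp
    have "\<exists>q d p. q \<in> {0..} \<and> q < h \<and> norm d < r \<and> p \<in> subdifferential W ((t, x) + q *\<^sub>R (1, - u) + d)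
           \<and> (\<forall>q'\<in>{0..}. 0 \<le> p \<bullet> (q' *\<^sub>R (1, - u)) + (- (c + \<kappa>) * q'))"
    proof (rule multidirectional_mean_value[where S = "{0<..} \<times> UNIV" and ?w0.0 = w and C = 1 and l = "\<lambda>q::real. q"])
      show "lsc_on ({0<..} \<times> UNIV) W" by (rule W_lsc)
      show "0 \<le> W z" if "z \<in> {0<..} \<times> UNIV" for z using that W_nonneg by (cases z) auto
      show "linear (\<lambda>q::real. q)" by (simp add: linear_iff)
      show "linear (\<lambda>q. q *\<^sub>R (1, - u) :: real \<times> 'a)" by (simp add: linear_iff scaleR_left_distrib)
      show "linear (\<lambda>q. - (c + \<kappa>) * q)" by (simp add: linear_iff algebra_simps)
      show "(t, x) + q *\<^sub>R (1, - u) + d \<in> {0<..} \<times> UNIV" if "q \<in> {0..}" "q \<le> h" "norm d \<le> r" for q d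
        using that r nfst[of d] by (cases d) auto
      show "ereal (w - - (c + \<kappa>) * q) < W ((t, x) + q *\<^sub>R (1, - u) + d)"
        if "q \<in> {0..}" "q = h" "norm d \<le> r" for q d
      proof -
        have eq: "(t, x) + q *\<^sub>R (1, - u) + d = (t + h, x - h *\<^sub>R u) + d" using that by simp
        have "ereal b < W ((t + h, x - h *\<^sub>R u) + d)"
        proof (cases "d = 0")
          case False
          have "(t + h, x - h *\<^sub>R u) + d \<in> {0<..} \<times> UNIV" using that r nfst[of d] h by (cases d) auto
          thus ?thesis using r1(2) False that r by (simp add: dist_norm)
        qed (use b in simp)
        thus ?thesis unfolding eq using \<kappa>(2) that by (simp add: algebra_simps)
      qed
    qed (use w h0 r in auto)
    then obtain q d p where q: "0 \<le> q" "q < h" and d: "norm d < r"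
      and p: "p \<in> subdifferential W ((t, x) + q *\<^sub>R (1, - u) + d)"
      and dir: "\<And>q'. 0 \<le> q' \<Longrightarrow> 0 \<le> p \<bullet> (q' *\<^sub>R (1, - u)) + (- (c + \<kappa>) * q')" by auto
    obtain pt px where pp: "p = (pt, px)" by force
    obtain d1 d2 where dd: "d = (d1, d2)" by force
    define x' where "x' = x - q *\<^sub>R u + d2"
    have "\<bar>d1\<bar> < r" "norm d2 < r" using d norm_fst_le[of d1 d2] norm_snd_le[of d2 d1] by (auto simp: dd)
    have z: "(t, x) + q *\<^sub>R (1, - u) + d = (t + q + d1, x')" by (simp add: dd x'_def)
    have "pt - px \<bullet> u \<le> L (x', u)"
      by (rule subgradient_upper[of "t + q + d1"]) (use p z pp q r \<open>\<bar>d1\<bar> < r\<close> in auto)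
    moreover have "c + \<kappa> \<le> pt - px \<bullet> u" using dir[of 1] by (simp add: pp)
    moreover have "L (x', u) < c + \<kappa>"
    proof -
      have a: "norm (x - q *\<^sub>R u) \<le> norm x + h * norm u"
        using norm_triangle_ineq4[of x "q *\<^sub>R u"] q mult_right_mono[of q h "norm u"] by simp
      have b: "norm x' \<le> norm (x - q *\<^sub>R u) + norm d2" unfolding x'_def by (rule norm_triangle_ineq)
      have n0: "0 \<le> h * norm u" "0 \<le> norm x" "0 \<le> norm u" using h by auto
      have "norm (x - q *\<^sub>R u) \<le> R" "norm x' \<le> R" "norm u \<le> R"
        unfolding R_def using a b n0 \<open>norm d2 < r\<close> r(4) by linarith+
      hence "\<bar>L (x', u) - L (x - q *\<^sub>R u, u)\<bar> < \<kappa>"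
        using \<open>norm d2 < r\<close> r r2(1) by (intro r2(2)) (auto simp: x'_def)
      thus ?thesis using c[of q] q by simp
    qed
    ultimately show False by simp
  qed
qed

end

section \<open>Descent from a single point\<close>

context hj_solution
begin

text \<open>If no such step existed, the mean value argument would give a subgradient over some
  \<open>x\<close> in the ball with
  \<open>pt - px \<bullet> v - L (x, v) \<le> - (\<epsilon> / 2)\<close> for every \<open>v\<close>,
  against \<open>subgradient_lower\<close>.\<close>

lemma approximate_step:
  assumes t0: "0 < t0" and W0: "W (t0, x0) = ereal w0" and \<epsilon>: "0 < \<epsilon>"
  shows "\<exists>\<tau> u \<rho> d. (\<tau>, u, \<rho>) \<in> velocity_cone \<epsilon> x0 \<and> 0 < \<tau> + \<rho> \<and> \<tau> + \<rho> < \<epsilon> \<and> norm d \<le> \<epsilon> * (\<tau> + \<rho>) \<and>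
     W ((t0, x0) + (- \<tau>, u) + d) \<le> ereal (w0 - \<rho> + \<epsilon> * (\<tau> + \<rho>))"
proof (rule ccontr)
  assume neg: "\<not> ?thesis"
  obtain C where C: "C > 0" "\<And>e x0 \<tau> u \<rho>. (\<tau>, u, \<rho>) \<in> velocity_cone e x0 \<Longrightarrow> norm (\<tau>, u, \<rho>) \<le> C * (\<tau> + \<rho>)"
    using velocity_cone_norm by blast
  \<comment> \<open>The bounds give, in turn, steps shorter than \<open>\<epsilon>\<close>, positive
    times and, through \<open>C\<close>, a base point \<open>x\<close> still in the ball, so that
    the velocities at \<open>x\<close> generate directions of the cone.\<close>
  define h where "h = min (\<epsilon> / 2) (min (t0 / (2 * (1 + \<epsilon>))) (\<epsilon> / (C + \<epsilon>)))"
  have h: "0 < h" "h < \<epsilon>" using \<epsilon> t0 C(1) by (auto simp: h_def)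
  have h1: "h * (1 + \<epsilon>) < t0"
  proof -
    have "h \<le> t0 / (2 * (1 + \<epsilon>))" by (simp add: h_def)
    hence "h * (2 * (1 + \<epsilon>)) \<le> t0" using \<epsilon> by (simp add: pos_le_divide_eq)
    thus ?thesis using t0 by (simp add: algebra_simps)
  qed
  have h2: "h * (C + \<epsilon>) \<le> \<epsilon>"
  proof -
    have "h \<le> \<epsilon> / (C + \<epsilon>)" by (simp add: h_def)
    thus ?thesis using \<epsilon> C(1) by (simp add: pos_le_divide_eq)
  qed
  \<comment> \<open>The error \<open>\<epsilon> * (\<tau> + \<rho>)\<close> that the claim allows on
    the face \<open>\<tau> + \<rho> = h\<close>.\<close>
  define r where "r = \<epsilon> * h"
  have r: "r > 0" using \<epsilon> h by (simp add: r_def)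
  let ?A = "\<lambda>q::real \<times> 'a \<times> real. (- fst q, fst (snd q))"
  let ?l = "\<lambda>q::real \<times> 'a \<times> real. fst q + snd (snd q)"
  \<comment> \<open>The subtracted term is the margin by which the resulting subgradient violates
    the equation; the factor \<open>\<epsilon> / 2\<close> stays within the error allowed by the
    claim.\<close>
  let ?g = "\<lambda>q::real \<times> 'a \<times> real. snd (snd q) - (\<epsilon> / 2) * (fst q + snd (snd q))"
  have comp: "\<bar>fst d\<bar> \<le> norm d" "norm (snd d) \<le> norm d" for d :: "real \<times> 'a"
    using norm_fst_le[of "fst d" "snd d"] norm_snd_le[of "snd d" "fst d"] by auto
  have "\<exists>q d p. q \<in> velocity_cone \<epsilon> x0 \<and> ?l q < h \<and> norm d < r \<and> p \<in> subdifferential W ((t0, x0) + ?A q + d)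
           \<and> (\<forall>q'\<in>velocity_cone \<epsilon> x0. 0 \<le> p \<bullet> ?A q' + ?g q')"
  proof (rule multidirectional_mean_value[where S = "{0<..} \<times> UNIV" and ?w0.0 = w0 and C = C and l = ?l])
    show "lsc_on ({0<..} \<times> UNIV) W" by (rule W_lsc)
    show "0 \<le> W z" if "z \<in> {0<..} \<times> UNIV" for z using that W_nonneg by (cases z) auto
    show "linear ?A" "linear ?l" "linear ?g"
      by (simp_all add: linear_iff algebra_simps add_divide_distrib)
    show "closed (velocity_cone \<epsilon> x0)" by (rule closed_velocity_cone)
    show "0 \<in> velocity_cone \<epsilon> x0" by (rule velocity_cone_zero)
    show "norm q \<le> C * ?l q" if "q \<in> velocity_cone \<epsilon> x0" for q
      using C(2) that by (cases q) auto
    show "(t0, x0) + ?A q + d \<in> {0<..} \<times> UNIV"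
      if "q \<in> velocity_cone \<epsilon> x0" "?l q \<le> h" "norm d \<le> r" for q d
    proof -
      obtain \<tau> u \<rho> where q: "q = (\<tau>, u, \<rho>)" by (metis prod_cases3)
      have "0 \<le> \<tau>" "0 \<le> \<rho>" using velocity_cone_nonneg that(1) q by auto
      hence "\<tau> \<le> h" using that(2) by (simp add: q)
      moreover have "h + r < t0" using h1 by (simp add: r_def algebra_simps)
      ultimately show ?thesis using that(3) comp(1)[of d] by (cases d) (auto simp: q)
    qed
    show "ereal (w0 - ?g q) < W ((t0, x0) + ?A q + d)"
      if "q \<in> velocity_cone \<epsilon> x0" "?l q = h" "norm d \<le> r" for q d
    proof -
      obtain \<tau> u \<rho> where q: "q = (\<tau>, u, \<rho>)" by (metis prod_cases3)
      have "(\<tau>, u, \<rho>) \<in> velocity_cone \<epsilon> x0" "\<tau> + \<rho> = h" using that by (auto simp: q)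
      hence "\<not> W ((t0, x0) + (- \<tau>, u) + d) \<le> ereal (w0 - \<rho> + \<epsilon> * (\<tau> + \<rho>))"
        using neg h that(3) unfolding r_def by blast
      hence "ereal (w0 - \<rho> + \<epsilon> * h) < W ((t0, x0) + ?A q + d)" using that(2) by (simp add: q)
      moreover have "w0 - ?g q < w0 - \<rho> + \<epsilon> * h"
        using that(2) \<epsilon> h by (simp add: q)
      ultimately show ?thesis by (meson less_ereal.simps(1) less_trans)
    qed
  qed (use W0 C h r velocity_cone_add velocity_cone_scale in auto)
  then obtain q d p where q: "q \<in> velocity_cone \<epsilon> x0" "?l q < h" and d: "norm d < r"
    and p: "p \<in> subdifferential W ((t0, x0) + ?A q + d)"
    and dir: "\<And>q'. q' \<in> velocity_cone \<epsilon> x0 \<Longrightarrow> 0 \<le> p \<bullet> ?A q' + ?g q'" by blast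
  obtain \<tau> u \<rho> where qq: "q = (\<tau>, u, \<rho>)" by (metis prod_cases3)
  obtain pt px where pp: "p = (pt, px)" by force
  have nn: "0 \<le> \<tau>" "0 \<le> \<rho>" using velocity_cone_nonneg q(1) qq by auto
  define t where "t = t0 - \<tau> + fst d"
  define x where "x = x0 + u + snd d"
  have z: "(t0, x0) + ?A q + d = (t, x)" by (simp add: t_def x_def qq prod_eq_iff)
  have "t > 0" using q(2) nn h1 comp(1)[of d] d unfolding t_def r_def qq by (simp add: algebra_simps)
  have "x \<in> cball x0 \<epsilon>"
  proof -
    have "norm u \<le> norm (\<tau>, u, \<rho>)" using norm_fst_le[of u \<rho>] norm_snd_le[of "(u, \<rho>)" \<tau>] by linarith
    also have "\<dots> \<le> C * h" using C(2)[of \<tau> u \<rho> \<epsilon> x0] q qq C(1) by (smt (verit) fst_conv mult_left_mono snd_conv)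
    finally have "norm (x - x0) \<le> C * h + \<epsilon> * h"
      using norm_triangle_ineq[of u "snd d"] comp(2)[of d] d by (simp add: x_def r_def add.assoc)
    thus ?thesis using h2 by (simp add: dist_norm norm_minus_commute algebra_simps)
  qed
  obtain v where v: "- (\<epsilon> / 2) < pt - px \<bullet> v - L (x, v)"
    using subgradient_lower[of t pt px x "\<epsilon> / 2"] p z pp \<epsilon> \<open>t > 0\<close> by auto
  have "0 \<le> p \<bullet> ?A (1, v, L (x, v)) + ?g (1, v, L (x, v))"
    by (rule dir[OF velocity_cone_generator[OF \<open>x \<in> cball x0 \<epsilon>\<close>]])
  moreover have "0 \<le> \<epsilon> * L (x, v)" using \<epsilon> L_nonneg by simp
  ultimately show False using v by (simp add: pp algebra_simps)
qed

text \<open>The lower half of the contingent condition, read along a sequence. It will exclude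
  descent at a positive rate by displacements of order \<open>o(s k)\<close>, the form that steps of
  vanishing duration take.\<close>

lemma contingent_lower:
  assumes t: "0 < t" and Wt: "W (t, x) = ereal w"
    and s: "\<And>k. 0 < s k" "s \<longlonglongrightarrow> 0" and v: "v \<longlonglongrightarrow> (0, 0)" and \<kappa>: "\<kappa> > 0"
  shows "\<exists>k. ereal (w - s k * \<kappa>) < W ((t, x) + s k *\<^sub>R v k)"
proof -
  have "contingent_derivative W (t, x) (0, 0) = 0"
    by (rule W_contingent) (use t Wt in \<open>auto simp: dom_on_def\<close>)
  hence "0 \<le> Liminf (at_right 0 \<times>\<^sub>F nhds (0, 0)) (\<lambda>(h, v). (W ((t, x) + h *\<^sub>R v) - W (t, x)) / ereal h)"
    unfolding contingent_derivative_def by simp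
  hence "eventually (\<lambda>p. ereal (- \<kappa>) < (case p of (h, v) \<Rightarrow> (W ((t, x) + h *\<^sub>R v) - W (t, x)) / ereal h))
     (at_right 0 \<times>\<^sub>F nhds (0, 0))"
    unfolding le_Liminf_iff by (elim allE[of _ "ereal (- \<kappa>)"]) (use \<kappa> in simp)
  moreover have "filterlim (\<lambda>k. (s k, v k)) (at_right 0 \<times>\<^sub>F nhds (0, 0)) sequentially"
  proof (intro filterlim_Pair v)
    have "s k \<noteq> 0" for k using s(1)[of k] by simp
    thus "filterlim s (at_right 0) sequentially" using s by (auto simp: filterlim_at)
  qed
  ultimately have "eventually (\<lambda>k. ereal (- \<kappa>) < (case (s k, v k) of (h, v) \<Rightarrow>
      (W ((t, x) + h *\<^sub>R v) - W (t, x)) / ereal h)) sequentially"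
    by (rule eventually_compose_filterlim)
  then obtain k where k: "ereal (- \<kappa>) < (W ((t, x) + s k *\<^sub>R v k) - W (t, x)) / ereal (s k)"
    by (auto simp: eventually_sequentially)
  have "ereal (w - s k * \<kappa>) < W ((t, x) + s k *\<^sub>R v k)"
  proof (cases "W ((t, x) + s k *\<^sub>R v k)")
    case (real b)
    thus ?thesis using k s(1)[of k] Wt by (simp add: field_simps)
  qed (use k s(1)[of k] Wt in auto)
  thus ?thesis by blast
qed

text \<open>Approximate steps, scaled to \<open>\<tau> + \<rho> = 1\<close>, pass to a limit
  \<open>(\<tau>, u, \<rho>)\<close> that obeys the support inequalities at \<open>x\<close> itself.
  Once \<open>\<tau> > 0\<close> is known, \<open>u /\<^sub>R \<tau>\<close> is the velocity, and
  convexity gives \<open>\<tau> * L (x, u /\<^sub>R \<tau>) \<le> \<rho>\<close>.\<close>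

lemma optimal_velocity:
  assumes t: "0 < t" and Wt: "W (t, x) = ereal w"
  shows "\<exists>u. \<forall>\<delta>>0. \<exists>h v. 0 < h \<and> h < \<delta> \<and> norm (v - u) < \<delta> \<and>
    W (t - h, x + h *\<^sub>R v) \<le> ereal (w - h * (L (x, u) - \<delta>))"
proof -
  define e where "e = (\<lambda>k. inverse (real (Suc k)))"
  have e: "e k > 0" for k by (simp add: e_def)
  have e0: "e \<longlonglongrightarrow> 0" unfolding e_def by (rule LIMSEQ_inverse_real_of_nat)
  have "\<exists>\<tau> u \<rho> d. (\<tau>, u, \<rho>) \<in> velocity_cone (e k) x \<and> 0 < \<tau> + \<rho> \<and> \<tau> + \<rho> < e k \<and> norm d \<le> e k * (\<tau> + \<rho>) \<and>
     W ((t, x) + (- \<tau>, u) + d) \<le> ereal (w - \<rho> + e k * (\<tau> + \<rho>))" for k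
    by (rule approximate_step[OF t Wt e])
  then obtain \<tau>0 u0 \<rho>0 d0 where A: "\<And>k. (\<tau>0 k, u0 k, \<rho>0 k) \<in> velocity_cone (e k) x"
      "\<And>k. 0 < \<tau>0 k + \<rho>0 k" "\<And>k. \<tau>0 k + \<rho>0 k < e k" "\<And>k. norm (d0 k) \<le> e k * (\<tau>0 k + \<rho>0 k)"
      "\<And>k. W ((t, x) + (- \<tau>0 k, u0 k) + d0 k) \<le> ereal (w - \<rho>0 k + e k * (\<tau>0 k + \<rho>0 k))"
    by metis
  define s where "s = (\<lambda>k. \<tau>0 k + \<rho>0 k)"
  define q where "q = (\<lambda>k. inverse (s k) *\<^sub>R (\<tau>0 k, u0 k, \<rho>0 k))"
  define d where "d = (\<lambda>k. inverse (s k) *\<^sub>R d0 k)"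
  have s: "s k > 0" "s k < e k" for k using A(2,3) by (auto simp: s_def)
  have s0: "s \<longlonglongrightarrow> 0"
    by (rule tendsto_sandwich[OF _ _ tendsto_const e0]) (use s in \<open>auto intro!: always_eventually less_imp_le\<close>)
  obtain C where C: "C > 0" "\<And>e x0 \<tau> u \<rho>. (\<tau>, u, \<rho>) \<in> velocity_cone e x0 \<Longrightarrow> norm (\<tau>, u, \<rho>) \<le> C * (\<tau> + \<rho>)"
    using velocity_cone_norm by blast
  have qcone: "q k \<in> velocity_cone (e k) x" for k
    unfolding q_def by (rule velocity_cone_scale[OF A(1)]) (use s[of k] in simp)
  have q1: "fst (q k) + snd (snd (q k)) = 1" for k
  proof -
    have "fst (q k) + snd (snd (q k)) = inverse (s k) * (\<tau>0 k + \<rho>0 k)" by (simp add: q_def distrib_left)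
    thus ?thesis using s(1)[of k] by (simp add: s_def)
  qed
  have "norm (q k) \<le> C" for k
    using C(2)[of "fst (q k)" "fst (snd (q k))" "snd (snd (q k))"] qcone[of k] q1[of k] by simp
  hence "bounded (range q)" by (auto intro: boundedI)
  then obtain ql \<sigma> where \<sigma>: "strict_mono \<sigma>" "(q \<circ> \<sigma>) \<longlonglongrightarrow> ql"
    using bounded_imp_convergent_subsequence by blast
  obtain \<tau> u \<rho> where ql: "ql = (\<tau>, u, \<rho>)" by (metis prod_cases3)
  define T where "T = (\<lambda>k. fst (q (\<sigma> k)))"
  define U where "U = (\<lambda>k. fst (snd (q (\<sigma> k))))"
  define R where "R = (\<lambda>k. snd (snd (q (\<sigma> k))))"
  define E where "E = (\<lambda>k. e (\<sigma> k))"
  define S where "S = (\<lambda>k. s (\<sigma> k))"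
  define D where "D = (\<lambda>k. d (\<sigma> k))"
  have T: "T \<longlonglongrightarrow> \<tau>" using tendsto_fst[OF \<sigma>(2)] by (simp add: T_def ql o_def)
  have U: "U \<longlonglongrightarrow> u" using tendsto_fst[OF tendsto_snd[OF \<sigma>(2)]] by (simp add: U_def ql o_def)
  have R: "R \<longlonglongrightarrow> \<rho>" using tendsto_snd[OF tendsto_snd[OF \<sigma>(2)]] by (simp add: R_def ql o_def)
  have E: "E \<longlonglongrightarrow> 0" using LIMSEQ_subseq_LIMSEQ[OF e0 \<sigma>(1)] by (simp add: E_def o_def)
  have S: "S \<longlonglongrightarrow> 0" using LIMSEQ_subseq_LIMSEQ[OF s0 \<sigma>(1)] by (simp add: S_def o_def)
  have Spos: "S k > 0" for k using s by (simp add: S_def)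
  have D: "D \<longlonglongrightarrow> 0"
  proof (rule Lim_null_comparison[OF _ E])
    have "norm (D k) \<le> E k" for k
      using A(4)[of "\<sigma> k"] s(1)[of "\<sigma> k"] by (simp add: D_def E_def d_def s_def field_simps)
    thus "eventually (\<lambda>k. norm (D k) \<le> E k) sequentially" by simp
  qed
  have cone: "(T k, U k, R k) \<in> velocity_cone (E k) x" for k
    using qcone[of "\<sigma> k"] by (simp add: T_def U_def R_def E_def)
  have TR: "T k + R k = 1" for k using q1 by (simp add: T_def R_def)
  have WS: "W ((t, x) + S k *\<^sub>R ((- T k, U k) + D k)) \<le> ereal (w - S k * (R k - E k))" for k
  proof -
    have eq: "S k *\<^sub>R ((- T k, U k) + D k) = (- \<tau>0 (\<sigma> k), u0 (\<sigma> k)) + d0 (\<sigma> k)"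
      using s(1)[of "\<sigma> k"] by (simp add: S_def T_def U_def D_def q_def d_def scaleR_add_right)
    have "(t, x) + S k *\<^sub>R ((- T k, U k) + D k) = (t, x) + (- \<tau>0 (\<sigma> k), u0 (\<sigma> k)) + d0 (\<sigma> k)"
      unfolding eq by (simp only: add.assoc)
    moreover have "w - S k * (R k - E k) = w - \<rho>0 (\<sigma> k) + e (\<sigma> k) * (\<tau>0 (\<sigma> k) + \<rho>0 (\<sigma> k))"
      using s(1)[of "\<sigma> k"] by (simp add: S_def R_def E_def q_def s_def[symmetric] algebra_simps) (simp add: s_def algebra_simps)
    ultimately show ?thesis using A(5)[of "\<sigma> k"] by (simp only:)
  qed
  have \<tau>\<rho>: "\<tau> + \<rho> = 1"
  proof -
    have "(\<lambda>k. T k + R k) \<longlonglongrightarrow> \<tau> + \<rho>" by (intro tendsto_intros T R)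
    thus ?thesis using TR by (simp add: LIMSEQ_const_iff)
  qed
  have \<tau>0: "0 \<le> \<tau>"
    by (rule tendsto_lowerbound[OF T]) (use velocity_cone_nonneg[OF cone] in auto)
  have \<rho>0: "0 \<le> \<rho>"
    by (rule tendsto_lowerbound[OF R]) (use velocity_cone_nonneg[OF cone] in auto)
  \<comment> \<open>The balls shrink to \<open>x\<close>, and \<open>hamiltonian_usc\<close> turns a
    bound \<open>m\<close> at \<open>x\<close> into the bound \<open>m + \<delta>\<close> on
    them.\<close>
  have limcone: "p \<bullet> u \<le> \<rho> + \<tau> * m" if m: "\<And>v. p \<bullet> v - L (x, v) \<le> m" for p m
  proof -
    have le: "p \<bullet> u \<le> \<rho> + \<tau> * (m + \<delta>)" if \<delta>: "\<delta> > 0" for \<delta>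
    proof -
      obtain e' where e': "e' > 0" "\<And>x' v. x' \<in> cball x e' \<Longrightarrow> p \<bullet> v - L (x', v) \<le> m + \<delta>"
        using hamiltonian_usc[OF m \<delta>] by metis
      have "eventually (\<lambda>k. E k < e') sequentially" using E e'(1) by (rule order_tendstoD)
      hence ev: "eventually (\<lambda>k. p \<bullet> U k \<le> R k + T k * (m + \<delta>)) sequentially"
      proof eventually_elim
        case (elim k)
        have "\<forall>x'\<in>cball x (E k). \<forall>v. p \<bullet> v - L (x', v) \<le> m + \<delta>" using e'(2) elim by auto
        thus ?case using cone[of k] by (simp add: velocity_cone_def)
      qed
      show ?thesis
        by (rule tendsto_le[OF _ _ _ ev]) (intro trivial_limit_sequentially tendsto_intros U R T)+
    qed
    show ?thesis
    proof (rule field_le_epsilon)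
      fix a :: real assume a: "a > 0"
      have "p \<bullet> u \<le> \<rho> + \<tau> * (m + a)" by (rule le[OF a])
      also have "\<dots> \<le> \<rho> + \<tau> * m + a" using a \<tau>0 \<tau>\<rho> \<rho>0 mult_right_mono[of \<tau> 1 a] by (simp add: algebra_simps)
      finally show "p \<bullet> u \<le> \<rho> + \<tau> * m + a" .
    qed
  qed
  \<comment> \<open>For \<open>\<tau> = 0\<close> the limit has \<open>\<rho> = 1\<close> and is
    forced to have \<open>u = 0\<close>: then \<open>W\<close> would drop at a rate above 1/2 per
    unit of \<open>S k\<close>, along displacements of order \<open>o(S k)\<close>, which
    \<open>contingent_lower\<close> excludes.\<close>
  have \<tau>pos: "\<tau> > 0"
  proof (rule ccontr)
    assume "\<not> \<tau> > 0"
    hence \<tau>z: "\<tau> = 0" "\<rho> = 1" using \<tau>0 \<tau>\<rho> by auto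
    have "u = 0"
    proof (rule ccontr)
      assume "u \<noteq> 0"
      \<comment> \<open>Scaled so that \<open>p \<bullet> u = 2\<close>, while
        \<open>\<tau> = 0\<close> and \<open>\<rho> = 1\<close> allow at most 1; superlinearity
        supplies a finite \<open>m\<close> for this \<open>p\<close>.\<close>
      define p where "p = (2 / (norm u)\<^sup>2) *\<^sub>R u"
      obtain M where M: "\<And>x v. norm p * norm v \<le> L (x, v) + M"
        using Theta_lower_bound[of "norm p"] by blast
      have "p \<bullet> v - L (x, v) \<le> M" for v
        using norm_cauchy_schwarz[of p v] M[of v x] by simp
      from limcone[OF this] have "p \<bullet> u \<le> 1" by (simp add: \<tau>z)
      moreover have "p \<bullet> u = 2" using \<open>u \<noteq> 0\<close> by (simp add: p_def power2_norm_eq_inner)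
      ultimately show False by simp
    qed
    define V where "V = (\<lambda>k. (- T k, U k) + D k)"
    have "V \<longlonglongrightarrow> (- \<tau>, u) + 0" unfolding V_def by (intro tendsto_intros T U D)
    hence V0: "V \<longlonglongrightarrow> (0, 0)" by (simp add: \<tau>z \<open>u = 0\<close>)
    have "eventually (\<lambda>k. 1 / 2 < R k - E k) sequentially"
      by (rule order_tendstoD(1)[OF tendsto_diff[OF R E]]) (use \<tau>z in simp)
    then obtain N where N: "\<And>k. k \<ge> N \<Longrightarrow> 1 / 2 < R k - E k" by (auto simp: eventually_sequentially)
    have "\<exists>k. ereal (w - S (k + N) * (1 / 2)) < W ((t, x) + S (k + N) *\<^sub>R V (k + N))"
      by (rule contingent_lower[OF t Wt]) (use Spos S V0 LIMSEQ_ignore_initial_segment in auto)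
    then obtain k where k: "ereal (w - S (k + N) * (1 / 2)) < W ((t, x) + S (k + N) *\<^sub>R V (k + N))" by blast
    also have "\<dots> \<le> ereal (w - S (k + N) * (R (k + N) - E (k + N)))" using WS[of "k + N"] by (simp add: V_def)
    finally have "S (k + N) * (R (k + N) - E (k + N)) < S (k + N) * (1 / 2)" by simp
    thus False using N[of "k + N"] Spos[of "k + N"] by simp
  qed
  define us where "us = u /\<^sub>R \<tau>"
  have Lus: "L (x, us) \<le> \<rho> / \<tau>"
  proof -
    \<comment> \<open>For a subgradient \<open>p\<close> at \<open>us\<close>, the bound
      \<open>m = p \<bullet> us - L (x, us)\<close> is sharp, and the support inequality becomes
      \<open>\<tau> * L (x, us) \<le> \<rho>\<close>.\<close>
    obtain p where p: "\<And>v. L (x, us) + p \<bullet> (v - us) \<le> L (x, v)"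
      using convex_on_subgradient[OF L_convex] by blast
    have "p \<bullet> v - L (x, v) \<le> p \<bullet> us - L (x, us)" for v using p[of v] by (simp add: inner_diff_right)
    from limcone[OF this] have "p \<bullet> u \<le> \<rho> + \<tau> * (p \<bullet> us - L (x, us))" .
    moreover have "\<tau> * (p \<bullet> us) = p \<bullet> u" using \<tau>pos by (simp add: us_def)
    ultimately have "\<tau> * L (x, us) \<le> \<rho>" by (simp add: algebra_simps)
    thus ?thesis using \<tau>pos by (simp add: field_simps)
  qed
  \<comment> \<open>The error \<open>D\<close> is absorbed: \<open>S k * Y k\<close> is the exact
    duration of the step and \<open>Z k\<close> its exact velocity.\<close>
  define Y where "Y = (\<lambda>k. T k - fst (D k))"
  define Z where "Z = (\<lambda>k. (U k + snd (D k)) /\<^sub>R Y k)"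
  have Y: "Y \<longlonglongrightarrow> \<tau>" using tendsto_diff[OF T tendsto_fst[OF D]] by (simp add: Y_def)
  have Z: "Z \<longlonglongrightarrow> us"
  proof -
    have "(\<lambda>k. inverse (Y k) *\<^sub>R (U k + snd (D k))) \<longlonglongrightarrow> inverse \<tau> *\<^sub>R (u + snd (0::real \<times> 'a))"
      by (intro tendsto_intros Y U D) (use \<tau>pos in simp)
    thus ?thesis by (simp add: Z_def us_def)
  qed
  have SY: "(\<lambda>k. S k * Y k) \<longlonglongrightarrow> 0" using tendsto_mult[OF S Y] by simp
  have RY: "(\<lambda>k. (R k - E k) / Y k) \<longlonglongrightarrow> \<rho> / \<tau>"
    using tendsto_divide[OF tendsto_diff[OF R E] Y] \<tau>pos by simp
  have "\<exists>h v. 0 < h \<and> h < \<delta> \<and> norm (v - us) < \<delta> \<and> W (t - h, x + h *\<^sub>R v) \<le> ereal (w - h * (L (x, us) - \<delta>))"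
    if \<delta>: "\<delta> > 0" for \<delta>
  proof -
    have "eventually (\<lambda>k. 0 < Y k) sequentially" using Y \<tau>pos by (rule order_tendstoD)
    moreover have "eventually (\<lambda>k. S k * Y k < \<delta>) sequentially" using SY \<delta> by (rule order_tendstoD)
    moreover have "eventually (\<lambda>k. norm (Z k - us) < \<delta>) sequentially"
      using tendstoD[OF Z \<delta>] by (simp add: dist_norm)
    moreover have "eventually (\<lambda>k. L (x, us) - \<delta> < (R k - E k) / Y k) sequentially"
      by (rule order_tendstoD(1)[OF RY]) (use Lus \<delta> in simp)
    ultimately have "eventually (\<lambda>k. 0 < Y k \<and> S k * Y k < \<delta> \<and> norm (Z k - us) < \<delta> \<and>
        L (x, us) - \<delta> < (R k - E k) / Y k) sequentially" by eventually_elim blast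
    then obtain k where k: "0 < Y k" "S k * Y k < \<delta>" "norm (Z k - us) < \<delta>" "L (x, us) - \<delta> < (R k - E k) / Y k"
      by (auto simp: eventually_sequentially)
    have eq: "(t, x) + S k *\<^sub>R ((- T k, U k) + D k) = (t - S k * Y k, x + (S k * Y k) *\<^sub>R Z k)"
    proof -
      have "(S k * Y k) *\<^sub>R Z k = S k *\<^sub>R (U k + snd (D k))" using k(1) by (simp add: Z_def)
      thus ?thesis by (simp add: prod_eq_iff Y_def algebra_simps)
    qed
    have "(L (x, us) - \<delta>) * Y k \<le> R k - E k" using k(1,4) by (simp add: field_simps)
    hence "S k * ((L (x, us) - \<delta>) * Y k) \<le> S k * (R k - E k)" using Spos[of k] by simp
    hence "ereal (w - S k * (R k - E k)) \<le> ereal (w - (S k * Y k) * (L (x, us) - \<delta>))"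
      by (simp add: algebra_simps)
    hence "W (t - S k * Y k, x + (S k * Y k) *\<^sub>R Z k) \<le> ereal (w - (S k * Y k) * (L (x, us) - \<delta>))"
      using WS[of k] unfolding eq by (rule order_trans[rotated])
    thus ?thesis using k Spos[of k] by (intro exI[of _ "S k * Y k"] exI[of _ "Z k"]) auto
  qed
  thus ?thesis by blast
qed

end

section \<open>Greedy concatenation of steps\<close>

context hj_solution
begin

text \<open>\<open>r\<close> is the remaining budget, an upper bound for \<open>W (t, x)\<close>
  carried along instead of the value itself; \<open>c\<close> bounds the running cost on the whole
  segment, and \<open>\<epsilon> * h\<close> is the tolerated loss.\<close>

definition admissible_step :: "real \<Rightarrow> real \<Rightarrow> 'a \<Rightarrow> real \<Rightarrow> real \<Rightarrow> 'a \<Rightarrow> real \<Rightarrow> bool" where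
  "admissible_step \<epsilon> t x r h v c \<longleftrightarrow> 0 < h \<and> h < t \<and> W (t - h, x + h *\<^sub>R v) \<le> ereal (r - h * c + \<epsilon> * h)
     \<and> (\<forall>s\<in>{0..h}. L (x + s *\<^sub>R v, v) \<le> c)"

text \<open>
  A step available at the limit remains available nearby: aim at the same end point, which changes
  the duration and the velocity only slightly, so that lower semicontinuity is not needed there.
\<close>

lemma steps_near_limit:
  assumes t: "0 < t" and lim: "tk \<longlonglongrightarrow> t" "xk \<longlonglongrightarrow> x" "rk \<longlonglongrightarrow> r"
    and W: "W (t, x) \<le> ereal r" and \<epsilon>: "0 < \<epsilon>"
  shows "\<exists>h0>0. eventually (\<lambda>k. \<exists>h v c. h0 \<le> h \<and> admissible_step \<epsilon> (tk k) (xk k) (rk k) h v c) sequentially"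
proof -
  obtain w where w: "W (t, x) = ereal w" using W W_nonneg[OF t, of x] by (cases "W (t, x)") auto
  hence wr: "w \<le> r" using W by simp
  obtain u where u: "\<And>\<delta>. \<delta> > 0 \<Longrightarrow> \<exists>h v. 0 < h \<and> h < \<delta> \<and> norm (v - u) < \<delta> \<and>
    W (t - h, x + h *\<^sub>R v) \<le> ereal (w - h * (L (x, u) - \<delta>))"
    using optimal_velocity[OF t w] by blast
  \<comment> \<open>One quarter of \<open>\<epsilon>\<close> covers the oscillation of
    \<open>L\<close>, another the error \<open>\<delta>\<close> of the descent; the remaining half
    absorbs the convergence of the sequences.\<close>
  define c where "c = L (x, u) + \<epsilon> / 4"
  define R where "R = norm x + norm u + 1"
  obtain d where d: "d > 0" "\<And>x x' u u'. norm x \<le> R \<Longrightarrow> norm x' \<le> R \<Longrightarrow> norm u \<le> R \<Longrightarrow> norm u' \<le> R \<Longrightarrow>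
    norm (x - x') \<le> d \<Longrightarrow> norm (u - u') \<le> d \<Longrightarrow> \<bar>L (x, u) - L (x', u')\<bar> < \<epsilon> / 4"
    using L_uniformly_continuous[of "\<epsilon> / 4" R] \<epsilon> by (metis zero_less_divide_iff zero_less_numeral)
  define a where "a = min d 1"
  have a: "a > 0" "a \<le> 1" "a \<le> d" using d(1) by (auto simp: a_def)
  have Lc: "L (x', u') \<le> c" if "norm (x' - x) \<le> a" "norm (u' - u) \<le> a" for x' u'
  proof -
    have "norm x' \<le> norm x + 1" "norm u' \<le> norm u + 1"
      using norm_triangle_ineq[of x "x' - x"] norm_triangle_ineq[of u "u' - u"] that a by auto
    hence "norm x' \<le> R" "norm u' \<le> R" "norm x \<le> R" "norm u \<le> R"
      unfolding R_def using norm_ge_zero[of x] norm_ge_zero[of u] by linarith+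
    hence "\<bar>L (x', u') - L (x, u)\<bar> < \<epsilon> / 4" using that a by (intro d(2)) auto
    thus ?thesis unfolding c_def by linarith
  qed
  \<comment> \<open>The last bound keeps the end point \<open>y\<close> within \<open>a\<close> of
    \<open>x\<close>.\<close>
  define \<delta> where "\<delta> = min (min (\<epsilon> / 4) (a / 2)) (min t (a / (2 * (norm u + 1))))"
  have nu: "norm u + 1 > 0" using norm_ge_zero[of u] by linarith
  have \<delta>: "\<delta> > 0" "\<delta> \<le> \<epsilon> / 4" "\<delta> \<le> a / 2" "\<delta> \<le> t"
  proof -
    show "\<delta> > 0" using \<epsilon> a t nu by (simp add: \<delta>_def)
    have "\<delta> \<le> min (\<epsilon> / 4) (a / 2)" "\<delta> \<le> min t (a / (2 * (norm u + 1)))"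
      unfolding \<delta>_def by (rule min.cobounded1, rule min.cobounded2)
    thus "\<delta> \<le> \<epsilon> / 4" "\<delta> \<le> a / 2" "\<delta> \<le> t" by (simp_all only: min.bounded_iff)
  qed
  have \<delta>u: "\<delta> * (norm u + 1) \<le> a / 2"
  proof -
    have "\<delta> \<le> a / (2 * (norm u + 1))" by (simp add: \<delta>_def)
    thus ?thesis using nu by (simp add: field_simps)
  qed
  obtain h v where hv: "0 < h" "h < \<delta>" "norm (v - u) < \<delta>"
    "W (t - h, x + h *\<^sub>R v) \<le> ereal (w - h * (L (x, u) - \<delta>))" using u[OF \<delta>(1)] by blast
  define y where "y = x + h *\<^sub>R v"
  have ya: "norm (y - x) < a"
  proof -
    have "norm v \<le> norm u + 1" using norm_triangle_ineq[of u "v - u"] hv(3) \<delta> a by simp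
    hence "norm (y - x) \<le> \<delta> * (norm u + 1)" using hv by (auto simp: y_def intro!: mult_mono)
    thus ?thesis using \<delta>u a by simp
  qed
  have Wy: "W (t - h, y) \<le> ereal (r - h * c + h * (\<epsilon> / 2))"
  proof -
    have "h * \<delta> \<le> h * (\<epsilon> / 4)" using hv \<delta> by simp
    hence "w - h * (L (x, u) - \<delta>) \<le> r - h * c + h * (\<epsilon> / 2)" using wr by (simp add: c_def algebra_simps)
    thus ?thesis using hv(4) unfolding y_def by (meson ereal_less_eq(3) order_trans)
  qed
  define hk where "hk = (\<lambda>k. tk k - t + h)"
  define vk where "vk = (\<lambda>k. (y - xk k) /\<^sub>R hk k)"
  have hk: "hk \<longlonglongrightarrow> h"
  proof -
    have "hk \<longlonglongrightarrow> t - t + h" unfolding hk_def by (intro tendsto_intros lim)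
    thus ?thesis by simp
  qed
  have vk: "vk \<longlonglongrightarrow> v"
  proof -
    have "(\<lambda>k. inverse (hk k) *\<^sub>R (y - xk k)) \<longlonglongrightarrow> inverse h *\<^sub>R (y - x)"
      by (intro tendsto_intros hk lim) (use hv in simp)
    thus ?thesis using hv by (simp add: vk_def y_def)
  qed
  have "eventually (\<lambda>k. h / 2 < hk k) sequentially" by (rule order_tendstoD(1)[OF hk]) (use hv in simp)
  moreover have "eventually (\<lambda>k. norm (vk k - v) < a / 2) sequentially"
    using tendstoD[OF vk, of "a / 2"] a by (simp add: dist_norm)
  moreover have "eventually (\<lambda>k. norm (xk k - x) < a) sequentially"
    using tendstoD[OF lim(2), of a] a by (simp add: dist_norm)
  moreover have "eventually (\<lambda>k. r - h * c + h * (\<epsilon> / 2) < rk k - hk k * c + \<epsilon> * hk k) sequentially"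
  proof (rule order_tendstoD(1))
    show "(\<lambda>k. rk k - hk k * c + \<epsilon> * hk k) \<longlonglongrightarrow> r - h * c + \<epsilon> * h" by (intro tendsto_intros hk lim)
    show "r - h * c + h * (\<epsilon> / 2) < r - h * c + \<epsilon> * h" using hv \<epsilon> by simp
  qed
  ultimately have "eventually (\<lambda>k. admissible_step \<epsilon> (tk k) (xk k) (rk k) (hk k) (vk k) c \<and> h / 2 \<le> hk k) sequentially"
  proof eventually_elim
    case (elim k)
    have hp: "hk k > 0" using elim(1) hv by simp
    have th: "tk k - hk k = t - h" by (simp add: hk_def)
    have xy: "xk k + hk k *\<^sub>R vk k = y" using hp by (simp add: vk_def)
    have "L (xk k + s *\<^sub>R vk k, vk k) \<le> c" if s: "s \<in> {0..hk k}" for s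
    proof (rule Lc)
      define b where "b = s / hk k"
      have b: "0 \<le> b" "b \<le> 1" using s hp by (auto simp: b_def)
      \<comment> \<open>The segment joins \<open>xk k\<close> to \<open>y\<close>; both lie within
        \<open>a\<close> of \<open>x\<close>, hence so does every point between them.\<close>
      have "xk k + s *\<^sub>R vk k - x = (1 - b) *\<^sub>R (xk k - x) + b *\<^sub>R (y - x)"
        using hp by (simp add: b_def vk_def algebra_simps divide_inverse)
      also have "norm \<dots> \<le> (1 - b) * norm (xk k - x) + b * norm (y - x)"
        using norm_triangle_ineq[of "(1 - b) *\<^sub>R (xk k - x)" "b *\<^sub>R (y - x)"] b by simp
      also have "\<dots> \<le> (1 - b) * a + b * a"
        using elim(3) ya b by (intro add_mono mult_left_mono) auto
      finally show "norm (xk k + s *\<^sub>R vk k - x) \<le> a" by (simp add: algebra_simps)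
      have "norm (vk k - u) \<le> norm (vk k - v) + norm (v - u)"
        using norm_triangle_ineq[of "vk k - v" "v - u"] by simp
      thus "norm (vk k - u) \<le> a" using elim(2) hv(3) \<delta> by simp
    qed
    moreover have "W (tk k - hk k, xk k + hk k *\<^sub>R vk k) \<le> ereal (rk k - hk k * c + \<epsilon> * hk k)"
      unfolding th xy using Wy elim(4) by (meson ereal_less_eq(3) less_imp_le order_trans)
    moreover have "hk k < tk k" using th hv \<delta> by simp
    ultimately show ?case using hp elim(1) by (auto simp: admissible_step_def)
  qed
  hence "eventually (\<lambda>k. \<exists>h' v c. h / 2 \<le> h' \<and> admissible_step \<epsilon> (tk k) (xk k) (rk k) h' v c) sequentially"
    by eventually_elim blast
  thus ?thesis using hv(1) by (intro exI[of _ "h / 2"]) auto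
qed

text \<open>
  Taking steps longer than half of the admissible ones prevents the steps from accumulating at a
  positive time.
\<close>

lemma greedy_step:
  assumes "0 < t" "W (t, x) \<le> ereal r" "0 < \<epsilon>"
  shows "\<exists>h v c. admissible_step \<epsilon> t x r h v c \<and> (\<forall>h' v' c'. admissible_step \<epsilon> t x r h' v' c' \<longrightarrow> h' < 2 * h)"
proof -
  define H where "H = {h. \<exists>v c. admissible_step \<epsilon> t x r h v c}"
  \<comment> \<open>Constant sequences turn \<open>steps_near_limit\<close> into the existence of
    one admissible step.\<close>
  have "\<exists>h0>0. eventually (\<lambda>k::nat. \<exists>h v c. h0 \<le> h \<and> admissible_step \<epsilon> t x r h v c) sequentially"
    by (rule steps_near_limit[OF assms(1) tendsto_const tendsto_const tendsto_const assms(2,3)])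
  hence ne: "H \<noteq> {}" unfolding H_def by (auto simp: eventually_sequentially)
  have Ht: "0 < h \<and> h < t" if "h \<in> H" for h using that by (auto simp: H_def admissible_step_def)
  have bdd: "bdd_above H" using Ht by (intro bdd_aboveI[of _ t]) (auto intro: less_imp_le)
  have "Sup H > 0" using ne Ht cSup_upper[OF _ bdd] by (meson all_not_in_conv less_le_trans)
  hence "Sup H / 2 < Sup H" by simp
  then obtain h where h: "h \<in> H" "Sup H / 2 < h" using less_cSup_iff[OF ne bdd] by blast
  have "h' < 2 * h" if "h' \<in> H" for h' using cSup_upper[OF that bdd] h(2) by simp
  thus ?thesis using h(1) unfolding H_def by blast
qed

text \<open>The times decrease and stay positive, and the nonnegative budget bounds the total cost;
  so durations, costs and, by the linear bound \<open>M\<close>, displacements are summable and the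
  vertices converge. At a positive limit time \<open>steps_near_limit\<close> would offer steps of a
  fixed size \<open>h0\<close>, although the chosen ones tend to 0.\<close>

lemma greedy_polygon:
  assumes t0: "0 < t0" and W0: "W (t0, x0) = ereal w0" and \<epsilon>: "0 < \<epsilon>"
    and M: "\<And>x u. norm u \<le> L (x, u) + M"
  obtains t :: "nat \<Rightarrow> real" and x :: "nat \<Rightarrow> 'a" and h v c xs where
    "t 0 = t0" "x 0 = x0" "\<And>k. 0 < h k" "\<And>k. t (Suc k) = t k - h k" "\<And>k. 0 < t k" "t \<longlonglongrightarrow> 0"
    "\<And>k. x (Suc k) = x k + h k *\<^sub>R v k" "\<And>k s. 0 \<le> s \<Longrightarrow> s \<le> h k \<Longrightarrow> L (x k + s *\<^sub>R v k, v k) \<le> c k"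
    "x \<longlonglongrightarrow> xs" "summable (\<lambda>k. h k * c k)" "\<phi> xs + ereal (\<Sum>k. h k * c k) \<le> ereal (w0 + \<epsilon> * t0)"
proof -
  define good where "good = (\<lambda>(t, x, r). 0 < t \<and> W (t, x) \<le> ereal r)"
  define next_state where "next_state = (\<lambda>(t, x, r) z'. \<exists>h v c. admissible_step \<epsilon> t x r h v c \<and>
     (\<forall>h' v' c'. admissible_step \<epsilon> t x r h' v' c' \<longrightarrow> h' < 2 * h) \<and> z' = (t - h, x + h *\<^sub>R v, r - h * c + \<epsilon> * h))"
  have "\<exists>f. \<forall>n. (good (f n) \<and> (n = 0 \<longrightarrow> f n = (t0, x0, w0))) \<and> next_state (f n) (f (Suc n))"
  proof (rule dependent_nat_choice)
    show "\<exists>z. good z \<and> (0 = (0::nat) \<longrightarrow> z = (t0, x0, w0))"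
      using t0 W0 by (intro exI[of _ "(t0, x0, w0)"]) (auto simp: good_def)
  next
    fix z :: "real \<times> 'a \<times> real" and n :: nat assume "good z \<and> (n = 0 \<longrightarrow> z = (t0, x0, w0))"
    moreover obtain t x r where z: "z = (t, x, r)" by (metis prod_cases3)
    ultimately have g: "0 < t" "W (t, x) \<le> ereal r" by (auto simp: good_def)
    obtain h v c where "admissible_step \<epsilon> t x r h v c" "\<forall>h' v' c'. admissible_step \<epsilon> t x r h' v' c' \<longrightarrow> h' < 2 * h"
      using greedy_step[OF g \<epsilon>] by blast
    moreover from this(1) have "good (t - h, x + h *\<^sub>R v, r - h * c + \<epsilon> * h)"
      by (simp add: admissible_step_def good_def)
    ultimately show "\<exists>z'. (good z' \<and> (Suc n = 0 \<longrightarrow> z' = (t0, x0, w0))) \<and> next_state z z'"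
      unfolding z next_state_def prod.case by blast
  qed
  then obtain f where f: "\<And>n. good (f n)" "f 0 = (t0, x0, w0)" "\<And>n. next_state (f n) (f (Suc n))" by blast
  define t where "t = (\<lambda>n. fst (f n))"
  define x where "x = (\<lambda>n. fst (snd (f n)))"
  define r where "r = (\<lambda>n. snd (snd (f n)))"
  have fe: "f n = (t n, x n, r n)" for n by (simp add: t_def x_def r_def)
  have "\<exists>h v c. admissible_step \<epsilon> (t n) (x n) (r n) h v c \<and>
     (\<forall>h' v' c'. admissible_step \<epsilon> (t n) (x n) (r n) h' v' c' \<longrightarrow> h' < 2 * h) \<and>
     t (Suc n) = t n - h \<and> x (Suc n) = x n + h *\<^sub>R v \<and> r (Suc n) = r n - h * c + \<epsilon> * h" for n
    using f(3)[of n] unfolding fe next_state_def by auto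
  then obtain h v c where st: "\<And>n. admissible_step \<epsilon> (t n) (x n) (r n) (h n) (v n) (c n)"
    "\<And>n h' v' c'. admissible_step \<epsilon> (t n) (x n) (r n) h' v' c' \<Longrightarrow> h' < 2 * h n"
    "\<And>n. t (Suc n) = t n - h n" "\<And>n. x (Suc n) = x n + h n *\<^sub>R v n" "\<And>n. r (Suc n) = r n - h n * c n + \<epsilon> * h n"
    by metis
  have init: "t 0 = t0" "x 0 = x0" "r 0 = w0" by (simp_all add: t_def x_def r_def f(2))
  have tpos: "t n > 0" and Wr: "W (t n, x n) \<le> ereal (r n)" for n
    using f(1)[of n] by (auto simp: fe good_def)
  have hpos: "h n > 0" for n using st(1)[of n] by (simp add: admissible_step_def)
  have Lc: "L (x n + s *\<^sub>R v n, v n) \<le> c n" if "0 \<le> s" "s \<le> h n" for n s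
    using st(1)[of n] that by (auto simp: admissible_step_def)
  have cpos: "c n \<ge> 0" for n using Lc[of 0 n] L_nonneg[of "x n + 0 *\<^sub>R v n" "v n"] hpos[of n] by simp
  have rpos: "r n \<ge> 0" for n using Wr[of n] W_nonneg[OF tpos[of n], of "x n"] by (meson ereal_less_eq(5) order_trans)
  have sumh: "(\<Sum>k<n. h k) = t0 - t n" for n by (induction n) (auto simp: init st(3))
  have sumc: "(\<Sum>k<n. h k * c k) = w0 - r n + \<epsilon> * (t0 - t n)" for n
    by (induction n) (auto simp: init st(3,5) algebra_simps)
  have sh: "summable h"
  proof (rule bounded_imp_summable)
    show "(\<Sum>k\<le>n. h k) \<le> t0" for n using sumh[of "Suc n"] tpos[of "Suc n"] by (simp add: lessThan_Suc_atMost)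
  qed (use hpos in \<open>auto intro: less_imp_le\<close>)
  have sc: "summable (\<lambda>k. h k * c k)"
  proof (rule bounded_imp_summable)
    show "(\<Sum>k\<le>n. h k * c k) \<le> w0 + \<epsilon> * t0" for n
    proof -
      have "\<epsilon> * (t0 - t (Suc n)) \<le> \<epsilon> * t0" using \<epsilon> tpos[of "Suc n"] by simp
      thus ?thesis using sumc[of "Suc n"] rpos[of "Suc n"] by (simp add: lessThan_Suc_atMost)
    qed
  qed (use hpos cpos in \<open>auto intro: less_imp_le mult_nonneg_nonneg\<close>)
  define ts where "ts = t0 - (\<Sum>k. h k)"
  have tlim: "t \<longlonglongrightarrow> ts"
  proof -
    have "(\<lambda>n. t0 - (\<Sum>k<n. h k)) \<longlonglongrightarrow> ts" unfolding ts_def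
      by (intro tendsto_intros summable_LIMSEQ sh)
    thus ?thesis by (simp add: sumh)
  qed
  define rs where "rs = w0 + \<epsilon> * (t0 - ts) - (\<Sum>k. h k * c k)"
  have rlim: "r \<longlonglongrightarrow> rs"
  proof -
    have "(\<lambda>n. w0 + \<epsilon> * (t0 - t n) - (\<Sum>k<n. h k * c k)) \<longlonglongrightarrow> rs" unfolding rs_def
      by (intro tendsto_intros summable_LIMSEQ sc tlim)
    thus ?thesis by (simp add: sumc)
  qed
  have sv: "summable (\<lambda>k. h k *\<^sub>R v k)"
  proof (rule summable_comparison_test)
    have "norm (h k *\<^sub>R v k) \<le> h k * c k + M * h k" for k
    proof -
      have "norm (v k) \<le> c k + M" using M[of "v k" "x k"] Lc[of 0 k] hpos[of k] by simp
      hence "h k * norm (v k) \<le> h k * (c k + M)" using hpos[of k] by simp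
      thus ?thesis using hpos[of k] by (simp add: algebra_simps)
    qed
    thus "\<exists>N. \<forall>n\<ge>N. norm (h n *\<^sub>R v n) \<le> h n * c n + M * h n" by blast
    show "summable (\<lambda>n. h n * c n + M * h n)" by (intro summable_add summable_mult sc sh)
  qed
  define xs where "xs = x0 + (\<Sum>k. h k *\<^sub>R v k)"
  have xlim: "x \<longlonglongrightarrow> xs"
  proof -
    have "x n = x0 + (\<Sum>k<n. h k *\<^sub>R v k)" for n by (induction n) (auto simp: init st(4))
    hence eq: "x = (\<lambda>n. x0 + (\<Sum>k<n. h k *\<^sub>R v k))" by (rule ext)
    show ?thesis unfolding eq xs_def by (intro tendsto_intros summable_LIMSEQ sv)
  qed
  have ts0: "ts \<ge> 0" by (rule tendsto_lowerbound[OF tlim]) (use tpos in \<open>simp_all add: less_imp_le\<close>)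
  have ts: "ts = 0"
  proof (rule ccontr)
    assume "ts \<noteq> 0"
    hence tsp: "ts > 0" using ts0 by simp
    have "W (ts, xs) \<le> ereal rs"
      by (rule lsc_on_sequentially[OF W_lsc _ _ tendsto_Pair[OF tlim xlim] Wr rlim]) (use tsp tpos in auto)
    from steps_near_limit[OF tsp tlim xlim rlim this \<epsilon>]
    obtain h0 where h0: "h0 > 0" "eventually (\<lambda>k. \<exists>h v c. h0 \<le> h \<and> admissible_step \<epsilon> (t k) (x k) (r k) h v c) sequentially"
      by blast
    have "eventually (\<lambda>k. h k < h0 / 2) sequentially"
      by (rule order_tendstoD(2)[OF summable_LIMSEQ_zero[OF sh]]) (use h0 in simp)
    with h0(2) have "eventually (\<lambda>k. False) sequentially"
    proof eventually_elim
      case (elim k)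
      then obtain h' v' c' where "h0 \<le> h'" "admissible_step \<epsilon> (t k) (x k) (r k) h' v' c'" by blast
      with st(2)[OF this(2)] elim(2) show False by simp
    qed
    thus False by simp
  qed
  \<comment> \<open>The initial condition enters through \<open>\<phi> xs \<le> Liminf\<close>: the
    budgets bound \<open>W\<close> along vertices that converge to \<open>(0, xs)\<close> with
    positive times.\<close>
  have "\<phi> xs \<le> ereal rs"
  proof (rule ccontr)
    assume "\<not> \<phi> xs \<le> ereal rs"
    hence "ereal rs < \<phi> xs" by simp
    then obtain e where e: "ereal rs < e" "e < \<phi> xs" using dense by blast
    have "\<phi> xs \<le> Liminf (at_right 0 \<times>\<^sub>F nhds xs) W" by (simp add: W_initial)
    hence "eventually (\<lambda>z. e < W z) (at_right 0 \<times>\<^sub>F nhds xs)" using e(2) unfolding le_Liminf_iff by blast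
    moreover have "filterlim (\<lambda>k. (t k, x k)) (at_right 0 \<times>\<^sub>F nhds xs) sequentially"
    proof (intro filterlim_Pair xlim)
      have "t k \<noteq> 0" for k using tpos[of k] by simp
      thus "filterlim t (at_right 0) sequentially" using tpos tlim ts by (auto simp: filterlim_at)
    qed
    ultimately have "eventually (\<lambda>k. e < W (t k, x k)) sequentially" by (rule eventually_compose_filterlim)
    moreover have "eventually (\<lambda>k. ereal (r k) < e) sequentially"
      using rlim e(1) by (intro order_tendstoD) (auto simp: lim_ereal)
    ultimately have "eventually (\<lambda>k. False) sequentially"
    proof eventually_elim
      case (elim k)
      with Wr[of k] show False by (meson leD less_le_trans less_trans)
    qed
    thus False by simp
  qed
  hence "\<phi> xs + ereal (\<Sum>k. h k * c k) \<le> ereal rs + ereal (\<Sum>k. h k * c k)" by (rule add_right_mono)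
  also have "\<dots> = ereal (w0 + \<epsilon> * t0)" by (simp add: rs_def ts)
  finally have fin: "\<phi> xs + ereal (\<Sum>k. h k * c k) \<le> ereal (w0 + \<epsilon> * t0)" .
  show ?thesis
    by (rule that[OF init(1,2) hpos st(3) tpos tlim[unfolded ts] st(4) Lc xlim sc fin])
qed

end

section \<open>The value function lies below the solution\<close>

context hj_solution
begin

text \<open>Off the countably many vertices and \<open>T\<close>, each time lies inside one edge,
  where the derivative is the edge velocity and the cost rate is at most \<open>c k\<close>.\<close>

lemma polygon_cost:
  fixes s h c :: "nat \<Rightarrow> real" and v :: "nat \<Rightarrow> 'a"
  assumes h: "\<And>k. 0 < h k" and s: "s 0 = 0" "\<And>k. s (Suc k) = s k + h k" "s \<longlonglongrightarrow> T" and T: "0 < T"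
    and y: "\<And>k \<sigma>. s k \<le> \<sigma> \<Longrightarrow> \<sigma> \<le> s (Suc k) \<Longrightarrow> y \<sigma> = x k + (\<sigma> - s k) *\<^sub>R v k"
    and c: "\<And>k \<sigma>. 0 \<le> \<sigma> \<Longrightarrow> \<sigma> \<le> h k \<Longrightarrow> L (x k + \<sigma> *\<^sub>R v k, v k) \<le> c k" "summable (\<lambda>k. h k * c k)"
  shows "(\<integral>\<^sup>+\<sigma>\<in>{0..T}. ennreal (L (y \<sigma>, vector_derivative y (at \<sigma> within {0..T}))) \<partial>lebesgue)
     \<le> ennreal (\<Sum>k. h k * c k)"
proof -
  have c0: "c k \<ge> 0" for k using c(1)[of 0 k] h[of k] L_nonneg[of "x k" "v k"] by simp
  have mono: "s j \<le> s k" if "j \<le> k" for j k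
    by (rule lift_Suc_mono_le[OF _ that]) (use s(2) less_imp_le[OF h] in simp)
  have sT: "s k \<le> T" for k using s(3) mono by (intro incseq_le) (auto simp: incseq_def)
  have bound: "L (y \<sigma>, vector_derivative y (at \<sigma> within {0..T})) \<le> c k"
    if \<sigma>: "s k < \<sigma>" "\<sigma> < s (Suc k)" for k \<sigma>
  proof -
    have "((\<lambda>\<sigma>. x k + (\<sigma> - s k) *\<^sub>R v k) has_vector_derivative v k) (at \<sigma>)"
      by (auto intro!: derivative_eq_intros)
    hence "(y has_vector_derivative v k) (at \<sigma>)"
      by (rule has_vector_derivative_transform_within_open[where S = "{s k<..<s (Suc k)}"])
         (use \<sigma> y[of k] in auto)
    hence "(y has_vector_derivative v k) (at \<sigma> within {0..T})"
      by (rule has_vector_derivative_at_within)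
    moreover have "\<sigma> \<in> {0..T}" using \<sigma> mono[of 0 k] s(1) sT[of "Suc k"] by simp
    ultimately have "vector_derivative y (at \<sigma> within {0..T}) = v k"
      using vector_derivative_within_closed_interval[OF T] by blast
    thus ?thesis using y[of k \<sigma>] c(1)[of "\<sigma> - s k" k] \<sigma> s(2)[of k] by simp
  qed
  have cover: "\<exists>k. s k \<le> \<sigma> \<and> \<sigma> < s (Suc k)" if "0 \<le> \<sigma>" "\<sigma> < T" for \<sigma>
  proof -
    have "eventually (\<lambda>k. \<sigma> < s k) sequentially" using s(3) that(2) by (rule order_tendstoD)
    hence ex: "\<exists>k. \<sigma> < s k" by (auto simp: eventually_sequentially)
    define n where "n = (LEAST k. \<sigma> < s k)"
    have n: "\<sigma> < s n" unfolding n_def using ex by (rule LeastI_ex)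
    have "n \<noteq> 0" using n s(1) that(1) by (cases n) auto
    then obtain k where k: "n = Suc k" by (cases n) auto
    have "\<not> \<sigma> < s k" using not_less_Least[of k "\<lambda>k. \<sigma> < s k"] k n_def by simp
    thus ?thesis using n k by (intro exI[of _ k]) auto
  qed
  have "AE \<sigma> in lebesgue. \<sigma> \<notin> insert T (range s)"
    by (intro AE_not_in null_sets_completionI countable_imp_null_set_lborel) simp
  hence "AE \<sigma> in lebesgue. ennreal (L (y \<sigma>, vector_derivative y (at \<sigma> within {0..T}))) * indicator {0..T} \<sigma>
      \<le> (\<Sum>k. ennreal (c k) * indicator {s k<..<s (Suc k)} \<sigma>)"
  proof eventually_elim
    case (elim \<sigma>)
    show ?case
    proof (cases "\<sigma> \<in> {0..T}")
      case True
      hence "0 \<le> \<sigma>" "\<sigma> < T" using elim by auto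
      then obtain k where k: "s k \<le> \<sigma>" "\<sigma> < s (Suc k)" using cover by blast
      hence k': "s k < \<sigma>" using elim by (metis insertCI le_less rangeI)
      have "ennreal (L (y \<sigma>, vector_derivative y (at \<sigma> within {0..T}))) * indicator {0..T} \<sigma>
        \<le> (\<Sum>k\<in>{k}. ennreal (c k) * indicator {s k<..<s (Suc k)} \<sigma>)"
        using bound[OF k' k(2)] True k k' by (simp add: ennreal_leI)
      also have "\<dots> \<le> (\<Sum>k. ennreal (c k) * indicator {s k<..<s (Suc k)} \<sigma>)"
        by (rule sum_le_suminf) auto
      finally show ?thesis .
    qed auto
  qed
  hence "(\<integral>\<^sup>+\<sigma>\<in>{0..T}. ennreal (L (y \<sigma>, vector_derivative y (at \<sigma> within {0..T}))) \<partial>lebesgue)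
     \<le> (\<integral>\<^sup>+\<sigma>. (\<Sum>k. ennreal (c k) * indicator {s k<..<s (Suc k)} \<sigma>) \<partial>lebesgue)"
    by (rule nn_integral_mono_AE)
  also have "\<dots> = (\<Sum>k. \<integral>\<^sup>+\<sigma>. ennreal (c k) * indicator {s k<..<s (Suc k)} \<sigma> \<partial>lebesgue)"
    by (intro nn_integral_suminf borel_measurable_times_ennreal borel_measurable_const
        borel_measurable_indicator) simp
  also have "\<dots> = (\<Sum>k. ennreal (h k * c k))"
  proof (rule suminf_cong)
    fix k
    have "(\<integral>\<^sup>+\<sigma>. ennreal (c k) * indicator {s k<..<s (Suc k)} \<sigma> \<partial>lebesgue) = ennreal (c k) * ennreal (h k)"
      using h[of k] by (subst nn_integral_cmult_indicator) (auto simp: s(2))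
    thus "(\<integral>\<^sup>+\<sigma>. ennreal (c k) * indicator {s k<..<s (Suc k)} \<sigma> \<partial>lebesgue) = ennreal (h k * c k)"
      using c0[of k] h[of k] by (simp add: ennreal_mult' mult.commute)
  qed
  also have "\<dots> = ennreal (\<Sum>k. h k * c k)"
    by (rule suminf_ennreal_eq[OF mult_nonneg_nonneg[OF less_imp_le[OF h] c0] summable_sums[OF c(2)]])
  finally show ?thesis .
qed

lemma value_function_le:
  assumes t0: "0 < t0"
  shows "value_function L \<phi> (t0, x0) \<le> W (t0, x0)"
proof (cases "W (t0, x0) = \<infinity>")
  case False
  then obtain w0 where w0: "W (t0, x0) = ereal w0"
    using W_nonneg[OF t0, of x0] by (cases "W (t0, x0)") auto
  obtain M where M: "M \<ge> 0" "\<And>x u. norm u \<le> L (x, u) + M"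
    using Theta_lower_bound[of 1] by auto
  have "value_function L \<phi> (t0, x0) \<le> ereal (w0 + \<epsilon> * t0)" if \<epsilon>: "\<epsilon> > 0" for \<epsilon>
  proof -
    obtain t x h v c xs where g:
      "t 0 = t0" "x 0 = x0" "\<And>k. 0 < h k" "\<And>k. t (Suc k) = t k - h k" "\<And>k. 0 < t k" "t \<longlonglongrightarrow> 0"
      "\<And>k. x (Suc k) = x k + h k *\<^sub>R v k" "\<And>k s. 0 \<le> s \<Longrightarrow> s \<le> h k \<Longrightarrow> L (x k + s *\<^sub>R v k, v k) \<le> c k"
      "x \<longlonglongrightarrow> xs" "summable (\<lambda>k. h k * c k)" "\<phi> xs + ereal (\<Sum>k. h k * c k) \<le> ereal (w0 + \<epsilon> * t0)"
      using greedy_polygon[OF t0 w0 \<epsilon> M(2)] by blast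
    define s where "s = (\<lambda>k. t0 - t k)"
    have s: "s 0 = 0" "\<And>k. s (Suc k) = s k + h k" "s \<longlonglongrightarrow> t0"
    proof -
      show "s 0 = 0" "\<And>k. s (Suc k) = s k + h k" by (simp_all add: s_def g)
      have "s \<longlonglongrightarrow> t0 - 0" unfolding s_def by (intro tendsto_intros g)
      thus "s \<longlonglongrightarrow> t0" by simp
    qed
    have sh: "summable h"
    proof -
      have "(\<Sum>k<n. h k) = s n" for n by (induction n) (auto simp: s)
      hence "h sums t0" using s(3) by (simp add: sums_def)
      thus ?thesis by (rule sums_summable)
    qed
    have "summable (\<lambda>k. h k * norm (v k))"
    proof (rule summable_comparison_test)
      have "norm (h k * norm (v k)) \<le> h k * c k + M * h k" for k
      proof -
        have "norm (v k) \<le> c k + M" using M(2)[of "v k" "x k"] g(8)[of 0 k] g(3)[of k] by simp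
        hence "h k * norm (v k) \<le> h k * (c k + M)" using g(3)[of k] by simp
        thus ?thesis using g(3)[of k] by (simp add: algebra_simps)
      qed
      thus "\<exists>N. \<forall>n\<ge>N. norm (h n * norm (v n)) \<le> h n * c n + M * h n" by blast
      show "summable (\<lambda>n. h n * c n + M * h n)" by (intro summable_add summable_mult g(10) sh)
    qed
    from polygon_curve[OF g(3) this s g(7,9)] obtain y where y: "abs_continuous y"
      "\<And>k \<sigma>. s k \<le> \<sigma> \<Longrightarrow> \<sigma> \<le> s (Suc k) \<Longrightarrow> y \<sigma> = x k + (\<sigma> - s k) *\<^sub>R v k" "y 0 = x0" "y t0 = xs"
      unfolding g(2) by metis
    have c0: "c k \<ge> 0" for k using g(8)[of 0 k] g(3)[of k] L_nonneg[of "x k" "v k"] by simp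
    have sum0: "0 \<le> (\<Sum>k. h k * c k)"
      by (rule suminf_nonneg[OF g(10)]) (rule mult_nonneg_nonneg[OF less_imp_le[OF g(3)] c0])
    have "value_function L \<phi> (t0, x0) \<le> cost L \<phi> t0 y"
      unfolding value_function_def prod.case
      by (rule INF_lower) (use y abs_continuous_imp_on_interval in auto)
    also have "\<dots> \<le> ereal (\<Sum>k. h k * c k) + \<phi> xs"
      unfolding cost_def y(4)
    proof (rule add_right_mono)
      have "enn2ereal (\<integral>\<^sup>+\<sigma>\<in>{0..t0}. ennreal (L (y \<sigma>, vector_derivative y (at \<sigma> within {0..t0}))) \<partial>lebesgue)
         \<le> enn2ereal (ennreal (\<Sum>k. h k * c k))"
        using polygon_cost[OF g(3) s t0 y(2) g(8) g(10)] by (simp add: less_eq_ennreal.rep_eq)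
      thus "enn2ereal (\<integral>\<^sup>+\<sigma>\<in>{0..t0}. ennreal (L (y \<sigma>, vector_derivative y (at \<sigma> within {0..t0}))) \<partial>lebesgue)
         \<le> ereal (\<Sum>k. h k * c k)" using sum0 by (simp add: enn2ereal_ennreal)
    qed
    also have "\<dots> \<le> ereal (w0 + \<epsilon> * t0)" using g(11) by (simp add: add.commute)
    finally show ?thesis .
  qed
  \<comment> \<open>With \<open>\<epsilon> = e / t0\<close> the excess is \<open>e\<close>.\<close>
  hence le: "value_function L \<phi> (t0, x0) \<le> ereal w0 + ereal e" if "e > 0" for e
    using that t0 by (metis divide_pos_pos nonzero_eq_divide_eq less_irrefl plus_ereal.simps(1))
  show ?thesis unfolding w0 by (rule ereal_le_epsilon2) (use le in blast)
qed simp

end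

section \<open>Growth of a solution along curves\<close>

context tonelli_lagrangian
begin

text \<open>Replacing the derivative by the density \<open>g\<close> gives a measurable integrand:
  \<open>L\<close> and the extended curve \<open>Y\<close> are continuous, \<open>G\<close> is
  Lebesgue measurable. Finite energy then makes it integrable, so that integrals of \<open>g\<close>
  and of the energy can be compared on subintervals.\<close>

lemma energy_representation:
  assumes y: "abs_continuous_on_interval 0 t y" and t: "0 < t"
    and fin: "(\<integral>\<^sup>+s\<in>{0..t}. ennreal (L (y s, vector_derivative y (at s within {0..t}))) \<partial>lebesgue) \<noteq> \<infinity>"
  obtains g E where "continuous_on {0..t} y"
    "\<And>a b. 0 \<le> a \<Longrightarrow> a \<le> b \<Longrightarrow> b \<le> t \<Longrightarrow> (g has_integral (y b - y a)) {a..b}"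
    "g absolutely_integrable_on {0..t}" "((\<lambda>s. L (y s, g s)) has_integral E) {0..t}" "0 \<le> E"
    "(\<integral>\<^sup>+s\<in>{0..t}. ennreal (L (y s, vector_derivative y (at s within {0..t}))) \<partial>lebesgue) = ennreal E"
proof -
  obtain g where g: "\<And>a b. 0 \<le> a \<Longrightarrow> a \<le> b \<Longrightarrow> b \<le> t \<Longrightarrow> (g has_integral (y b - y a)) {a..b}"
    "g absolutely_integrable_on {0..t}"
    "AE s in lebesgue. s \<in> {0..t} \<longrightarrow> vector_derivative y (at s within {0..t}) = g s"
    "continuous_on {0..t} y"
    using abs_continuous_on_interval_derivative[OF y t] by blast
  define Y where "Y = (\<lambda>s. y (clamp_real 0 t s))"
  define G where "G = (\<lambda>s. indicat_real {0..t} s *\<^sub>R g s)"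
  define f where "f = (\<lambda>s. indicat_real {0..t} s * L (Y s, G s))"
  have f_eq: "f s = (if s \<in> {0..t} then L (y s, g s) else 0)" for s
    by (auto simp: f_def Y_def G_def clamp_real_def)
  have f0: "0 \<le> f s" for s by (simp add: f_eq L_nonneg)
  have "continuous_on UNIV Y"
    unfolding Y_def
  proof (rule continuous_on_compose2[OF g(4)])
    show "continuous_on UNIV (clamp_real 0 t)" unfolding clamp_real_def by (intro continuous_intros)
    show "range (clamp_real 0 t) \<subseteq> {0..t}" using t by (auto simp: clamp_real_def)
  qed
  hence "Y \<in> borel_measurable lborel" using borel_measurable_continuous_onI by simp
  hence Ym: "Y \<in> borel_measurable lebesgue" by (rule measurable_completion)
  have Gm: "G \<in> borel_measurable lebesgue"
    using g(2) unfolding set_integrable_def G_def by (rule borel_measurable_integrable)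
  have "(\<lambda>s. (Y s, G s)) \<in> borel_measurable lebesgue" using Ym Gm by (rule borel_measurable_Pair)
  moreover have "L \<in> borel_measurable borel" using L_cont by (rule borel_measurable_continuous_onI)
  ultimately have "(\<lambda>s. L (Y s, G s)) \<in> borel_measurable lebesgue" by (rule measurable_compose)
  hence fm: "f \<in> borel_measurable lebesgue"
    unfolding f_def by (intro borel_measurable_times borel_measurable_indicator) auto
  have I: "(\<integral>\<^sup>+s\<in>{0..t}. ennreal (L (y s, vector_derivative y (at s within {0..t}))) \<partial>lebesgue)
      = (\<integral>\<^sup>+s. ennreal (f s) \<partial>lebesgue)" (is "?I = _")
  proof (rule nn_integral_cong_AE, use g(3) in eventually_elim)
    case (elim s)
    thus ?case by (auto simp: f_eq)
  qed
  have int: "integrable lebesgue f"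
    by (rule integrableI_nonneg[OF fm]) (use fin I f0 in \<open>auto simp: less_top\<close>)
  define E where "E = integral\<^sup>L lebesgue f"
  have "?I = ennreal E" unfolding I E_def
    by (rule nn_integral_eq_integral[OF int]) (use f0 in simp)
  moreover have "0 \<le> E" unfolding E_def using f0 by simp
  moreover have "((\<lambda>s. L (y s, g s)) has_integral E) {0..t}"
  proof -
    have "(f has_integral E) UNIV" unfolding E_def by (rule has_integral_integral_lebesgue[OF int])
    moreover have "f = (\<lambda>s. if s \<in> {0..t} then L (y s, g s) else 0)" using f_eq by (rule ext)
    ultimately have "((\<lambda>s. if s \<in> {0..t} then L (y s, g s) else 0) has_integral E) UNIV" by (simp only:)
    thus ?thesis by (simp only: has_integral_restrict_UNIV)
  qed
  ultimately show ?thesis using that g(1,2,4) by blast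
qed

text \<open>
  Slowing down the curve by the factor \<open>m\<close> caps its speed at \<open>M\<close>; since the final time is free, convexity
  makes the energy grow by at most \<open>L (x, 0)\<close> times the extra time.
\<close>

lemma capped_speed:
  assumes M: "0 < M" and m: "m = max 1 (norm u / M)"
  shows "1 \<le> m" "norm (u /\<^sub>R m) \<le> M" "m * L (x, u /\<^sub>R m) \<le> L (x, u) + (m - 1) * L (x, 0)"
    "norm u \<le> M * m" "m - 1 \<le> norm u / M"
proof -
  show m1: "1 \<le> m" by (simp add: m)
  have "norm u / M \<le> m" by (simp add: m)
  thus um: "norm u \<le> M * m" using M by (simp add: pos_divide_le_eq mult.commute)
  show "norm (u /\<^sub>R m) \<le> M" using um m1 by (simp add: field_simps)
  have "0 \<le> norm u / M" using M by simp
  thus "m - 1 \<le> norm u / M" unfolding m by linarith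
  have "L (x, (1 - 1 / m) *\<^sub>R 0 + (1 / m) *\<^sub>R u) \<le> (1 - 1 / m) * L (x, 0) + (1 / m) * L (x, u)"
    using convex_onD[OF L_convex, of "1 / m" 0 u] m1 by simp
  hence "m * L (x, u /\<^sub>R m) \<le> m * ((1 - 1 / m) * L (x, 0) + (1 / m) * L (x, u))"
    using m1 by (intro mult_left_mono) (auto simp: divide_inverse)
  also have "\<dots> = L (x, u) + (m - 1) * L (x, 0)" using m1 by (simp add: field_simps)
  finally show "m * L (x, u /\<^sub>R m) \<le> L (x, u) + (m - 1) * L (x, 0)" .
qed

end

section \<open>The solution lies below the value function\<close>

context hj_solution
begin

text \<open>\<open>m\<close> stretches time so that the speed is at most \<open>M\<close>, and
  \<open>D\<close> is the resulting duration. The curve is cut into short pieces, each replaced by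
  its chord run in the stretched time; the shift \<open>\<xi>\<close> lets the translated polygon
  end at any point near \<open>y t\<close>.\<close>

lemma W_along_slowed_curve:
  fixes y g :: "real \<Rightarrow> 'a"
  assumes t: "0 < t" and y: "continuous_on {0..t} y"
    and g: "\<And>a b. 0 \<le> a \<Longrightarrow> a \<le> b \<Longrightarrow> b \<le> t \<Longrightarrow> (g has_integral (y b - y a)) {a..b}"
    and E: "((\<lambda>s. L (y s, g s)) has_integral E) {0..t}"
    and M: "0 < M" and m: "m = (\<lambda>s. max 1 (norm (g s) / M))" and D: "(m has_integral D) {0..t}"
    and K: "\<And>s. s \<in> {0..t} \<Longrightarrow> L (y s, 0) \<le> K" and \<epsilon>: "0 < \<epsilon>"
  shows "\<exists>\<eta>>0. \<forall>\<tau> \<xi>. 0 < \<tau> \<and> norm \<xi> \<le> \<eta> \<longrightarrow>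
     W (\<tau> + D, y 0 + \<xi>) \<le> W (\<tau>, y t + \<xi>) + ereal (E + K * (D - t) + 2 * \<epsilon> * D)"
proof -
  have "bounded (y ` {0..t})" by (intro compact_imp_bounded compact_continuous_image y) simp
  then obtain B where "\<forall>x\<in>y ` {0..t}. norm x \<le> B" unfolding bounded_iff by blast
  hence B: "norm (y s) \<le> B" if "s \<in> {0..t}" for s using that by blast
  have B0: "B \<ge> 0" using order_trans[OF norm_ge_zero B[of 0]] t by simp
  define R where "R = B + 2 + M"
  obtain \<delta> where \<delta>: "\<delta> > 0" "\<And>x x' u u'. norm x \<le> R \<Longrightarrow> norm x' \<le> R \<Longrightarrow> norm u \<le> R \<Longrightarrow> norm u' \<le> R \<Longrightarrow>
    norm (x - x') \<le> \<delta> \<Longrightarrow> norm (u - u') \<le> \<delta> \<Longrightarrow> \<bar>L (x, u) - L (x', u')\<bar> < \<epsilon>"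
    using L_uniformly_continuous[OF \<epsilon>, of R] by metis
  define \<eta> where "\<eta> = min (\<delta> / 2) 1"
  have \<eta>: "\<eta> > 0" "\<eta> \<le> 1" "2 * \<eta> \<le> \<delta>" using \<delta>(1) by (auto simp: \<eta>_def)
  have "uniformly_continuous_on {0..t} y" by (intro compact_uniformly_continuous y) simp
  then obtain \<gamma> where \<gamma>: "\<gamma> > 0" "\<And>s s'. s \<in> {0..t} \<Longrightarrow> s' \<in> {0..t} \<Longrightarrow> dist s' s < \<gamma> \<Longrightarrow> dist (y s') (y s) < \<eta>"
    using \<eta>(1) unfolding uniformly_continuous_on_def by metis
  \<comment> \<open>The integrand that pays for everything: the energy, the cost \<open>K\<close>
    per unit of extra time, and two errors \<open>\<epsilon>\<close> per unit of stretched time, one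
    for freezing the position at \<open>y a\<close> and one for the shifted chord.\<close>
  define e where "e = (\<lambda>s. L (y s, g s) + K * (m s - 1) + 2 * \<epsilon> * m s)"
  have eint: "(e has_integral (E + K * (D - t) + 2 * \<epsilon> * D)) {0..t}"
  proof -
    have "((\<lambda>s. 1::real) has_integral t) {0..t}" using has_integral_const_real[of "1::real" 0 t] t by simp
    thus ?thesis unfolding e_def
      by (intro has_integral_add has_integral_mult_right has_integral_diff E D)
  qed
  have ion: "m integrable_on {a..b}" "e integrable_on {a..b}" if "0 \<le> a" "b \<le> t" for a b
    using integrable_on_subinterval[OF has_integral_integrable[OF D], of a b]
      integrable_on_subinterval[OF has_integral_integrable[OF eint], of a b] that by auto
  have piece: "W (\<tau> + integral {a..b} m, y a + \<xi>) \<le> W (\<tau>, y b + \<xi>) + ereal (integral {a..b} e)"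
    if ab: "0 \<le> a" "a < b" "b \<le> t" "b - a < \<gamma>" and \<tau>: "0 < \<tau>" and \<xi>: "norm \<xi> \<le> \<eta>" for a b \<tau> \<xi>
  proof -
    define d where "d = integral {a..b} m"
    have mi: "(m has_integral d) {a..b}" unfolding d_def using ion ab by (intro integrable_integral) auto
    have ei: "(e has_integral integral {a..b} e) {a..b}" using ion ab by (intro integrable_integral) auto
    have m1: "1 \<le> m s" for s by (simp add: m)
    have "b - a \<le> d"
      by (rule has_integral_le[OF _ mi, of "\<lambda>_. 1"]) (use has_integral_const_real[of "1::real" a b] ab m1 in auto)
    hence d0: "d > 0" using ab by simp
    \<comment> \<open>The mean of the capped velocity \<open>g s /\<^sub>R m s\<close> for the
      weight \<open>m s\<close>, whose total mass is \<open>d\<close>.\<close>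
    define w where "w = (y b - y a) /\<^sub>R d"
    have gi: "(g has_integral (y b - y a)) {a..b}" by (rule g) (use ab in auto)
    have "norm (y b - y a) \<le> M * d"
    proof -
      have "norm (integral {a..b} g) \<le> integral {a..b} (\<lambda>s. M * m s)"
      proof (rule integral_norm_bound_integral)
        show "g integrable_on {a..b}" using gi by (rule has_integral_integrable)
        show "(\<lambda>s. M * m s) integrable_on {a..b}"
          using has_integral_mult_right[OF mi] by (rule has_integral_integrable)
        show "norm (g s) \<le> M * m s" for s using capped_speed(4)[OF M, of "m s" "g s"] by (simp add: m)
      qed
        thus ?thesis unfolding integral_unique[OF gi] integral_unique[OF has_integral_mult_right[OF mi]] .
    qed
    moreover have "norm w = norm (y b - y a) / d" using d0 by (simp add: w_def divide_inverse mult.commute)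
    ultimately have wM: "norm w \<le> M" using d0 by (simp add: pos_divide_le_eq)
    have near: "norm (y s - y a) \<le> \<eta>" if "s \<in> {a..b}" for s
      using \<gamma>(2)[of a s] that ab by (simp add: dist_norm)
    have in0: "a \<in> {0..t}" "b \<in> {0..t}" using ab by auto
    have jensen: "d * L (y a, w) + \<epsilon> * d \<le> integral {a..b} e"
    proof -
      \<comment> \<open>Jensen's inequality through a subgradient at the mean velocity: its linear
        part, weighted by \<open>m\<close>, integrates to zero.\<close>
      obtain p where p: "\<And>z. L (y a, w) + p \<bullet> (z - w) \<le> L (y a, z)"
        using convex_on_subgradient[OF L_convex] by blast
      have pw: "(L (y a, w) + \<epsilon> - p \<bullet> w) * m s + p \<bullet> g s \<le> e s" if s: "s \<in> {a..b}" for s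
      proof -
        have ms: "m s = max 1 (norm (g s) / M)" by (simp add: m)
        note cs = capped_speed(1,2)[OF M ms] capped_speed(3)[OF M ms, of "y s"]
        define z where "z = g s /\<^sub>R m s"
        have s0: "s \<in> {0..t}" using s ab by auto
        have gz: "g s = m s *\<^sub>R z" using cs(1) by (simp add: z_def)
        have n: "norm (y a) \<le> R" "norm (y s) \<le> R" "norm z \<le> R"
          using B[OF in0(1)] B[OF s0] cs(2) B0 M unfolding R_def z_def by linarith+
        have "\<bar>L (y a, z) - L (y s, z)\<bar> < \<epsilon>"
          by (rule \<delta>(2)) (use n near[OF s] \<eta> in \<open>auto simp: norm_minus_commute\<close>)
        hence "L (y a, w) + p \<bullet> (z - w) \<le> L (y s, z) + \<epsilon>" using p[of z] by linarith
        hence "m s * (L (y a, w) + p \<bullet> (z - w)) \<le> m s * (L (y s, z) + \<epsilon>)"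
          using cs(1) by (intro mult_left_mono) auto
        moreover have "m s * L (y s, z) \<le> L (y s, g s) + (m s - 1) * L (y s, 0)"
          unfolding z_def by (rule cs(3))
        moreover have "(m s - 1) * L (y s, 0) \<le> (m s - 1) * K"
          using K[OF s0] cs(1) by (intro mult_left_mono) auto
        moreover have "m s * (p \<bullet> z) = p \<bullet> g s" unfolding gz by simp
        ultimately show ?thesis by (simp add: e_def inner_diff_right algebra_simps)
      qed
      have "((\<lambda>s. (L (y a, w) + \<epsilon> - p \<bullet> w) * m s + p \<bullet> g s) has_integral
          ((L (y a, w) + \<epsilon> - p \<bullet> w) * d + p \<bullet> (y b - y a))) {a..b}"
        using has_integral_linear[OF gi bounded_linear_inner_right[of p]]
        by (intro has_integral_add has_integral_mult_right mi) (simp add: o_def)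
      from has_integral_le[OF this ei pw]
      have "(L (y a, w) + \<epsilon> - p \<bullet> w) * d + p \<bullet> (y b - y a) \<le> integral {a..b} e" by blast
      moreover have "p \<bullet> (y b - y a) = (p \<bullet> w) * d" using d0 by (simp add: w_def)
      ultimately show ?thesis by (simp add: algebra_simps)
    qed
    have "W (\<tau> + d, (y b + \<xi>) - d *\<^sub>R w) \<le> W (\<tau>, y b + \<xi>) + ereal (d * (L (y a, w) + \<epsilon>))"
    proof (rule W_along_segment[OF \<tau>])
      show "0 \<le> d" using d0 by simp
      fix s assume s: "0 \<le> s" "s \<le> d"
      have "y b + \<xi> - s *\<^sub>R w - y a = (1 - s / d) *\<^sub>R (y b - y a) + \<xi>"
        by (simp add: w_def algebra_simps divide_inverse)
      also have "norm \<dots> \<le> (1 - s / d) * norm (y b - y a) + norm \<xi>"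
        using norm_triangle_ineq[of "(1 - s / d) *\<^sub>R (y b - y a)" \<xi>] s d0 by simp
      also have "\<dots> \<le> 1 * norm (y b - y a) + norm \<xi>"
        using s d0 by (intro add_right_mono mult_right_mono) auto
      finally have nn: "norm (y b + \<xi> - s *\<^sub>R w - y a) \<le> 2 * \<eta>" using near[of b] ab \<xi> by simp
      have "norm (y b + \<xi> - s *\<^sub>R w) \<le> norm (y a) + 2 * \<eta>"
        using norm_triangle_ineq[of "y a" "y b + \<xi> - s *\<^sub>R w - y a"] nn by simp
      hence "norm (y b + \<xi> - s *\<^sub>R w) \<le> R" "norm (y a) \<le> R" "norm w \<le> R"
        using B[OF in0(1)] wM \<eta> B0 M unfolding R_def by linarith+
      hence "\<bar>L (y b + \<xi> - s *\<^sub>R w, w) - L (y a, w)\<bar> < \<epsilon>"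
        using nn \<eta> by (intro \<delta>(2)) auto
      thus "L (y b + \<xi> - s *\<^sub>R w, w) \<le> L (y a, w) + \<epsilon>" by linarith
    qed
    also have "(y b + \<xi>) - d *\<^sub>R w = y a + \<xi>" using d0 by (simp add: w_def)
    also have "W (\<tau>, y b + \<xi>) + ereal (d * (L (y a, w) + \<epsilon>)) \<le> W (\<tau>, y b + \<xi>) + ereal (integral {a..b} e)"
      using jensen by (intro add_left_mono) (simp add: algebra_simps)
    finally show ?thesis by (simp add: d_def)
  qed
  obtain N :: nat where N: "t / \<gamma> < real N" using reals_Archimedean2 by blast
  hence N0: "N > 0" using t \<gamma>(1) by (cases N) (auto simp: divide_less_0_iff)
  define h where "h = t / real N"
  have h: "h > 0" "h < \<gamma>" using N N0 t \<gamma>(1) by (auto simp: h_def field_simps)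
  have hN: "real N * h = t" using N0 by (simp add: h_def)
  have "W (\<tau> + D, y 0 + \<xi>) \<le> W (\<tau>, y t + \<xi>) + ereal (E + K * (D - t) + 2 * \<epsilon> * D)"
    if \<tau>: "0 < \<tau>" and \<xi>: "norm \<xi> \<le> \<eta>" for \<tau> \<xi>
  proof -
    \<comment> \<open>The time left accumulates from the end of the curve, so the pieces are added
      from \<open>t\<close> backwards.\<close>
    define a where "a = (\<lambda>i. t - real i * h)"
    have "i \<le> N \<Longrightarrow> W (\<tau> + integral {a i..t} m, y (a i) + \<xi>) \<le> W (\<tau>, y t + \<xi>) + ereal (integral {a i..t} e)" for i
    proof (induction i)
      case 0 thus ?case by (simp add: a_def)
    next
      case (Suc i)
      have "real (Suc i) * h \<le> real N * h" using Suc.prems h(1) by (intro mult_right_mono) auto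
      hence a: "0 \<le> a (Suc i)" "a (Suc i) < a i" "a i \<le> t" "a i - a (Suc i) < \<gamma>"
        using h hN by (auto simp: a_def algebra_simps)
      have m0: "0 \<le> integral {a i..t} m"
        by (rule integral_nonneg) (use ion a in \<open>auto simp: m\<close>)
      have "W ((\<tau> + integral {a i..t} m) + integral {a (Suc i)..a i} m, y (a (Suc i)) + \<xi>)
          \<le> W (\<tau> + integral {a i..t} m, y (a i) + \<xi>) + ereal (integral {a (Suc i)..a i} e)"
        by (rule piece[OF a _ \<xi>]) (use \<tau> m0 in simp)
      also have "\<dots> \<le> (W (\<tau>, y t + \<xi>) + ereal (integral {a i..t} e)) + ereal (integral {a (Suc i)..a i} e)"
        using Suc by (intro add_right_mono) simp
      also have "\<dots> = W (\<tau>, y t + \<xi>) + ereal (integral {a (Suc i)..a i} e + integral {a i..t} e)"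
        by (cases "W (\<tau>, y t + \<xi>)") auto
      also have "integral {a (Suc i)..a i} e + integral {a i..t} e = integral {a (Suc i)..t} e"
        using a by (intro Henstock_Kurzweil_Integration.integral_combine ion) auto
      also have "(\<tau> + integral {a i..t} m) + integral {a (Suc i)..a i} m = \<tau> + integral {a (Suc i)..t} m"
        using Henstock_Kurzweil_Integration.integral_combine[of "a (Suc i)" "a i" t m] a ion by simp
      finally show ?case .
    qed
    from this[of N] have "W (\<tau> + integral {0..t} m, y 0 + \<xi>) \<le> W (\<tau>, y t + \<xi>) + ereal (integral {0..t} e)"
      using hN by (simp add: a_def)
    thus ?thesis using integral_unique[OF D] integral_unique[OF eint] by simp
  qed
  thus ?thesis using \<eta>(1) by blast
qed

text \<open>For any \<open>f\<close> above \<open>\<phi> (y t)\<close> the initial condition gives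
  points \<open>(\<tau>, x)\<close> near \<open>(0, y t)\<close> with \<open>W\<close> below
  \<open>f\<close>. The shifted, slowed curve carries this bound to
  \<open>(\<tau> + D, y 0 + \<xi>)\<close>; these points tend to \<open>(t, y 0)\<close>, where
  lower semicontinuity concludes.\<close>

lemma W_le_cost:
  assumes t: "0 < t" and y: "abs_continuous_on_interval 0 t y"
  shows "W (t, y 0) \<le> cost L \<phi> t y"
proof (cases "(\<integral>\<^sup>+s\<in>{0..t}. ennreal (L (y s, vector_derivative y (at s within {0..t}))) \<partial>lebesgue) = \<infinity>")
  case True
  hence "cost L \<phi> t y = \<infinity>" unfolding cost_def True by simp
  thus ?thesis by simp
next
  case False
  obtain g E where c: "continuous_on {0..t} y"
    and g: "\<And>a b. 0 \<le> a \<Longrightarrow> a \<le> b \<Longrightarrow> b \<le> t \<Longrightarrow> (g has_integral (y b - y a)) {a..b}"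
    "g absolutely_integrable_on {0..t}" and E: "((\<lambda>s. L (y s, g s)) has_integral E) {0..t}" "0 \<le> E"
    and I: "(\<integral>\<^sup>+s\<in>{0..t}. ennreal (L (y s, vector_derivative y (at s within {0..t}))) \<partial>lebesgue) = ennreal E"
    using energy_representation[OF y t False] by blast
  have cost: "cost L \<phi> t y = ereal E + \<phi> (y t)"
    unfolding cost_def I using E(2) by (simp add: enn2ereal_ennreal)
  have "bounded ((\<lambda>s. L (y s, 0)) ` {0..t})"
  proof (intro compact_imp_bounded compact_continuous_image)
    show "continuous_on {0..t} (\<lambda>s. L (y s, 0))"
      by (rule continuous_on_compose2[OF L_cont]) (auto intro!: continuous_intros c)
  qed simp
  then obtain K where "\<forall>r\<in>(\<lambda>s. L (y s, 0)) ` {0..t}. norm r \<le> K" unfolding bounded_iff by blast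
  hence "norm (L (y s, 0)) \<le> K" if "s \<in> {0..t}" for s using that by blast
  hence K: "L (y s, 0) \<le> K" if "s \<in> {0..t}" for s using abs_ge_self order_trans that unfolding real_norm_def by blast
  have K0: "K \<ge> 0" using K[of 0] L_nonneg[of "y 0" 0] t by simp
  define \<Gamma> where "\<Gamma> = integral {0..t} (\<lambda>s. norm (g s))"
  have gn: "(\<lambda>s. norm (g s)) integrable_on {0..t}"
    using g(2) absolutely_integrable_on_def by blast
  have \<Gamma>0: "\<Gamma> \<ge> 0" unfolding \<Gamma>_def by (rule integral_nonneg[OF gn]) simp
  have approx: "\<exists>T \<xi>. 0 < T \<and> \<bar>T - t\<bar> \<le> 2 * \<rho> \<and> norm \<xi> \<le> \<rho> \<and> W (T, y 0 + \<xi>) \<le> ereal (f + E + \<rho>)"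
    if \<rho>: "0 < \<rho>" "\<rho> \<le> 1" and f: "\<phi> (y t) < ereal f" for \<rho> f
  proof -
    \<comment> \<open>Since \<open>D - t \<le> \<Gamma> / M\<close>, this \<open>M\<close> makes
      \<open>(1 + K) * (D - t)\<close> at most \<open>\<rho> / 2\<close>, which controls both the
      extra time and its cost.\<close>
    define M where "M = 2 * (1 + K) * (\<Gamma> + 1) / \<rho>"
    have M: "M > 0" using K0 \<Gamma>0 \<rho> by (simp add: M_def)
    define m where "m = (\<lambda>s. max 1 (norm (g s) / M))"
    have "m integrable_on {0..t}"
    proof -
      have "(\<lambda>s. norm (g s) / M) absolutely_integrable_on {0..t}"
        using absolutely_integrable_norm[OF g(2)] by (auto simp: o_def divide_inverse)
      hence "m absolutely_integrable_on {0..t}" unfolding m_def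
        by (intro absolutely_integrable_max_1) auto
      thus ?thesis using absolutely_integrable_on_def by blast
    qed
    then obtain D where D: "(m has_integral D) {0..t}" by blast
    have one: "((\<lambda>s. 1::real) has_integral t) {0..t}" using has_integral_const_real[of "1::real" 0 t] t by simp
    have tD: "t \<le> D" by (rule has_integral_le[OF one D]) (simp add: m_def)
    have Dt: "D - t \<le> \<Gamma> / M"
    proof (rule has_integral_le[OF has_integral_diff[OF D one]])
      show "((\<lambda>s. norm (g s) / M) has_integral \<Gamma> / M) {0..t}"
        unfolding \<Gamma>_def by (intro has_integral_divide integrable_integral gn)
      show "m s - 1 \<le> norm (g s) / M" for s using capped_speed(5)[OF M, of "m s" "g s"] by (simp add: m_def)
    qed
    have D1: "(1 + K) * (D - t) \<le> \<rho> / 2"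
    proof -
      have "\<Gamma> / M = \<rho> / (2 * (1 + K)) * (\<Gamma> / (\<Gamma> + 1))" using \<rho> by (simp add: M_def)
      also have "\<dots> \<le> \<rho> / (2 * (1 + K)) * 1" using K0 \<Gamma>0 \<rho> by (intro mult_left_mono) auto
      finally have "\<Gamma> / M \<le> \<rho> / (2 * (1 + K))" by simp
      hence "(1 + K) * (D - t) \<le> (1 + K) * (\<rho> / (2 * (1 + K)))" using Dt K0 by (intro mult_left_mono) auto
      also have "\<dots> = \<rho> / 2" using K0 by (simp add: field_simps)
      finally show ?thesis .
    qed
    have KD: "0 \<le> K * (D - t)" "0 \<le> D - t" using K0 tD by auto
    have D2: "D - t \<le> \<rho>" "K * (D - t) \<le> \<rho> / 2" using D1 KD \<rho> by (auto simp: algebra_simps)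
    \<comment> \<open>Chosen for \<open>2 * \<epsilon> * D \<le> \<rho> / 2\<close>, using
      \<open>D \<le> t + 1\<close>.\<close>
    define \<epsilon> where "\<epsilon> = \<rho> / (4 * (t + 1))"
    have \<epsilon>: "\<epsilon> > 0" using \<rho> t by (simp add: \<epsilon>_def)
    have "2 * \<epsilon> * D \<le> 2 * \<epsilon> * (t + 1)" using D2 \<rho> \<epsilon> by (intro mult_left_mono) auto
    also have "\<dots> = \<rho> / 2" using t by (simp add: \<epsilon>_def field_simps)
    finally have \<epsilon>D: "2 * \<epsilon> * D \<le> \<rho> / 2" .
    obtain \<eta> where \<eta>: "\<eta> > 0" "\<And>\<tau> \<xi>. 0 < \<tau> \<Longrightarrow> norm \<xi> \<le> \<eta> \<Longrightarrow>
        W (\<tau> + D, y 0 + \<xi>) \<le> W (\<tau>, y t + \<xi>) + ereal (E + K * (D - t) + 2 * \<epsilon> * D)"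
      using W_along_slowed_curve[OF t c g(1) E(1) M m_def D K \<epsilon>] by blast
    \<comment> \<open>The half \<open>Liminf \<le> \<phi>\<close> of the initial condition:
      arbitrarily near \<open>(0, y t)\<close> some points carry values below
      \<open>f\<close>.\<close>
    have "\<not> eventually (\<lambda>z. ereal f \<le> W z) (at_right 0 \<times>\<^sub>F nhds (y t))"
    proof
      assume "eventually (\<lambda>z. ereal f \<le> W z) (at_right 0 \<times>\<^sub>F nhds (y t))"
      hence "ereal f \<le> Liminf (at_right 0 \<times>\<^sub>F nhds (y t)) W" by (rule Liminf_bounded)
      thus False using f W_initial[of "y t"] by simp
    qed
    moreover have "eventually (\<lambda>z. 0 < fst z \<and> fst z < \<rho> \<and> norm (snd z - y t) < min \<eta> \<rho>) (at_right 0 \<times>\<^sub>F nhds (y t))"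
    proof (rule eventually_prod_filter[THEN iffD2], intro exI conjI)
      show "eventually (\<lambda>\<tau>. 0 < \<tau> \<and> \<tau> < \<rho>) (at_right (0::real))"
        using \<rho> by (auto simp: eventually_at_right_field)
      show "eventually (\<lambda>x. norm (x - y t) < min \<eta> \<rho>) (nhds (y t))"
        using \<eta> \<rho> by (intro eventually_nhds_metric[THEN iffD2] exI[of _ "min \<eta> \<rho>"]) (auto simp: dist_norm)
    qed auto
    ultimately have "\<exists>z. \<not> ereal f \<le> W z \<and> 0 < fst z \<and> fst z < \<rho> \<and> norm (snd z - y t) < min \<eta> \<rho>"
      using eventually_mono by (metis (mono_tags, lifting))
    then obtain \<tau> x where z: "\<not> ereal f \<le> W (\<tau>, x)" "0 < \<tau>" "\<tau> < \<rho>" "norm (x - y t) < min \<eta> \<rho>" by auto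
    define \<xi> where "\<xi> = x - y t"
    have "W (\<tau> + D, y 0 + \<xi>) \<le> W (\<tau>, y t + \<xi>) + ereal (E + K * (D - t) + 2 * \<epsilon> * D)"
      using z by (intro \<eta>(2)) (auto simp: \<xi>_def)
    also have "\<dots> \<le> ereal f + ereal (E + \<rho>)"
      using z(1) D2(2) \<epsilon>D by (intro add_mono) (auto simp: \<xi>_def)
    finally have "W (\<tau> + D, y 0 + \<xi>) \<le> ereal (f + E + \<rho>)" by (simp add: add.assoc)
    moreover have "0 < \<tau> + D" "\<bar>\<tau> + D - t\<bar> \<le> 2 * \<rho>" using z D2 KD t tD by auto
    ultimately show ?thesis using z(4) unfolding \<xi>_def
      by (intro exI[of _ "\<tau> + D"] exI[of _ "x - y t"]) auto
  qed
  show ?thesis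
  proof (rule ccontr)
    assume "\<not> ?thesis"
    hence "ereal E + \<phi> (y t) < W (t, y 0)" by (simp add: cost)
    then obtain q where q: "ereal E + \<phi> (y t) < ereal q" "ereal q < W (t, y 0)"
      using ereal_dense2 by blast
    define f where "f = q - E"
    have f: "\<phi> (y t) < ereal f" using q(1) by (cases "\<phi> (y t)") (auto simp: f_def)
    define \<rho> where "\<rho> = (\<lambda>n. inverse (real (Suc n)))"
    have \<rho>: "\<rho> n > 0" "\<rho> n \<le> 1" for n by (auto simp: \<rho>_def divide_simps)
    have \<rho>0: "\<rho> \<longlonglongrightarrow> 0" unfolding \<rho>_def by (rule LIMSEQ_inverse_real_of_nat)
    have "\<forall>n. \<exists>T \<xi>. 0 < T \<and> \<bar>T - t\<bar> \<le> 2 * \<rho> n \<and> norm \<xi> \<le> \<rho> n \<and> W (T, y 0 + \<xi>) \<le> ereal (f + E + \<rho> n)"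
      using approx[OF \<rho> f] by blast
    then obtain T \<xi> where T\<xi>: "\<And>n. 0 < T n" "\<And>n. \<bar>T n - t\<bar> \<le> 2 * \<rho> n" "\<And>n. norm (\<xi> n) \<le> \<rho> n"
        "\<And>n. W (T n, y 0 + \<xi> n) \<le> ereal (f + E + \<rho> n)" by metis
    have "(\<lambda>n. T n - t) \<longlonglongrightarrow> 0"
    proof (rule Lim_null_comparison)
      show "eventually (\<lambda>n. norm (T n - t) \<le> 2 * \<rho> n) sequentially" using T\<xi>(2) by simp
      show "(\<lambda>n. 2 * \<rho> n) \<longlonglongrightarrow> 0" using tendsto_mult[OF tendsto_const \<rho>0, of 2] by simp
    qed
    hence Tlim: "T \<longlonglongrightarrow> t" by (rule LIM_zero_cancel)
    have "\<xi> \<longlonglongrightarrow> 0" by (rule Lim_null_comparison[OF _ \<rho>0]) (use T\<xi>(3) in simp)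
    hence xlim: "(\<lambda>n. y 0 + \<xi> n) \<longlonglongrightarrow> y 0" using tendsto_add[OF tendsto_const, of \<xi> 0 _ "y 0"] by simp
    have "(\<lambda>n. f + E + \<rho> n) \<longlonglongrightarrow> f + E + 0" by (intro tendsto_intros \<rho>0)
    hence "W (t, y 0) \<le> ereal (f + E + 0)"
      by (intro lsc_on_sequentially[OF W_lsc _ _ tendsto_Pair[OF Tlim xlim] T\<xi>(4)]) (use t T\<xi>(1) in auto)
    thus False using q(2) by (simp add: f_def)
  qed
qed

end

theorem theorem1p4:
  fixes L :: "(real^'n) \<times> (real^'n) \<Rightarrow> real"
    and \<Theta> :: "real^'n \<Rightarrow> real"
    and \<phi> :: "real^'n \<Rightarrow> ereal"
    and W :: "real \<times> (real^'n) \<Rightarrow> ereal"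
  assumes phi_nonneg: "\<And>x. 0 \<le> \<phi> x"
    and phi_lsc: "lsc_on UNIV \<phi>"
    and L_nonneg: "\<And>x u. 0 \<le> L (x, u)"
    and L_bounded: "locally_bounded L"
    and L_lsc: "lsc_on UNIV (\<lambda>z. ereal (L z))"
    and L_convex: "\<And>x. convex_on UNIV (\<lambda>u. L (x, u))"
    and Theta_nonneg: "\<And>u. 0 \<le> \<Theta> u"
    and Theta_superlinear: "filterlim (\<lambda>u. \<Theta> u / norm u) at_top at_infinity"
    and L_ge_Theta: "\<And>x u. \<Theta> u \<le> L (x, u)"
    and L_cont: "continuous_on UNIV L"
    and W_nonneg: "\<And>t x. 0 < t \<Longrightarrow> 0 \<le> W (t, x)"
    and W_lsc: "lsc_on ({0<..} \<times> UNIV) W"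
    and i: "\<And>x. Liminf (at_right 0 \<times>\<^sub>F nhds x) W = \<phi> x"
    and ii: "\<And>t x. (t, x) \<in> dom_on ({0<..} \<times> UNIV) W \<Longrightarrow>
               contingent_derivative W (t, x) (0, 0) = 0"
    and iii: "\<And>t x. (t, x) \<in> dom_on ({0<..} \<times> UNIV) W \<Longrightarrow>
               \<exists>u. contingent_derivative W (t, x) (-1, u) < \<infinity>"
    and iv: "\<And>t x p\<^sub>t p\<^sub>x. 0 < t \<Longrightarrow> (p\<^sub>t, p\<^sub>x) \<in> subdifferential W (t, x) \<Longrightarrow>
               ereal p\<^sub>t + hamiltonian L x (- p\<^sub>x) = 0"
  shows "\<forall>t>0. \<forall>x. W (t, x) = value_function L \<phi> (t, x)"
proof (intro allI impI)
  interpret hj_solution L \<Theta> \<phi> W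
    by unfold_locales (rule L_nonneg L_convex Theta_superlinear L_ge_Theta L_cont W_nonneg W_lsc i ii iv; assumption?)+
  fix t :: real and x :: "real^'n"
  assume t: "0 < t"
  show "W (t, x) = value_function L \<phi> (t, x)"
  proof (rule antisym)
    show "W (t, x) \<le> value_function L \<phi> (t, x)"
      unfolding value_function_def prod.case using W_le_cost[OF t] by (intro INF_greatest) auto
    show "value_function L \<phi> (t, x) \<le> W (t, x)" by (rule value_function_le[OF t])
  qed
qed

end
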